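(* Let $X_1,\dots,X_n$ be independent random variables with common density $f$, and let the kernel $K:\mathbb R\to\mathbb R$, the bandwidth maps $(h_k)_{k\geqslant1}$ and the finite sets $\Gamma_n$ be as in the context, with $\gamma_{\max}:=\max\Gamma_n$. Assume that $K$ is symmetric, $K(0)>0$, $\int_{\mathbb R}K(y)\,dy=1$, $$\frac{\|K\|_\infty\|K\|_1}{n\,h_n(\gamma_{\max})}\leqslant1,$$ and $\|f\|_\infty<\infty$. Let $\lambda\in[1,\infty)$ and $\varepsilon\in(0,1)$, and let $\widetilde\gamma_n\in\arg\min_{\gamma\in\Gamma_n}\mathrm{Crit}(\gamma)$. Then there exist three deterministic constants $c_1,c_2,c_3>0$, not depending on $n$, $\lambda$ and $\gamma$, such that with probability larger than $1-c_1|\Gamma_n|e^{-\lambda}$, $$\|\widehat f_{n,\mathbf h_n(\widetilde\gamma_n)}-f\|_2^2\leqslant(1+\varepsilon)\min_{\gamma\in\Gamma_n}\|\widehat f_{n,\mathbf h_n(\gamma)}-f\|_2^2+\frac{c_2}{\varepsilon}\|f_{n,\gamma_{\max}}-f\|_2^2+\frac{c_3}{\varepsilon}\left(\frac{\lambda^2}n+\frac{\lambda^3}{n^2h_n(\gamma_{\max})}\right).$$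
   Context: $\|\cdot\|_p$ is the $L^p(\mathbb R,dx)$ norm; $\langle\cdot,\cdot\rangle_2$ is the inner product of $L^2(\mathbb R,dx)$; $\ast$ is convolution on $\mathbb R$; $K_\varepsilon:=(1/\varepsilon)K(\cdot/\varepsilon)$ for $\varepsilon>0$; $|\Gamma_n|$ is the cardinality of $\Gamma_n$. The constants are uniform over all positive integers $n$ for which the assumptions hold. Bandwidths: $h_k:[0,1]\to(0,\infty)$, $k\geqslant1$, are maps such that (for the $n$ considered) $0<h_n(\gamma')<\dots<h_1(\gamma')$ for every $\gamma'\in[0,1]$, and $h_n(\cdot)$ is decreasing and one-to-one from $[0,1]$ into $(0,1]$. We write $\mathbf h_n(\gamma):=(h_1(\gamma),\dots,h_n(\gamma))$. The set $\Gamma_n=\{\gamma_1,\dots,\gamma_{N(n)}\}\subset[0,1]$ has $N(n)\in\{1,\dots,n\}$ and $0<\gamma_1<\dots<\gamma_{N(n)}\leqslant h_n^{-1}(1/n)$. Estimator and its mean: for $\gamma\in[0,1]$ and $x\in\mathbb R$, $$\widehat f_{n,\mathbf h_n(\gamma)}(x):=\frac1n\sum_{k=1}^n\frac1{h_k(\gamma)}K\left(\frac{X_k-x}{h_k(\gamma)}\right),\qquad f_{n,\gamma}(x):=\mathbb E(\widehat f_{n,\mathbf h_n(\gamma)}(x))=\frac1n\sum_{k=1}^n(K_{h_k(\gamma)}\ast f)(x).$$ Criterion: for $\gamma\in\Gamma_n$, $$\mathrm{Crit}(\gamma):=\|\widehat f_{n,\mathbf h_n(\gamma)}-\widehat f_{n,\mathbf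 h_n(\gamma_{\max})}\|_2^2+\mathrm{pen}(\gamma),\qquad\mathrm{pen}(\gamma):=\frac2{n^2}\sum_{k=1}^n\langle K_{h_k(\gamma_{\max})},K_{h_k(\gamma)}\rangle_2.$$ *)

theory Defs
  imports "HOL-Probability.Probability" "HOL-Probability.Essential_Supremum"
begin

text \<open>Norms and inner product of \<open>L\<^sup>p(\<real>, dx)\<close>. For finite \<open>p\<close> the norm is real-valued, hence (Bochner
  integral) \<open>0\<close> when \<open>\<bar>g\<bar>\<^sup>p\<close> is not integrable. The functions it is used for are a kernel
  in \<open>L\<^sup>1 \<inter> L\<^sup>\<infinity>\<close>, a bounded density, and finite sums of their rescalings and convolutions, which
  all lie in the relevant space. The supremum norm is extended-real-valued, so that its
  finiteness is a genuine hypothesis.\<close>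

definition Lp_norm :: "real \<Rightarrow> (real \<Rightarrow> real) \<Rightarrow> real" where
  "Lp_norm p g = (LINT x|lborel. \<bar>g x\<bar> powr p) powr (1 / p)"

definition Linf_norm :: "(real \<Rightarrow> real) \<Rightarrow> ereal" where
  "Linf_norm g = esssup lborel (\<lambda>x. ereal \<bar>g x\<bar>)"

definition L2_inner :: "(real \<Rightarrow> real) \<Rightarrow> (real \<Rightarrow> real) \<Rightarrow> real" where
  "L2_inner g g' = (LINT x|lborel. g x * g' x)"

lemma Lp_norm_1: "Lp_norm 1 g = (LINT x|lborel. \<bar>g x\<bar>)"
  by (simp add: Lp_norm_def)

lemma Lp_norm_2_sq: "(Lp_norm 2 g)\<^sup>2 = (LINT x|lborel. (g x)\<^sup>2)"
proof -
  have "0 \<le> (LINT x|lborel. (g x)\<^sup>2)"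
    by simp
  then show ?thesis
    by (simp add: Lp_norm_def powr_half_sqrt)
qed

definition conv :: "(real \<Rightarrow> real) \<Rightarrow> (real \<Rightarrow> real) \<Rightarrow> real \<Rightarrow> real" where
  "conv g g' x = (LINT y|lborel. g (x - y) * g' y)"

definition rescale :: "(real \<Rightarrow> real) \<Rightarrow> real \<Rightarrow> real \<Rightarrow> real" where
  "rescale K e = (\<lambda>x. (1 / e) * K (x / e))"

text \<open>\<open>the_inv_into {0..1} (h n) (1 / n)\<close> is \<open>h\<^sub>n\<^sup>-\<^sup>1(1/n)\<close>; it is only meaningful when \<open>1/n\<close> is a
  value of \<open>h\<^sub>n\<close>, whence the membership in the image.\<close>

definition admissible :: "(nat \<Rightarrow> real \<Rightarrow> real) \<Rightarrow> (nat \<Rightarrow> real set) \<Rightarrow> nat \<Rightarrow> bool" where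
  "admissible h \<Gamma> n \<longleftrightarrow>
     (\<forall>\<gamma>\<in>{0..1}. \<forall>i\<in>{1..n}. \<forall>j\<in>{1..n}. i < j \<longrightarrow> h j \<gamma> < h i \<gamma>) \<and>
     antimono_on {0..1} (h n) \<and> inj_on (h n) {0..1} \<and> h n ` {0..1} \<subseteq> {0<..1} \<and>
     finite (\<Gamma> n) \<and> \<Gamma> n \<subseteq> {0..1} \<and> card (\<Gamma> n) \<in> {1..n} \<and> (\<forall>\<gamma>\<in>\<Gamma> n. 0 < \<gamma>) \<and>
     1 / real n \<in> h n ` {0..1} \<and> Max (\<Gamma> n) \<le> the_inv_into {0..1} (h n) (1 / real n)"

definition fhat ::
  "(real \<Rightarrow> real) \<Rightarrow> (nat \<Rightarrow> real \<Rightarrow> real) \<Rightarrow> nat \<Rightarrow> (nat \<Rightarrow> real) \<Rightarrow> real \<Rightarrow> real \<Rightarrow> real" where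
  "fhat K h n xs \<gamma> x = (1 / real n) * (\<Sum>k=1..n. (1 / h k \<gamma>) * K ((xs k - x) / h k \<gamma>))"

definition fmean ::
  "(real \<Rightarrow> real) \<Rightarrow> (nat \<Rightarrow> real \<Rightarrow> real) \<Rightarrow> nat \<Rightarrow> 'a measure \<Rightarrow> (nat \<Rightarrow> 'a \<Rightarrow> real) \<Rightarrow> real \<Rightarrow> real \<Rightarrow> real"
where
  "fmean K h n M X \<gamma> x = (LINT \<omega>|M. fhat K h n (\<lambda>k. X k \<omega>) \<gamma> x)"

definition pen :: "(real \<Rightarrow> real) \<Rightarrow> (nat \<Rightarrow> real \<Rightarrow> real) \<Rightarrow> (nat \<Rightarrow> real set) \<Rightarrow> nat \<Rightarrow> real \<Rightarrow> real" where
  "pen K h \<Gamma> n \<gamma> =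
     (2 / (real n)\<^sup>2) * (\<Sum>k=1..n. L2_inner (rescale K (h k (Max (\<Gamma> n)))) (rescale K (h k \<gamma>)))"

definition Crit ::
  "(real \<Rightarrow> real) \<Rightarrow> (nat \<Rightarrow> real \<Rightarrow> real) \<Rightarrow> (nat \<Rightarrow> real set) \<Rightarrow> nat \<Rightarrow> (nat \<Rightarrow> real) \<Rightarrow> real \<Rightarrow> real" where
  "Crit K h \<Gamma> n xs \<gamma> =
     (Lp_norm 2 (\<lambda>x. fhat K h n xs \<gamma> x - fhat K h n xs (Max (\<Gamma> n)) x))\<^sup>2 + pen K h \<Gamma> n \<gamma>"

lemma fmean_eq_conv:
  assumes K: "integrable lborel K" "\<And>y. K (- y) = K y"
    and f: "f \<in> borel_measurable borel" "\<And>x. 0 \<le> f x" "Linf_norm f < \<infinity>"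
    and X: "\<And>k. k \<in> {1..n} \<Longrightarrow> distributed M lborel (X k) (\<lambda>x. ennreal (f x))"
    and h: "\<And>k. k \<in> {1..n} \<Longrightarrow> 0 < h k \<gamma>"
  shows "fmean K h n M X \<gamma> x = (1 / real n) * (\<Sum>k=1..n. conv (rescale K (h k \<gamma>)) f x)"
proof -
  have Kb: "K \<in> borel_measurable borel"
    using borel_measurable_integrable[OF K(1)] by simp
  have ae: "AE y in lborel. ereal \<bar>f y\<bar> \<le> Linf_norm f"
    unfolding Linf_norm_def by (rule esssup_AE)
  obtain C where C: "AE y in lborel. \<bar>f y\<bar> \<le> C"
  proof (cases "Linf_norm f")
    case (real r)
    then show ?thesis using ae by (intro that[of r]) auto
  next
    case PInf
    then show ?thesis using f(3) by simp
  next
    case MInf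
    then show ?thesis using ae by (intro that[of 0]) auto
  qed
  have *: "integrable M (\<lambda>\<omega>. K ((X k \<omega> - x) / h k \<gamma>)) \<and>
      (LINT \<omega>|M. (1 / h k \<gamma>) * K ((X k \<omega> - x) / h k \<gamma>)) = conv (rescale K (h k \<gamma>)) f x"
    if k: "k \<in> {1..n}" for k
  proof -
    let ?e = "h k \<gamma>"
    let ?g = "\<lambda>y. K ((y - x) / ?e)"
    have e: "0 < ?e" using h k by blast
    have gm: "?g \<in> borel_measurable lborel"
      using Kb by measurable
    have "integrable lborel (\<lambda>y. K (- x / ?e + (1 / ?e) * y))"
      using e by (intro lborel_integrable_real_affine K(1)) simp
    then have gi: "integrable lborel ?g"
      by (simp add: diff_divide_distrib)
    have fgi: "integrable lborel (\<lambda>y. f y * ?g y)"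
    proof (rule Bochner_Integration.integrable_bound[where f="\<lambda>y. C * ?g y"])
      show "AE y in lborel. norm (f y * ?g y) \<le> norm (C * ?g y)"
        using C by eventually_elim (auto simp: abs_mult intro!: mult_right_mono)
    qed (use gi gm f in \<open>auto\<close>)
    have "integrable M (\<lambda>\<omega>. ?g (X k \<omega>))"
      using distributed_integrable[OF X[OF k] gm f(2)] fgi by simp
    moreover have "(LINT \<omega>|M. ?g (X k \<omega>)) = (LINT y|lborel. f y * ?g y)"
      using distributed_integral[OF X[OF k] gm f(2)] by simp
    moreover have "K ((y - x) / ?e) = K ((x - y) / ?e)" for y
      using K(2)[of "(y - x) / ?e"] by (simp add: minus_divide_left)
    ultimately show ?thesis
      unfolding conv_def rescale_def
      by (simp add: mult_ac flip: integral_mult_right_zero)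
  qed
  show ?thesis
    unfolding fmean_def fhat_def
    using * by (simp add: Bochner_Integration.integral_sum)
qed

end

theory Submission
  imports Defs
begin

text \<open>
  Write \<open>A\<close> for the estimator at \<open>\<gamma>\<close> and \<open>A\<^sub>m\<close> for the one at \<open>m = \<gamma>\<^sub>m\<^sub>a\<^sub>x\<close>. Expanding squares,
  \<open>Crit \<gamma> = |A - f|\<^sup>2 + |A\<^sub>m - f|\<^sup>2 - 2 Z \<gamma>\<close> with \<open>Z \<gamma> = \<langle>A - f, A\<^sub>m - f\<rangle> - pen \<gamma> / 2\<close>, so the
  minimiser of the criterion is as good as any competitor up to the errors \<open>Z\<close>
  (\<open>Crit_eq\<close>). It suffices to bound \<open>|Z \<gamma>|\<close> by a small multiple of the loss at \<open>\<gamma>\<close>, plus a multiple of the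
  bias at \<open>m\<close> and of the rate \<open>\<lambda>\<^sup>2/n + \<lambda>\<^sup>3/(n\<^sup>2 h\<^sub>n(m))\<close>.

  Split each estimator into its mean and a noise, the average of independent centered random functions.
  The diagonal terms of \<open>\<langle>noise \<gamma>, noise m\<rangle>\<close> are \<open>pen \<gamma> / 2\<close> up to \<open>O(1/n)\<close>, because
  \<open>\<langle>K\<^sub>h(X - \<cdot>), K\<^sub>h'(X - \<cdot>)\<rangle>\<close> does not depend on \<open>X\<close>: this is why the penalty has its particular form.
  Apart from a product of two deterministic errors, what remains is linear in the noise, or is the off-diagonal form
  \<open>U = \<Sum>\<^sub>k\<^sub>\<noteq>\<^sub>l \<langle>a\<^sub>k, b\<^sub>l\<rangle>\<close>, where \<open>a\<^sub>k\<close> and \<open>b\<^sub>l\<close> are the centered kernels at \<open>m\<close> and at \<open>\<gamma>\<close>.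

  The rate leaves room for an elementary treatment of \<open>U\<close>, in three steps. Averaging over all splittings of the index set
  reduces \<open>U\<close> to sums \<open>\<Sum>\<^sub>k \<langle>a\<^sub>k, S\<rangle>\<close> with \<open>S\<close> a sum of \<open>b\<^sub>l\<close> independent of the \<open>a\<^sub>k\<close>
  (\<open>expectation_offdiag_power\<close>). Given \<open>S\<close> this is a sum of independent real variables with variance at
  most a constant times \<open>|S|\<^sup>2\<close> and size at most \<open>|a\<^sub>k| |S|\<close>, so that its moments are of Bernstein type
  (\<open>expectation_linear_power\<close>). Finally \<open>|S|\<close> is sub-Gaussian with variance proxy
  \<open>V = \<Sum> |b\<^sub>l|\<^sup>2\<close> (\<open>expectation_cosh_norm_sum\<close>). Off an event of probability at most \<open>e\<^sup>-\<^sup>\<lambda>\<close> this gives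
  \<open>|U|/n\<^sup>2 \<le> C \<surd>rate \<surd>D\<close>, where \<open>D\<close>, of order \<open>V/n\<^sup>2\<close>, is the stochastic error at \<open>\<gamma>\<close>. By the
  same estimate, applied to \<open>|noise \<gamma>|\<^sup>2\<close>, \<open>D\<close> is itself controlled by the observed loss
  (\<open>bias_plus_stochastic_level_le\<close>), and the arithmetic-geometric mean inequality finishes the proof.
\<close>

section \<open>Square-integrable functions\<close>

text \<open>Functions are not identified when they agree almost everywhere, so that point evaluation and joint
  measurability make sense; \<open>Lp_norm 2\<close> is therefore only a seminorm on this class.\<close>

definition sq_int :: "(real \<Rightarrow> real) \<Rightarrow> bool" where
  "sq_int u \<longleftrightarrow> u \<in> borel_measurable borel \<and> integrable lborel (\<lambda>t. (u t)\<^sup>2)"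

lemma sq_int_measurable: "sq_int u \<Longrightarrow> u \<in> borel_measurable borel"
  by (simp add: sq_int_def)

lemma sq_int_mult_integrable:
  assumes "sq_int u" "sq_int v"
  shows "integrable lborel (\<lambda>t. u t * v t)"
proof (rule Bochner_Integration.integrable_bound[where f="\<lambda>t. (u t)\<^sup>2 + (v t)\<^sup>2"])
  show "AE t in lborel. norm (u t * v t) \<le> norm ((u t)\<^sup>2 + (v t)\<^sup>2)"
  proof (rule AE_I2)
    fix t
    have "2 * (\<bar>u t\<bar> * \<bar>v t\<bar>) \<le> (u t)\<^sup>2 + (v t)\<^sup>2"
      using sum_squares_bound[of "\<bar>u t\<bar>" "\<bar>v t\<bar>"] by simp
    moreover have "0 \<le> \<bar>u t\<bar> * \<bar>v t\<bar>" by simp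
    ultimately have "\<bar>u t\<bar> * \<bar>v t\<bar> \<le> (u t)\<^sup>2 + (v t)\<^sup>2" by linarith
    then show "norm (u t * v t) \<le> norm ((u t)\<^sup>2 + (v t)\<^sup>2)"
      by (simp add: abs_mult)
  qed
qed (use assms in \<open>auto simp: sq_int_def\<close>)

lemma sq_int_add [intro]:
  assumes "sq_int u" "sq_int v"
  shows "sq_int (\<lambda>t. u t + v t)"
proof -
  have "integrable lborel (\<lambda>t. (u t)\<^sup>2 + 2 * (u t * v t) + (v t)\<^sup>2)"
    using assms sq_int_mult_integrable[OF assms] by (auto simp: sq_int_def)
  then show ?thesis
    using assms by (auto simp: sq_int_def power2_sum algebra_simps)
qed

lemma sq_int_cmult [intro]: "sq_int u \<Longrightarrow> sq_int (\<lambda>t. c * u t)"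
  by (auto simp: sq_int_def power_mult_distrib)

lemma sq_int_diff [intro]: "sq_int u \<Longrightarrow> sq_int v \<Longrightarrow> sq_int (\<lambda>t. u t - v t)"
  using sq_int_add[of u "\<lambda>t. (- 1) * v t"] sq_int_cmult[of v "- 1"] by simp

lemma sq_int_zero [simp]: "sq_int (\<lambda>_. 0)"
  by (simp add: sq_int_def)

lemma sq_int_sum [intro]: "(\<And>k. k \<in> A \<Longrightarrow> sq_int (u k)) \<Longrightarrow> sq_int (\<lambda>t. \<Sum>k\<in>A. u k t)"
  by (induction A rule: infinite_finite_induct) auto

lemma L2_inner_commute: "L2_inner u v = L2_inner v u"
  by (simp add: L2_inner_def mult.commute)

lemma L2_inner_add_left:
  "sq_int u \<Longrightarrow> sq_int v \<Longrightarrow> sq_int w \<Longrightarrow>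
    L2_inner (\<lambda>t. u t + v t) w = L2_inner u w + L2_inner v w"
  by (simp add: L2_inner_def distrib_right sq_int_mult_integrable)

lemma L2_inner_diff_left:
  "sq_int u \<Longrightarrow> sq_int v \<Longrightarrow> sq_int w \<Longrightarrow>
    L2_inner (\<lambda>t. u t - v t) w = L2_inner u w - L2_inner v w"
  by (simp add: L2_inner_def left_diff_distrib sq_int_mult_integrable)

lemma L2_inner_cmult_left: "L2_inner (\<lambda>t. c * u t) w = c * L2_inner u w"
  by (simp add: L2_inner_def mult.assoc)

lemma L2_inner_sum_left:
  "(\<And>k. k \<in> A \<Longrightarrow> sq_int (u k)) \<Longrightarrow> sq_int w \<Longrightarrow>
    L2_inner (\<lambda>t. \<Sum>k\<in>A. u k t) w = (\<Sum>k\<in>A. L2_inner (u k) w)"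
  by (simp add: L2_inner_def sum_distrib_right sq_int_mult_integrable)

lemma L2_inner_add_right:
  "sq_int u \<Longrightarrow> sq_int v \<Longrightarrow> sq_int w \<Longrightarrow>
    L2_inner w (\<lambda>t. u t + v t) = L2_inner w u + L2_inner w v"
  using L2_inner_add_left[of u v w] by (simp add: L2_inner_commute)

lemma L2_inner_diff_right:
  "sq_int u \<Longrightarrow> sq_int v \<Longrightarrow> sq_int w \<Longrightarrow>
    L2_inner w (\<lambda>t. u t - v t) = L2_inner w u - L2_inner w v"
  using L2_inner_diff_left[of u v w] by (simp add: L2_inner_commute)

lemma L2_inner_cmult_right: "L2_inner w (\<lambda>t. c * u t) = c * L2_inner w u"
  using L2_inner_cmult_left[of c u w] by (simp add: L2_inner_commute)

lemma L2_inner_sum_right: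
  "(\<And>k. k \<in> A \<Longrightarrow> sq_int (u k)) \<Longrightarrow> sq_int w \<Longrightarrow>
    L2_inner w (\<lambda>t. \<Sum>k\<in>A. u k t) = (\<Sum>k\<in>A. L2_inner w (u k))"
  using L2_inner_sum_left[of A u w] by (simp add: L2_inner_commute)

lemma Lp_norm_nonneg [simp]: "0 \<le> Lp_norm p u"
  by (simp add: Lp_norm_def)

lemma Lp_norm_2_sq_inner: "(Lp_norm 2 u)\<^sup>2 = L2_inner u u"
  unfolding Lp_norm_2_sq L2_inner_def by (simp only: power2_eq_square)

lemma Lp_norm_2_zero [simp]: "Lp_norm 2 (\<lambda>_. 0) = 0"
  by (simp add: Lp_norm_def)

lemma Lp_norm_2_add_sq:
  assumes "sq_int u" "sq_int v"
  shows "(Lp_norm 2 (\<lambda>t. u t + v t))\<^sup>2 = (Lp_norm 2 u)\<^sup>2 + 2 * L2_inner u v + (Lp_norm 2 v)\<^sup>2"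
  using assms
  by (simp add: Lp_norm_2_sq_inner L2_inner_add_left L2_inner_add_right sq_int_add
      L2_inner_commute[of v u])

lemma Lp_norm_2_diff_sq:
  assumes "sq_int u" "sq_int v"
  shows "(Lp_norm 2 (\<lambda>t. u t - v t))\<^sup>2 = (Lp_norm 2 u)\<^sup>2 - 2 * L2_inner u v + (Lp_norm 2 v)\<^sup>2"
  using assms
  by (simp add: Lp_norm_2_sq_inner L2_inner_diff_left L2_inner_diff_right sq_int_diff
      L2_inner_commute[of v u])

lemma L2_Cauchy_Schwarz:
  assumes u: "sq_int u" and v: "sq_int v"
  shows "\<bar>L2_inner u v\<bar> \<le> Lp_norm 2 u * Lp_norm 2 v"
proof -
  define a b c where "a = (Lp_norm 2 u)\<^sup>2" and "b = L2_inner u v" and "c = (Lp_norm 2 v)\<^sup>2"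
  \<comment> \<open>nonnegativity of \<open>|u - s v|\<^sup>2\<close> as a quadratic polynomial in \<open>s\<close>\<close>
  have q: "0 \<le> a - 2 * s * b + s\<^sup>2 * c" for s
  proof -
    have "0 \<le> (Lp_norm 2 (\<lambda>t. u t - s * v t))\<^sup>2" by simp
    also have "\<dots> = a - 2 * s * b + s\<^sup>2 * c"
      unfolding Lp_norm_2_diff_sq[OF u sq_int_cmult[OF v, of s]] a_def b_def c_def
        Lp_norm_2_sq_inner L2_inner_cmult_right L2_inner_cmult_left
      by (simp add: power2_eq_square)
    finally show ?thesis .
  qed
  have "b\<^sup>2 \<le> a * c"
  proof (cases "c = 0")
    case True
    have "b = 0"
    proof (rule ccontr)
      assume "b \<noteq> 0"
      then show False using q[of "(a + 1) / (2 * b)"] True by simp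
    qed
    then show ?thesis using True by simp
  next
    case False
    then have c: "0 < c" by (simp add: c_def)
    have "0 \<le> a - b\<^sup>2 / c"
      using q[of "b / c"] False by (simp add: power2_eq_square field_simps)
    then show ?thesis using c by (simp add: field_simps)
  qed
  then have "\<bar>b\<bar>\<^sup>2 \<le> (Lp_norm 2 u * Lp_norm 2 v)\<^sup>2"
    by (simp add: a_def c_def power_mult_distrib)
  then show ?thesis
    unfolding b_def by (rule power2_le_imp_le) simp
qed

lemma Lp_norm_2_triangle:
  assumes "sq_int u" "sq_int v"
  shows "Lp_norm 2 (\<lambda>t. u t + v t) \<le> Lp_norm 2 u + Lp_norm 2 v"
proof (rule power2_le_imp_le)
  show "(Lp_norm 2 (\<lambda>t. u t + v t))\<^sup>2 \<le> (Lp_norm 2 u + Lp_norm 2 v)\<^sup>2"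
    using Lp_norm_2_add_sq[OF assms] L2_Cauchy_Schwarz[OF assms]
    by (simp add: power2_sum)
qed simp

lemma Lp_norm_2_sum_le:
  "(\<And>k. k \<in> A \<Longrightarrow> sq_int (u k)) \<Longrightarrow> Lp_norm 2 (\<lambda>t. \<Sum>k\<in>A. u k t) \<le> (\<Sum>k\<in>A. Lp_norm 2 (u k))"
proof (induction A rule: infinite_finite_induct)
  case (insert k A)
  then have "Lp_norm 2 (\<lambda>t. u k t + (\<Sum>k\<in>A. u k t)) \<le> Lp_norm 2 (u k) + Lp_norm 2 (\<lambda>t. \<Sum>k\<in>A. u k t)"
    by (intro Lp_norm_2_triangle sq_int_sum) auto
  then show ?case using insert by simp
qed auto

section \<open>Elementary inequalities\<close>

lemma exp_le_quadratic:
  fixes x :: real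
  assumes "\<bar>x\<bar> \<le> 1"
  shows "exp x \<le> 1 + x + x\<^sup>2"
proof (cases "0 \<le> x")
  case True
  then show ?thesis using assms exp_bound by auto
next
  case False
  define y where "y = - x"
  have y: "0 < y" "y \<le> 1" using False assms by (auto simp: y_def)
  have "1 + y + y\<^sup>2 / 2 \<le> exp y"
    using exp_lower_Taylor_quadratic[of y] y by simp
  then have "exp (- y) \<le> 1 / (1 + y + y\<^sup>2 / 2)"
    using y by (simp add: exp_minus inverse_eq_divide frac_le add_pos_nonneg)
  also have "\<dots> \<le> 1 - y + y\<^sup>2"
  proof -
    have "(1 - y + y\<^sup>2) * (1 + y + y\<^sup>2 / 2) = 1 + y\<^sup>2 / 2 + y ^ 3 / 2 + y ^ 4 / 2"
      by (simp add: power2_eq_square power3_eq_cube power4_eq_xxxx field_simps)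
    then have "1 \<le> (1 - y + y\<^sup>2) * (1 + y + y\<^sup>2 / 2)" using y by simp
    moreover have "0 < 1 + y + y\<^sup>2 / 2" using y by (simp add: add_pos_nonneg)
    ultimately show ?thesis by (simp add: divide_le_eq)
  qed
  finally show ?thesis by (simp add: y_def)
qed

text \<open>The even power series of \<open>cosh\<close> turns \<open>cosh (s \<surd>z)\<close> into a power series in \<open>z\<close> with nonnegative
  coefficients, which makes its convexity evident.\<close>

lemma cosh_sqrt_sums:
  fixes z s :: real
  assumes "0 \<le> z"
  shows "(\<lambda>n. if even n then s ^ n * z ^ (n div 2) / fact n else 0) sums cosh (s * sqrt z)"
proof -
  have "(if even n then s ^ n * z ^ (n div 2) / fact n else 0)
      = (if even n then (s * sqrt z) ^ n /\<^sub>R fact n else 0)" for n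
    using assms by (auto elim!: evenE simp: power_mult_distrib power_mult divide_inverse)
  then show ?thesis using cosh_converges[of "s * sqrt z"] by simp
qed

lemma cosh_ge_even_power:
  fixes x :: real
  shows "x ^ (2 * p) / fact (2 * p) \<le> cosh x"
proof -
  have "sum (\<lambda>n. if even n then x ^ n /\<^sub>R fact n else 0) {2 * p} \<le> cosh x"
    unfolding sums_unique[OF cosh_converges]
    by (rule sum_le_suminf)
      (use sums_summable[OF cosh_converges] in \<open>auto simp: zero_le_power_eq\<close>)
  then show ?thesis by (simp add: field_simps)
qed

lemma convex_on_power_nonneg: "convex_on {0::real..} (\<lambda>x. x ^ n)"
proof (cases "even n")
  case True
  then show ?thesis
    using convex_on_subset[OF convex_power_even[OF True], of "{0..}"] by (simp add: convex_real_interval)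
next
  case False
  then show ?thesis by (rule convex_power_odd)
qed

lemma convex_on_cosh_sqrt: "convex_on {0::real..} (\<lambda>z. cosh (s * sqrt z))"
proof (rule convex_onI)
  fix \<tau> x y :: real
  assume \<tau>: "0 < \<tau>" "\<tau> < 1" and xy: "x \<in> {0..}" "y \<in> {0..}"
  let ?z = "(1 - \<tau>) *\<^sub>R x + \<tau> *\<^sub>R y"
  let ?c = "\<lambda>z n. if even n then s ^ n * z ^ (n div 2) / fact n else 0 :: real"
  have z: "0 \<le> ?z" using \<tau> xy by simp
  show "cosh (s * sqrt ?z) \<le> (1 - \<tau>) * cosh (s * sqrt x) + \<tau> * cosh (s * sqrt y)"
  proof (rule sums_le[OF _ cosh_sqrt_sums[OF z]])
    show "(\<lambda>n. (1 - \<tau>) * ?c x n + \<tau> * ?c y n) sums ((1 - \<tau>) * cosh (s * sqrt x) + \<tau> * cosh (s * sqrt y))"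
      using xy by (intro sums_add sums_mult cosh_sqrt_sums) auto
    fix n
    have "?z ^ (n div 2) \<le> (1 - \<tau>) * x ^ (n div 2) + \<tau> * y ^ (n div 2)"
      using convex_onD[OF convex_on_power_nonneg, of \<tau> x y "n div 2"] \<tau> xy by simp
    then have "even n \<Longrightarrow> s ^ n / fact n * ?z ^ (n div 2)
        \<le> s ^ n / fact n * ((1 - \<tau>) * x ^ (n div 2) + \<tau> * y ^ (n div 2))"
      by (intro mult_left_mono) (auto simp: zero_le_power_eq)
    then show "?c ?z n \<le> (1 - \<tau>) * ?c x n + \<tau> * ?c y n"
      by (auto simp: distrib_left mult_ac)
  qed
qed (simp add: convex_real_interval)

text \<open>The number \<open>a\<^sup>2 + 2r + c\<^sup>2\<close> runs from \<open>(a - c)\<^sup>2\<close> to \<open>(a + c)\<^sup>2\<close>; by convexity, the function lies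
  below its chord between these points, and the chord is affine in \<open>r\<close>. With \<open>r\<close> the inner product of a fixed
  vector with a centered random vector, the term in \<open>r\<close> vanishes in expectation.\<close>

lemma cosh_sqrt_chord:
  fixes a c r s :: real
  assumes "0 \<le> a" "0 \<le> c" "\<bar>r\<bar> \<le> a * c"
  shows "cosh (s * sqrt (a\<^sup>2 + 2 * r + c\<^sup>2))
    \<le> cosh (s * a) * cosh (s * c) + r * (sinh (s * a) * sinh (s * c) / (a * c))"
proof (cases "a * c = 0")
  case True
  then show ?thesis using assms by auto
next
  case False
  then have ac: "0 < a * c" using assms by (metis less_eq_real_def mult_nonneg_nonneg)
  define \<tau> where "\<tau> = (1 + r / (a * c)) / 2"
  have \<tau>: "0 \<le> \<tau>" "\<tau> \<le> 1" proof -
    have "\<bar>r / (a * c)\<bar> \<le> 1"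
      using assms(3) ac by (simp only: abs_divide abs_of_pos[OF ac] divide_le_eq_1_pos)
    then show "0 \<le> \<tau>" "\<tau> \<le> 1" unfolding \<tau>_def abs_le_iff by simp_all
  qed
  have r: "r = (2 * \<tau> - 1) * (a * c)" using ac False by (simp add: \<tau>_def field_simps)
  have eq: "a\<^sup>2 + 2 * r + c\<^sup>2 = (1 - \<tau>) *\<^sub>R (a - c)\<^sup>2 + \<tau> *\<^sub>R (a + c)\<^sup>2"
    unfolding r by (simp add: power2_eq_square algebra_simps)
  have "cosh (s * sqrt (a\<^sup>2 + 2 * r + c\<^sup>2))
      \<le> (1 - \<tau>) * cosh (s * sqrt ((a - c)\<^sup>2)) + \<tau> * cosh (s * sqrt ((a + c)\<^sup>2))"
    unfolding eq by (rule convex_onD[OF convex_on_cosh_sqrt \<tau>]) auto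
  also have "cosh (s * sqrt ((a - c)\<^sup>2)) = cosh (s * a - s * c)"
    using cosh_minus[of "s * a - s * c"] by (cases "c \<le> a") (auto simp: right_diff_distrib abs_if)
  also have "cosh (s * sqrt ((a + c)\<^sup>2)) = cosh (s * a + s * c)"
    using assms by (simp add: distrib_left)
  also have "(1 - \<tau>) * cosh (s * a - s * c) + \<tau> * cosh (s * a + s * c)
      = cosh (s * a) * cosh (s * c) + (2 * \<tau> - 1) * (sinh (s * a) * sinh (s * c))"
    by (simp add: cosh_add cosh_diff algebra_simps)
  also have "2 * \<tau> - 1 = r / (a * c)" by (simp add: \<tau>_def add_divide_distrib)
  finally show ?thesis by simp
qed

lemma cosh_le_exp_square_half:
  fixes x :: real
  shows "cosh x \<le> exp (x\<^sup>2 / 2)"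
proof (rule sums_le)
  let ?f = "\<lambda>n. if even n then x ^ n /\<^sub>R fact n else 0"
  have "(\<lambda>n. ?f (2 * n)) sums cosh x \<longleftrightarrow> ?f sums cosh x"
    by (rule sums_mono_reindex) (auto simp: strict_mono_def image_def elim!: evenE)
  then have "(\<lambda>n. ?f (2 * n)) sums cosh x"
    using cosh_converges by blast
  then show "(\<lambda>n. x ^ (2 * n) / fact (2 * n)) sums cosh x"
    by (simp add: field_simps)
  show "(\<lambda>n. (x\<^sup>2 / 2) ^ n /\<^sub>R fact n) sums exp (x\<^sup>2 / 2)"
    by (rule exp_converges)
  fix n
  have "2 ^ n * fact n \<le> (fact (2 * n) :: real)"
  proof (induction n)
    case (Suc n)
    have "2 ^ Suc n * fact (Suc n) = (2 * real n + 2) * (2 ^ n * fact n)"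
      by (simp add: algebra_simps)
    also have "\<dots> \<le> (2 * real n + 2) * fact (2 * n)"
      using Suc by (intro mult_left_mono) auto
    also have "\<dots> \<le> (2 * real n + 2) * ((2 * real n + 1) * fact (2 * n))"
      by (intro mult_left_mono) (auto simp: mult_le_cancel_right1)
    also have "\<dots> = fact (2 * Suc n)" by (simp add: algebra_simps)
    finally show ?case .
  qed simp
  then have "x ^ (2 * n) / fact (2 * n) \<le> x ^ (2 * n) / (2 ^ n * fact n)"
    by (intro divide_left_mono) (auto simp: zero_le_power_eq)
  also have "\<dots> = (x\<^sup>2 / 2) ^ n /\<^sub>R fact n"
    unfolding power_mult power_divide by (simp add: divide_inverse)
  finally show "x ^ (2 * n) / fact (2 * n) \<le> (x\<^sup>2 / 2) ^ n /\<^sub>R fact n" .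
qed

section \<open>Sums of independent centered random functions\<close>

text \<open>Random elements of the Hilbert space of square-integrable functions that are bounded in norm by \<open>c\<close> and
  have mean zero. The mean is tested against fixed functions, which avoids vector-valued integrals.\<close>

definition centered_L2 :: "'b measure \<Rightarrow> real \<Rightarrow> ('b \<Rightarrow> real \<Rightarrow> real) \<Rightarrow> bool" where
  "centered_L2 P c \<phi> \<longleftrightarrow>
     case_prod \<phi> \<in> borel_measurable (P \<Otimes>\<^sub>M lborel) \<and>
     (\<forall>y\<in>space P. sq_int (\<phi> y) \<and> Lp_norm 2 (\<phi> y) \<le> c) \<and>
     (\<forall>u. sq_int u \<longrightarrow> (LINT y|P. L2_inner (\<phi> y) u) = 0)"

text \<open>The covariance operator has norm at most \<open>v\<close>. For kernels this is far smaller than the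
  squared norm \<open>c\<^sup>2\<close>, which blows up with small bandwidths.\<close>

definition weak_variance_le :: "'b measure \<Rightarrow> real \<Rightarrow> ('b \<Rightarrow> real \<Rightarrow> real) \<Rightarrow> bool" where
  "weak_variance_le P v \<phi> \<longleftrightarrow>
     (\<forall>u. sq_int u \<longrightarrow> (LINT y|P. (L2_inner (\<phi> y) u)\<^sup>2) \<le> v * (Lp_norm 2 u)\<^sup>2)"

lemma centered_L2D:
  assumes "centered_L2 P c \<phi>"
  shows "case_prod \<phi> \<in> borel_measurable (P \<Otimes>\<^sub>M lborel)"
    and "y \<in> space P \<Longrightarrow> sq_int (\<phi> y)"
    and "y \<in> space P \<Longrightarrow> Lp_norm 2 (\<phi> y) \<le> c"
    and "sq_int u \<Longrightarrow> (LINT y|P. L2_inner (\<phi> y) u) = 0"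
  using assms by (auto simp: centered_L2_def)

lemma L2_inner_measurable:
  assumes [measurable]: "case_prod a \<in> borel_measurable (N \<Otimes>\<^sub>M lborel)"
    "case_prod b \<in> borel_measurable (N \<Otimes>\<^sub>M lborel)"
  shows "(\<lambda>x. L2_inner (a x) (b x)) \<in> borel_measurable N"
  unfolding L2_inner_def by measurable

lemma Lp_norm_2_measurable:
  assumes [measurable]: "case_prod a \<in> borel_measurable (N \<Otimes>\<^sub>M lborel)"
  shows "(\<lambda>x. Lp_norm 2 (a x)) \<in> borel_measurable N"
  unfolding Lp_norm_def by measurable

lemma case_prod_const_measurable:
  "sq_int u \<Longrightarrow> case_prod (\<lambda>_. u) \<in> borel_measurable (N \<Otimes>\<^sub>M lborel)"
  unfolding case_prod_beta
  by (rule measurable_compose[OF measurable_snd]) (simp add: sq_int_measurable)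

lemma borel_measurable_cosh [measurable (raw)]:
  fixes g :: "'b \<Rightarrow> real"
  assumes [measurable]: "g \<in> borel_measurable N"
  shows "(\<lambda>x. cosh (g x)) \<in> borel_measurable N"
  unfolding cosh_def by measurable

lemma PiM_component_measurable:
  assumes "case_prod \<phi> \<in> borel_measurable (P \<Otimes>\<^sub>M lborel)" "k \<in> J"
  shows "case_prod (\<lambda>x. \<phi> (x k)) \<in> borel_measurable (Pi\<^sub>M J (\<lambda>_. P) \<Otimes>\<^sub>M lborel)"
proof -
  have "(\<lambda>z. (fst z k, snd z)) \<in> Pi\<^sub>M J (\<lambda>_. P) \<Otimes>\<^sub>M lborel \<rightarrow>\<^sub>M P \<Otimes>\<^sub>M lborel"
    using assms(2) by measurable
  from measurable_compose[OF this assms(1)] show ?thesis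
    by (simp add: case_prod_beta')
qed

lemma PiM_sum_measurable:
  fixes \<phi> :: "'i \<Rightarrow> 'b \<Rightarrow> real \<Rightarrow> real"
  assumes "\<And>k. k \<in> I \<Longrightarrow> case_prod (\<phi> k) \<in> borel_measurable (P \<Otimes>\<^sub>M lborel)" "I \<subseteq> J"
  shows "case_prod (\<lambda>x t. \<Sum>k\<in>I. \<phi> k (x k) t) \<in> borel_measurable (Pi\<^sub>M J (\<lambda>_. P) \<Otimes>\<^sub>M lborel)"
proof -
  have "(\<lambda>z. \<Sum>k\<in>I. \<phi> k (fst z k) (snd z)) \<in> borel_measurable (Pi\<^sub>M J (\<lambda>_. P) \<Otimes>\<^sub>M lborel)"
  proof (rule borel_measurable_sum)
    fix k assume "k \<in> I"
    then show "(\<lambda>z. \<phi> k (fst z k) (snd z)) \<in> borel_measurable (Pi\<^sub>M J (\<lambda>_. P) \<Otimes>\<^sub>M lborel)"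
      using PiM_component_measurable[OF assms(1), of k k J] assms(2) by (auto simp: case_prod_beta')
  qed
  then show ?thesis by (simp add: case_prod_beta')
qed

lemma PiM_component_in_space: "x \<in> space (Pi\<^sub>M J (\<lambda>_. P)) \<Longrightarrow> k \<in> J \<Longrightarrow> x k \<in> space P"
  by (auto simp: space_PiM PiE_def)

lemma prob_space_PiM_const: "prob_space P \<Longrightarrow> prob_space (Pi\<^sub>M J (\<lambda>_. P))"
  by (rule prob_space_PiM) simp

lemma integrable_bounded_prob:
  fixes g :: "'c \<Rightarrow> real"
  assumes "prob_space Q" "g \<in> borel_measurable Q" "\<And>x. x \<in> space Q \<Longrightarrow> \<bar>g x\<bar> \<le> B"
  shows "integrable Q g"
proof -
  interpret prob_space Q by fact
  show ?thesis using assms by (intro integrable_const_bound[where B=B]) auto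
qed

lemma integral_bounded_prob:
  fixes g :: "'c \<Rightarrow> real"
  assumes Q: "prob_space Q" and g: "integrable Q g" and B: "\<And>x. x \<in> space Q \<Longrightarrow> g x \<le> B"
  shows "(LINT x|Q. g x) \<le> B"
proof -
  interpret prob_space Q by fact
  show ?thesis using integral_mono[of Q g "\<lambda>_. B"] g B by (simp add: prob_space)
qed

text \<open>One step of the sub-Gaussian bound: adding a centered vector of norm at most \<open>c\<close> to \<open>w\<close> costs no more
  than adding a random sign times \<open>c\<close> to the real number \<open>|w|\<close>, since that is the case of equality in
  \<open>cosh_sqrt_chord\<close>.\<close>

lemma expectation_cosh_norm_add:
  assumes P: "prob_space P" and \<phi>: "centered_L2 P c \<phi>" and w: "sq_int w" and s: "0 \<le> s"
  shows "(LINT y|P. cosh (s * Lp_norm 2 (\<lambda>t. \<phi> y t + w t))) \<le> cosh (s * Lp_norm 2 w) * cosh (s * c)"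
proof -
  interpret prob_space P by fact
  let ?g = "\<lambda>y. cosh (s * Lp_norm 2 (\<lambda>t. \<phi> y t + w t))"
  note \<phi>D = centered_L2D[OF \<phi>]
  obtain y0 where "y0 \<in> space P" using not_empty by blast
  then have c: "0 \<le> c" using \<phi>D(3)[of y0] Lp_norm_nonneg[of 2 "\<phi> y0"] by linarith
  let ?a = "Lp_norm 2 w"
  let ?r = "\<lambda>y. L2_inner w (\<phi> y)"
  have [measurable]: "case_prod \<phi> \<in> borel_measurable (P \<Otimes>\<^sub>M lborel)" by (rule \<phi>D)
  have [measurable]: "w \<in> borel_measurable borel" using w by (rule sq_int_measurable)
  have gm: "?g \<in> borel_measurable P" unfolding Lp_norm_def by measurable
  have rm: "?r \<in> borel_measurable P" unfolding L2_inner_def by measurable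
  have rb: "\<bar>?r y\<bar> \<le> ?a * c" if "y \<in> space P" for y
    using L2_Cauchy_Schwarz[OF w \<phi>D(2)[OF that]] mult_left_mono[OF \<phi>D(3)[OF that], of ?a]
    by simp
  have ub: "?g y \<le> cosh (s * ?a) * cosh (s * c) + ?r y * (sinh (s * ?a) * sinh (s * c) / (?a * c))"
    if y: "y \<in> space P" for y
  proof -
    have "Lp_norm 2 (\<lambda>t. \<phi> y t + w t) = sqrt ((Lp_norm 2 (\<lambda>t. \<phi> y t + w t))\<^sup>2)" by simp
    also have "(Lp_norm 2 (\<lambda>t. \<phi> y t + w t))\<^sup>2 = ?a\<^sup>2 + 2 * ?r y + (Lp_norm 2 (\<phi> y))\<^sup>2"
      using Lp_norm_2_add_sq[OF \<phi>D(2)[OF y] w] by (simp add: L2_inner_commute)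
    also have "sqrt \<dots> \<le> sqrt (?a\<^sup>2 + 2 * ?r y + c\<^sup>2)"
      using power_mono[OF \<phi>D(3)[OF y], of 2] by simp
    finally have le: "Lp_norm 2 (\<lambda>t. \<phi> y t + w t) \<le> sqrt (?a\<^sup>2 + 2 * ?r y + c\<^sup>2)" .
    have "?g y \<le> cosh (s * sqrt (?a\<^sup>2 + 2 * ?r y + c\<^sup>2))"
      using s mult_left_mono[OF le s] order_trans[OF Lp_norm_nonneg le]
      by (simp add: cosh_real_nonneg_le_iff)
    also have "\<dots> \<le> cosh (s * ?a) * cosh (s * c) + ?r y * (sinh (s * ?a) * sinh (s * c) / (?a * c))"
      by (rule cosh_sqrt_chord) (use c rb[OF y] in auto)
    finally show ?thesis .
  qed
  have gi: "integrable P ?g"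
  proof (rule integrable_bounded_prob[OF P gm])
    fix y assume y: "y \<in> space P"
    have "Lp_norm 2 (\<lambda>t. \<phi> y t + w t) \<le> c + ?a"
      using Lp_norm_2_triangle[OF \<phi>D(2)[OF y] w] \<phi>D(3)[OF y] by linarith
    then show "\<bar>?g y\<bar> \<le> cosh (s * (c + ?a))"
      using s c by (simp add: cosh_real_nonneg_le_iff mult_left_mono)
  qed
  have ri: "integrable P ?r"
    by (rule integrable_bounded_prob[OF P rm rb])
  have "(LINT y|P. ?g y)
      \<le> (LINT y|P. cosh (s * ?a) * cosh (s * c) + ?r y * (sinh (s * ?a) * sinh (s * c) / (?a * c)))"
    by (rule integral_mono[OF gi _ ub]) (use ri in auto)
  also have "\<dots> = cosh (s * ?a) * cosh (s * c)"
    using ri \<phi>D(4)[OF w] by (simp add: prob_space L2_inner_commute[of w])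
  finally show "(LINT y|P. ?g y) \<le> cosh (s * ?a) * cosh (s * c)" .
qed

lemma norm_sum_bounded:
  assumes "\<And>k. k \<in> J \<Longrightarrow> centered_L2 P (c k) (\<phi> k)" "x \<in> space (Pi\<^sub>M J (\<lambda>_. P))" "I \<subseteq> J"
  shows "sq_int (\<lambda>t. \<Sum>k\<in>I. \<phi> k (x k) t)"
    and "Lp_norm 2 (\<lambda>t. \<Sum>k\<in>I. \<phi> k (x k) t) \<le> (\<Sum>k\<in>I. c k)"
proof -
  have *: "sq_int (\<phi> k (x k))" "Lp_norm 2 (\<phi> k (x k)) \<le> c k" if "k \<in> I" for k
    using assms that centered_L2D(2,3)[of P "c k" "\<phi> k" "x k"]
    by (auto dest: PiM_component_in_space)
  then show "sq_int (\<lambda>t. \<Sum>k\<in>I. \<phi> k (x k) t)" by auto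
  have "Lp_norm 2 (\<lambda>t. \<Sum>k\<in>I. \<phi> k (x k) t) \<le> (\<Sum>k\<in>I. Lp_norm 2 (\<phi> k (x k)))"
    using * by (intro Lp_norm_2_sum_le)
  also have "\<dots> \<le> (\<Sum>k\<in>I. c k)" using * by (intro sum_mono)
  finally show "Lp_norm 2 (\<lambda>t. \<Sum>k\<in>I. \<phi> k (x k) t) \<le> (\<Sum>k\<in>I. c k)" .
qed

lemma integrable_cosh_norm_sum:
  assumes P: "prob_space P" and \<phi>: "\<And>k. k \<in> J \<Longrightarrow> centered_L2 P (c k) (\<phi> k)" and s: "0 \<le> s"
  shows "integrable (Pi\<^sub>M J (\<lambda>_. P)) (\<lambda>x. cosh (s * Lp_norm 2 (\<lambda>t. \<Sum>k\<in>J. \<phi> k (x k) t)))"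
proof (rule integrable_bounded_prob[OF prob_space_PiM_const[OF P]])
  have "(\<lambda>x. Lp_norm 2 (\<lambda>t. \<Sum>k\<in>J. \<phi> k (x k) t)) \<in> borel_measurable (Pi\<^sub>M J (\<lambda>_. P))"
    by (intro Lp_norm_2_measurable PiM_sum_measurable centered_L2D(1)[OF \<phi>]) auto
  then show "(\<lambda>x. cosh (s * Lp_norm 2 (\<lambda>t. \<Sum>k\<in>J. \<phi> k (x k) t))) \<in> borel_measurable (Pi\<^sub>M J (\<lambda>_. P))"
    by measurable
  fix x assume "x \<in> space (Pi\<^sub>M J (\<lambda>_. P))"
  then have "Lp_norm 2 (\<lambda>t. \<Sum>k\<in>J. \<phi> k (x k) t) \<le> (\<Sum>k\<in>J. c k)"
    by (intro norm_sum_bounded(2)[where \<phi>=\<phi> and c=c and J=J and P=P]) (auto intro: \<phi>)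
  then have le: "s * Lp_norm 2 (\<lambda>t. \<Sum>k\<in>J. \<phi> k (x k) t) \<le> s * (\<Sum>k\<in>J. c k)"
    using s by (rule mult_left_mono)
  have ge: "0 \<le> s * Lp_norm 2 (\<lambda>t. \<Sum>k\<in>J. \<phi> k (x k) t)"
    using s by simp
  show "\<bar>cosh (s * Lp_norm 2 (\<lambda>t. \<Sum>k\<in>J. \<phi> k (x k) t))\<bar> \<le> cosh (s * (\<Sum>k\<in>J. c k))"
    unfolding abs_of_nonneg[OF cosh_real_nonneg] cosh_real_nonneg_le_iff[OF ge order_trans[OF ge le]]
    by (rule le)
qed

text \<open>Hoeffding's inequality in a Hilbert space, in exponential form: integrating out one summand at a time
  gives \<open>\<Prod> cosh (s c\<^sub>k)\<close>.\<close>

lemma expectation_cosh_norm_sum: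
  assumes prob: "prob_space P" and J: "finite J"
    and \<phi>: "\<And>k. k \<in> J \<Longrightarrow> centered_L2 P (c k) (\<phi> k)" and s: "0 \<le> s"
  shows "(LINT x|Pi\<^sub>M J (\<lambda>_. P). cosh (s * Lp_norm 2 (\<lambda>t. \<Sum>k\<in>J. \<phi> k (x k) t)))
    \<le> exp (s\<^sup>2 * (\<Sum>k\<in>J. (c k)\<^sup>2) / 2)"
  using J \<phi>
proof (induction J)
  case empty
  interpret prob_space "Pi\<^sub>M {} (\<lambda>_. P)" by (rule prob_space_PiM_const[OF prob])
  show ?case by (simp add: prob_space)
next
  case (insert i J)
  interpret product_sigma_finite "\<lambda>_. P"
    using prob by (simp add: product_sigma_finite_def prob_space_imp_sigma_finite)
  let ?S = "\<lambda>x t. \<Sum>k\<in>J. \<phi> k (x k) t"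
  have upd: "(\<Sum>k\<in>insert i J. \<phi> k ((x(i := y)) k) t) = \<phi> i y t + ?S x t" for x y t
  proof -
    have "(\<Sum>k\<in>J. \<phi> k ((x(i := y)) k) t) = ?S x t"
      using insert.hyps by (intro sum.cong) auto
    then show ?thesis using insert.hyps by simp
  qed
  have \<phi>J: "k \<in> J \<Longrightarrow> centered_L2 P (c k) (\<phi> k)" for k using insert.prems by auto
  have Ssq: "x \<in> space (Pi\<^sub>M J (\<lambda>_. P)) \<Longrightarrow> sq_int (?S x)" for x
    by (rule norm_sum_bounded(1)[where \<phi>=\<phi> and c=c and J=J, OF \<phi>J _ order.refl])
  have "(LINT x|Pi\<^sub>M (insert i J) (\<lambda>_. P). cosh (s * Lp_norm 2 (\<lambda>t. \<Sum>k\<in>insert i J. \<phi> k (x k) t)))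
      = (LINT x|Pi\<^sub>M J (\<lambda>_. P). LINT y|P. cosh (s * Lp_norm 2 (\<lambda>t. \<phi> i y t + ?S x t)))"
    by (subst product_integral_insert[OF insert.hyps(1,2)
          integrable_cosh_norm_sum[OF prob insert.prems s]]) (simp_all only: upd)
  also have "\<dots> \<le> (LINT x|Pi\<^sub>M J (\<lambda>_. P). cosh (s * Lp_norm 2 (?S x)) * cosh (s * c i))"
  proof (rule integral_mono_AE')
    show "integrable (Pi\<^sub>M J (\<lambda>_. P)) (\<lambda>x. cosh (s * Lp_norm 2 (?S x)) * cosh (s * c i))"
      using integrable_cosh_norm_sum[OF prob \<phi>J s] by auto
    show "AE x in Pi\<^sub>M J (\<lambda>_. P). (LINT y|P. cosh (s * Lp_norm 2 (\<lambda>t. \<phi> i y t + ?S x t)))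
        \<le> cosh (s * Lp_norm 2 (?S x)) * cosh (s * c i)"
      using expectation_cosh_norm_add[OF prob insert.prems Ssq s] by (intro AE_I2) auto
  qed (auto intro!: AE_I2 mult_nonneg_nonneg simp: cosh_real_nonneg)
  also have "\<dots> = (LINT x|Pi\<^sub>M J (\<lambda>_. P). cosh (s * Lp_norm 2 (?S x))) * cosh (s * c i)"
    by simp
  also have "\<dots> \<le> exp (s\<^sup>2 * (\<Sum>k\<in>J. (c k)\<^sup>2) / 2) * exp ((s * c i)\<^sup>2 / 2)"
    using insert.IH[OF \<phi>J] by (intro mult_mono cosh_le_exp_square_half) (auto simp: cosh_real_nonneg)
  also have "\<dots> = exp (s\<^sup>2 * (\<Sum>k\<in>insert i J. (c k)\<^sup>2) / 2)"
    using insert.hyps by (simp add: exp_add[symmetric] power_mult_distrib algebra_simps add_divide_distrib)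
  finally show ?case .
qed

lemma product_sigma_finite_const: "prob_space P \<Longrightarrow> product_sigma_finite (\<lambda>_. P)"
  by (simp add: product_sigma_finite_def prob_space_imp_sigma_finite)

text \<open>Moments of order \<open>2p\<close> are extracted from exponential moments at the cost of a factor \<open>(2p)! e\<^sup>p\<close>, which
  is harmless on the scale \<open>z/p\<close>.\<close>

lemma fact_exp_power_le:
  assumes "1 \<le> p" "0 \<le> z"
  shows "fact (2 * p) * exp (real p) * (z / real p) ^ (2 * p) \<le> (4 * z) ^ (2 * p)"
proof -
  have e: "exp (real p) \<le> 2 ^ (2 * p)"
  proof -
    have "exp (real p) = exp 1 ^ p" by (simp add: exp_of_nat_mult[symmetric])
    also have "\<dots> \<le> (4::real) ^ p"
      using exp_le by (intro power_mono) auto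
    finally show ?thesis by (simp add: power_mult)
  qed
  have "fact (2 * p) \<le> (2 * real p) ^ (2 * p)"
    using fact_le_power[of "2 * p", where ?'a=real] by simp
  then have "fact (2 * p) * exp (real p) * (z / real p) ^ (2 * p)
      \<le> (2 * real p) ^ (2 * p) * 2 ^ (2 * p) * (z / real p) ^ (2 * p)"
    using assms e by (intro mult_mono) auto
  also have "\<dots> = (4 * z) ^ (2 * p)"
    using assms by (simp only: power_mult_distrib[symmetric]) (simp add: mult_ac)
  finally show ?thesis .
qed

text \<open>A power is dominated by \<open>cosh\<close>; the choice \<open>s\<^sup>2 = 2p/V\<close> balances \<open>s\<^sup>-\<^sup>2\<^sup>p\<close> against the exponential bound.\<close>

lemma expectation_norm_sum_power:
  assumes prob: "prob_space P" and J: "finite J"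
    and \<phi>: "\<And>k. k \<in> J \<Longrightarrow> centered_L2 P (c k) (\<phi> k)"
    and V: "(\<Sum>k\<in>J. (c k)\<^sup>2) \<le> V" "0 < V" and p: "1 \<le> p"
  shows "(LINT x|Pi\<^sub>M J (\<lambda>_. P). Lp_norm 2 (\<lambda>t. \<Sum>k\<in>J. \<phi> k (x k) t) ^ (2 * p))
    \<le> (3 * sqrt (real p * V)) ^ (2 * p)"
proof -
  let ?Q = "Pi\<^sub>M J (\<lambda>_. P)"
  let ?N = "\<lambda>x. Lp_norm 2 (\<lambda>t. \<Sum>k\<in>J. \<phi> k (x k) t)"
  define s where "s = sqrt (2 * real p / V)"
  have s: "0 < s" using V p by (simp add: s_def)
  have s2: "s\<^sup>2 = 2 * real p / V" using V p by (simp add: s_def)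
  have ci: "integrable ?Q (\<lambda>x. cosh (s * ?N x))"
    using integrable_cosh_norm_sum[where \<phi>=\<phi> and c=c and J=J, OF prob \<phi>] s by simp
  have pw: "?N x ^ (2 * p) \<le> fact (2 * p) / s ^ (2 * p) * cosh (s * ?N x)" for x
    using cosh_ge_even_power[of "s * ?N x" p] s by (simp add: power_mult_distrib field_simps)
  have "(LINT x|?Q. ?N x ^ (2 * p)) \<le> (LINT x|?Q. fact (2 * p) / s ^ (2 * p) * cosh (s * ?N x))"
    using ci s pw by (intro integral_mono_AE') (auto simp: cosh_real_nonneg)
  also have "\<dots> = fact (2 * p) / s ^ (2 * p) * (LINT x|?Q. cosh (s * ?N x))" by simp
  also have "\<dots> \<le> fact (2 * p) / s ^ (2 * p) * exp (s\<^sup>2 * (\<Sum>k\<in>J. (c k)\<^sup>2) / 2)"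
    using s expectation_cosh_norm_sum[where \<phi>=\<phi> and c=c and J=J, OF prob J \<phi>, of s] by (intro mult_left_mono) auto
  also have "\<dots> \<le> fact (2 * p) / s ^ (2 * p) * exp (real p)"
  proof -
    have "s\<^sup>2 * (\<Sum>k\<in>J. (c k)\<^sup>2) \<le> s\<^sup>2 * V" using V by (intro mult_left_mono) auto
    then show ?thesis using V s by (intro mult_left_mono) (auto simp: s2)
  qed
  also have "\<dots> = fact (2 * p) * exp (real p) * ((real p / s) / real p) ^ (2 * p)"
    using p s by (simp add: power_divide field_simps)
  also have "\<dots> \<le> (4 * (real p / s)) ^ (2 * p)"
    using s p by (intro fact_exp_power_le) auto
  also have "\<dots> = (16 * (real p)\<^sup>2 / s\<^sup>2) ^ p"
    by (simp add: power_mult power_divide power_mult_distrib)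
  also have "16 * (real p)\<^sup>2 / s\<^sup>2 = 8 * (real p * V)"
    unfolding s2 using p V by (simp add: power2_eq_square field_simps)
  also have "(8 * (real p * V)) ^ p \<le> (9 * (real p * V)) ^ p"
    using V by (intro power_mono) auto
  also have "\<dots> = (3 * sqrt (real p * V)) ^ (2 * p)"
    using V by (simp add: power_mult power_mult_distrib)
  finally show ?thesis .
qed

lemma L2_inner_component_bounded:
  assumes "centered_L2 P b \<psi>" "sq_int u" "y \<in> space P"
  shows "\<bar>L2_inner (\<psi> y) u\<bar> \<le> b * Lp_norm 2 u"
proof -
  have "\<bar>L2_inner (\<psi> y) u\<bar> \<le> Lp_norm 2 (\<psi> y) * Lp_norm 2 u"
    using assms by (intro L2_Cauchy_Schwarz) (auto intro: centered_L2D(2))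
  also have "\<dots> \<le> b * Lp_norm 2 u"
    using assms by (intro mult_right_mono) (auto intro: centered_L2D(3))
  finally show ?thesis .
qed

lemma integrable_exp_linear:
  assumes prob: "prob_space P" and \<psi>: "centered_L2 P b \<psi>" and u: "sq_int u"
  shows "integrable P (\<lambda>y. L2_inner (\<psi> y) u)"
    and "integrable P (\<lambda>y. (L2_inner (\<psi> y) u)\<^sup>2)"
    and "integrable P (\<lambda>y. exp (s * L2_inner (\<psi> y) u))"
proof -
  have [measurable]: "(\<lambda>y. L2_inner (\<psi> y) u) \<in> borel_measurable P"
    by (intro L2_inner_measurable centered_L2D(1)[OF \<psi>] case_prod_const_measurable u)
  note b = L2_inner_component_bounded[OF \<psi> u]
  show "integrable P (\<lambda>y. L2_inner (\<psi> y) u)"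
    by (rule integrable_bounded_prob[OF prob _ b]) auto
  show "integrable P (\<lambda>y. (L2_inner (\<psi> y) u)\<^sup>2)"
  proof (rule integrable_bounded_prob[OF prob])
    show "\<bar>(L2_inner (\<psi> y) u)\<^sup>2\<bar> \<le> (b * Lp_norm 2 u)\<^sup>2" if "y \<in> space P" for y
      using power_mono[OF b[OF that], of 2] by simp
  qed simp
  show "integrable P (\<lambda>y. exp (s * L2_inner (\<psi> y) u))"
  proof (rule integrable_bounded_prob[OF prob])
    fix y assume "y \<in> space P"
    have "s * L2_inner (\<psi> y) u \<le> \<bar>s\<bar> * \<bar>L2_inner (\<psi> y) u\<bar>"
      by (simp flip: abs_mult)
    also have "\<dots> \<le> \<bar>s\<bar> * (b * Lp_norm 2 u)"
      using b[OF \<open>y \<in> space P\<close>] by (intro mult_left_mono) auto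
    finally show "\<bar>exp (s * L2_inner (\<psi> y) u)\<bar> \<le> exp (\<bar>s\<bar> * (b * Lp_norm 2 u))" by simp
  qed measurable
qed

text \<open>Bennett's argument: within the range \<open>|s| b |u| \<le> 1\<close> the bound \<open>e\<^sup>x \<le> 1 + x + x\<^sup>2\<close> applies to each
  summand, and the linear term has mean zero.\<close>

lemma expectation_exp_linear:
  assumes prob: "prob_space P" and J: "finite J"
    and \<psi>: "\<And>k. k \<in> J \<Longrightarrow> centered_L2 P b (\<psi> k)"
    and wv: "\<And>k. k \<in> J \<Longrightarrow> weak_variance_le P v (\<psi> k)"
    and u: "sq_int u" and s: "\<bar>s\<bar> * (b * Lp_norm 2 u) \<le> 1"
  shows "integrable (Pi\<^sub>M J (\<lambda>_. P)) (\<lambda>x. exp (s * (\<Sum>k\<in>J. L2_inner (\<psi> k (x k)) u)))" (is ?I)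
    and "(LINT x|Pi\<^sub>M J (\<lambda>_. P). exp (s * (\<Sum>k\<in>J. L2_inner (\<psi> k (x k)) u)))
      \<le> exp (s\<^sup>2 * (real (card J) * v * (Lp_norm 2 u)\<^sup>2))" (is ?E)
proof -
  interpret P: prob_space P by fact
  interpret product_sigma_finite "\<lambda>_. P" by (rule product_sigma_finite_const[OF prob])
  have eq: "exp (s * (\<Sum>k\<in>J. L2_inner (\<psi> k (x k)) u)) = (\<Prod>k\<in>J. exp (s * L2_inner (\<psi> k (x k)) u))"
    for x
    using J by (simp add: sum_distrib_left exp_sum)
  have ei: "integrable P (\<lambda>y. exp (s * L2_inner (\<psi> k y) u))" if "k \<in> J" for k
    by (rule integrable_exp_linear[OF prob \<psi>[OF that] u])
  show ?I unfolding eq by (rule product_integrable_prod[OF J]) (rule ei)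
  have one: "(LINT y|P. exp (s * L2_inner (\<psi> k y) u)) \<le> exp (s\<^sup>2 * (v * (Lp_norm 2 u)\<^sup>2))"
    if k: "k \<in> J" for k
  proof -
    let ?r = "\<lambda>y. L2_inner (\<psi> k y) u"
    note i = integrable_exp_linear[OF prob \<psi>[OF k] u]
    have "(LINT y|P. exp (s * ?r y)) \<le> (LINT y|P. 1 + s * ?r y + s\<^sup>2 * (?r y)\<^sup>2)"
    proof (rule integral_mono)
      fix y assume "y \<in> space P"
      then have "\<bar>s\<bar> * \<bar>?r y\<bar> \<le> \<bar>s\<bar> * (b * Lp_norm 2 u)"
        by (intro mult_left_mono L2_inner_component_bounded[OF \<psi>[OF k] u]) auto
      then show "exp (s * ?r y) \<le> 1 + s * ?r y + s\<^sup>2 * (?r y)\<^sup>2"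
        using exp_le_quadratic[of "s * ?r y"] s by (simp add: abs_mult power_mult_distrib)
    qed (use i in auto)
    also have "\<dots> = 1 + s\<^sup>2 * (LINT y|P. (?r y)\<^sup>2)"
      using i(1,2) centered_L2D(4)[OF \<psi>[OF k] u] by (simp add: P.prob_space)
    also have "\<dots> \<le> 1 + s\<^sup>2 * (v * (Lp_norm 2 u)\<^sup>2)"
      using wv[OF k] u by (auto simp: weak_variance_le_def intro!: mult_left_mono)
    also have "\<dots> \<le> exp (s\<^sup>2 * (v * (Lp_norm 2 u)\<^sup>2))" by (rule exp_ge_add_one_self)
    finally show ?thesis .
  qed
  have "(LINT x|Pi\<^sub>M J (\<lambda>_. P). exp (s * (\<Sum>k\<in>J. L2_inner (\<psi> k (x k)) u)))
      = (\<Prod>k\<in>J. LINT y|P. exp (s * L2_inner (\<psi> k y) u))"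
    unfolding eq by (rule product_integral_prod[OF J]) (rule ei)
  also have "\<dots> \<le> (\<Prod>k\<in>J. exp (s\<^sup>2 * (v * (Lp_norm 2 u)\<^sup>2)))"
    using one by (intro prod_mono) auto
  also have "\<dots> = exp (s\<^sup>2 * (real (card J) * v * (Lp_norm 2 u)\<^sup>2))"
    by (simp add: exp_of_nat_mult[symmetric] mult_ac)
  finally show ?E .
qed

text \<open>The size of the moment of order \<open>p\<close> of a sum of \<open>N\<close> centered variables with variance \<open>v\<close> and bound \<open>b\<close>, or
  equivalently the deviation exceeded with probability about \<open>e\<^sup>-\<^sup>p\<close>.\<close>

definition Bernstein_scale :: "real \<Rightarrow> real \<Rightarrow> real \<Rightarrow> real \<Rightarrow> real" where
  "Bernstein_scale v b N p = sqrt (v * N * p) + b * p"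

text \<open>The bound is proportional to \<open>|u|\<close> because the summands are also bounded by \<open>b |u|\<close>. This homogeneity is what
  allows \<open>u\<close> to be replaced by an independent random vector whose norm is well controlled only in probability.\<close>

lemma expectation_linear_power:
  assumes prob: "prob_space P" and J: "finite J" and card: "real (card J) \<le> N"
    and \<psi>: "\<And>k. k \<in> J \<Longrightarrow> centered_L2 P b (\<psi> k)"
    and wv: "\<And>k. k \<in> J \<Longrightarrow> weak_variance_le P v (\<psi> k)"
    and u: "sq_int u" and b: "0 < b" and v: "0 \<le> v" and p: "1 \<le> p"
  shows "(LINT x|Pi\<^sub>M J (\<lambda>_. P). (\<Sum>k\<in>J. L2_inner (\<psi> k (x k)) u) ^ (2 * p))
    \<le> (4 * (Bernstein_scale v b N (real p) * Lp_norm 2 u)) ^ (2 * p)"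
proof -
  let ?Q = "Pi\<^sub>M J (\<lambda>_. P)"
  let ?W = "\<lambda>x. \<Sum>k\<in>J. L2_inner (\<psi> k (x k)) u"
  define \<tau> where "\<tau> = Bernstein_scale v b N (real p)"
  have N: "0 \<le> N" using card by (meson of_nat_0_le_iff order_trans)
  have \<tau>b: "b * real p \<le> \<tau>" and \<tau>v: "v * N * real p \<le> \<tau>\<^sup>2" and \<tau>: "0 < \<tau>"
  proof -
    have "0 \<le> sqrt (v * N * real p)" "0 < b * real p" using v N b p by auto
    then show "b * real p \<le> \<tau>" "0 < \<tau>"
      by (auto simp: \<tau>_def Bernstein_scale_def intro: add_nonneg_pos)
    have "v * N * real p = (sqrt (v * N * real p))\<^sup>2" using v N by simp
    also have "\<dots> \<le> \<tau>\<^sup>2"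
      using \<open>0 < b * real p\<close> v N by (intro power_mono) (auto simp: \<tau>_def Bernstein_scale_def)
    finally show "v * N * real p \<le> \<tau>\<^sup>2" .
  qed
  show ?thesis
  proof (cases "Lp_norm 2 u = 0")
    case True
    have "?W x = 0" if "x \<in> space ?Q" for x
    proof (rule sum.neutral, rule ballI)
      fix k assume "k \<in> J"
      then show "L2_inner (\<psi> k (x k)) u = 0"
        using L2_inner_component_bounded[OF \<psi>[OF \<open>k \<in> J\<close>] u PiM_component_in_space[OF that]] True
        by simp
    qed
    then have "(LINT x|?Q. ?W x ^ (2 * p)) = (LINT x|?Q. 0)"
      using p by (intro Bochner_Integration.integral_cong) auto
    then show ?thesis using True p by simp
  next
    case False
    then have u0: "0 < Lp_norm 2 u" using Lp_norm_nonneg[of 2 u] by linarith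
    \<comment> \<open>the largest \<open>s\<close> for which both \<open>s b |u| \<le> 1\<close> and \<open>s\<^sup>2 N v |u|\<^sup>2 \<le> p\<close> are guaranteed, up to constants\<close>
    define s where "s = real p / (\<tau> * Lp_norm 2 u)"
    have s: "0 < s" using u0 \<tau> p by (simp add: s_def)
    have s1: "\<bar>s\<bar> * (b * Lp_norm 2 u) \<le> 1" "\<bar>- s\<bar> * (b * Lp_norm 2 u) \<le> 1"
      using s \<tau>b u0 \<tau> by (simp_all add: s_def mult_ac)
    note E = expectation_exp_linear[where \<psi>=\<psi> and J=J, OF prob J \<psi> wv u]
    have e: "exp (s\<^sup>2 * (real (card J) * v * (Lp_norm 2 u)\<^sup>2)) \<le> exp (real p)"
    proof -
      have "s\<^sup>2 * (real (card J) * v * (Lp_norm 2 u)\<^sup>2) = (real p)\<^sup>2 * (real (card J) * v) / \<tau>\<^sup>2"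
        using u0 by (simp add: s_def power_divide power_mult_distrib)
      also have "\<dots> \<le> real p * (v * N * real p) / \<tau>\<^sup>2"
        using mult_left_mono[OF mult_right_mono[OF card v], of "(real p)\<^sup>2"]
        by (intro divide_right_mono) (auto simp: power2_eq_square mult_ac)
      also have "\<dots> \<le> real p"
        using \<tau>v \<tau> p by (simp add: divide_le_eq mult_left_mono)
      finally show ?thesis by simp
    qed
    have E2: "(LINT x|?Q. exp (r * ?W x)) \<le> exp (real p)" if "r = s \<or> r = - s" for r
    proof -
      have "(LINT x|?Q. exp (r * ?W x)) \<le> exp (r\<^sup>2 * (real (card J) * v * (Lp_norm 2 u)\<^sup>2))"
        by (rule E(2)) (use that s1 in auto)
      also have "r\<^sup>2 = s\<^sup>2" using that by auto
      finally show ?thesis using e by (rule order_trans)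
    qed
    have ci: "integrable ?Q (\<lambda>x. cosh (s * ?W x))"
      using E(1)[where s=s] E(1)[where s="- s"] s1 by (simp add: cosh_field_def)
    have "(LINT x|?Q. cosh (s * ?W x)) = ((LINT x|?Q. exp (s * ?W x)) + (LINT x|?Q. exp (- s * ?W x))) / 2"
      using E(1)[where s=s] E(1)[where s="- s"] s1 by (simp add: cosh_field_def)
    also have "\<dots> \<le> exp (real p)"
      using E2[of s] E2[of "- s"] by simp
    finally have c: "(LINT x|?Q. cosh (s * ?W x)) \<le> exp (real p)" .
    have pw: "?W x ^ (2 * p) \<le> fact (2 * p) / s ^ (2 * p) * cosh (s * ?W x)" for x
      using cosh_ge_even_power[of "s * ?W x" p] s by (simp add: power_mult_distrib field_simps)
    have "(LINT x|?Q. ?W x ^ (2 * p)) \<le> (LINT x|?Q. fact (2 * p) / s ^ (2 * p) * cosh (s * ?W x))"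
      using ci s pw by (intro integral_mono_AE') (auto simp: cosh_real_nonneg zero_le_power_eq)
    also have "\<dots> \<le> fact (2 * p) / s ^ (2 * p) * exp (real p)"
      using c s by (simp add: divide_right_mono)
    also have "\<dots> = fact (2 * p) * exp (real p) * (\<tau> * Lp_norm 2 u / real p) ^ (2 * p)"
      using p s by (simp add: s_def power_divide field_simps)
    also have "\<dots> \<le> (4 * (\<tau> * Lp_norm 2 u)) ^ (2 * p)"
      using \<tau> u0 p by (intro fact_exp_power_le) auto
    finally show ?thesis unfolding \<tau>_def .
  qed
qed

section \<open>Decoupling\<close>

lemma card_subsets_separating:
  assumes "finite J" "k \<in> J" "l \<in> J" "k \<noteq> l"
  shows "4 * card {I \<in> Pow J. l \<in> I \<and> k \<notin> I} = 2 ^ card J"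
proof -
  have bij: "bij_betw (insert l) (Pow (J - {k, l})) {I \<in> Pow J. l \<in> I \<and> k \<notin> I}"
  proof (rule bij_betwI[where g="\<lambda>I. I - {l}"])
    show "insert l \<in> Pow (J - {k, l}) \<rightarrow> {I \<in> Pow J. l \<in> I \<and> k \<notin> I}"
      using assms by auto
    show "(\<lambda>I. I - {l}) \<in> {I \<in> Pow J. l \<in> I \<and> k \<notin> I} \<rightarrow> Pow (J - {k, l})"
      by auto
  qed auto
  obtain m where m: "card (J - {k, l}) = m" by blast
  have "card J = m + 2"
    using assms card_Diff_subset[of "{k, l}" J] card_mono[of J "{k, l}"] m by simp
  moreover have "card {I \<in> Pow J. l \<in> I \<and> k \<notin> I} = 2 ^ m"
    using bij_betw_same_card[OF bij] assms m card_Pow[of "J - {k, l}"] by simp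
  ultimately show ?thesis by simp
qed

text \<open>A pair \<open>k \<noteq> l\<close> is separated by a quarter of all subsets \<open>I\<close>, so the off-diagonal sum is four times the
  average of its restrictions to \<open>(J - I) \<times> I\<close>.\<close>

lemma sum_decoupling:
  fixes g :: "'i \<Rightarrow> 'i \<Rightarrow> real"
  assumes J: "finite J"
  shows "(\<Sum>k\<in>J. \<Sum>l\<in>J - {k}. g k l) = (\<Sum>I\<in>Pow J. (1 / 2 ^ card J) * (4 * (\<Sum>k\<in>J - I. \<Sum>l\<in>I. g k l)))"
proof -
  let ?i = "\<lambda>k l I. if l \<in> I \<and> k \<notin> I then 1 else 0 :: real"
  have "(\<Sum>I\<in>Pow J. (1 / 2 ^ card J) * (4 * (\<Sum>k\<in>J - I. \<Sum>l\<in>I. g k l)))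
      = (4 / 2 ^ card J) * (\<Sum>I\<in>Pow J. \<Sum>k\<in>J - I. \<Sum>l\<in>I. g k l)"
    by (simp add: sum_distrib_left)
  also have "(\<Sum>I\<in>Pow J. \<Sum>k\<in>J - I. \<Sum>l\<in>I. g k l) = (\<Sum>I\<in>Pow J. \<Sum>k\<in>J. \<Sum>l\<in>J. ?i k l I * g k l)"
  proof (rule sum.cong[OF refl])
    fix I assume "I \<in> Pow J"
    then have I: "I \<subseteq> J" by simp
    have "(\<Sum>k\<in>J - I. \<Sum>l\<in>I. g k l) = (\<Sum>k\<in>J - I. \<Sum>l\<in>J. ?i k l I * g k l)"
      using J I by (intro sum.cong[OF refl] sum.mono_neutral_cong_left) auto
    also have "\<dots> = (\<Sum>k\<in>J. \<Sum>l\<in>J. ?i k l I * g k l)"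
      using J by (intro sum.mono_neutral_left) auto
    finally show "(\<Sum>k\<in>J - I. \<Sum>l\<in>I. g k l) = (\<Sum>k\<in>J. \<Sum>l\<in>J. ?i k l I * g k l)" .
  qed
  also have "\<dots> = (\<Sum>k\<in>J. \<Sum>l\<in>J. \<Sum>I\<in>Pow J. ?i k l I * g k l)"
    by (subst sum.swap, intro sum.cong refl, rule sum.swap)
  also have "\<dots> = (\<Sum>k\<in>J. \<Sum>l\<in>J. real (card {I \<in> Pow J. l \<in> I \<and> k \<notin> I}) * g k l)"
    using J by (simp add: sum_distrib_right[symmetric] sum.If_cases Int_def)
  also have "(4 / 2 ^ card J) * \<dots> = (\<Sum>k\<in>J. \<Sum>l\<in>J. if l = k then 0 else g k l)"
    unfolding sum_distrib_left
  proof (intro sum.cong refl)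
    fix k l assume kl: "k \<in> J" "l \<in> J"
    show "4 / 2 ^ card J * (real (card {I \<in> Pow J. l \<in> I \<and> k \<notin> I}) * g k l) = (if l = k then 0 else g k l)"
    proof (cases "l = k")
      case False
      have "4 * real (card {I \<in> Pow J. l \<in> I \<and> k \<notin> I}) = real (4 * card {I \<in> Pow J. l \<in> I \<and> k \<notin> I})"
        by simp
      also have "\<dots> = 2 ^ card J"
        using card_subsets_separating[OF J kl] False by simp
      finally show ?thesis using False by (simp add: field_simps)
    qed simp
  qed
  also have "\<dots> = (\<Sum>k\<in>J. \<Sum>l\<in>J - {k}. g k l)"
    using J by (intro sum.cong[OF refl] sum.mono_neutral_cong_right) auto
  finally show ?thesis by simp
qed

lemma L2_inner_sum_bounded:
  assumes J: "finite J" and \<phi>: "\<And>k. k \<in> J \<Longrightarrow> centered_L2 P (c k) (\<phi> k)"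
    and \<psi>: "\<And>k. k \<in> J \<Longrightarrow> centered_L2 P b (\<psi> k)"
    and x: "x \<in> space (Pi\<^sub>M J (\<lambda>_. P))" and I: "I \<subseteq> J" and K: "K \<subseteq> J" and b: "0 \<le> b"
  shows "\<bar>\<Sum>k\<in>K. L2_inner (\<psi> k (x k)) (\<lambda>t. \<Sum>l\<in>I. \<phi> l (x l) t)\<bar> \<le> (\<Sum>k\<in>K. b * (\<Sum>l\<in>I. c l))"
proof -
  let ?S = "\<lambda>t. \<Sum>l\<in>I. \<phi> l (x l) t"
  have S: "sq_int ?S" "Lp_norm 2 ?S \<le> (\<Sum>l\<in>I. c l)"
    using norm_sum_bounded[where \<phi>=\<phi> and c=c and J=J and P=P, OF \<phi> x I] by auto
  have "\<bar>\<Sum>k\<in>K. L2_inner (\<psi> k (x k)) ?S\<bar> \<le> (\<Sum>k\<in>K. \<bar>L2_inner (\<psi> k (x k)) ?S\<bar>)"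
    by (rule sum_abs)
  also have "\<dots> \<le> (\<Sum>k\<in>K. b * (\<Sum>l\<in>I. c l))"
  proof (rule sum_mono)
    fix k assume k: "k \<in> K"
    then have "\<bar>L2_inner (\<psi> k (x k)) ?S\<bar> \<le> b * Lp_norm 2 ?S"
      using K by (intro L2_inner_component_bounded[OF \<psi> S(1) PiM_component_in_space[OF x]]) auto
    also have "\<dots> \<le> b * (\<Sum>l\<in>I. c l)" using S(2) b by (rule mult_left_mono)
    finally show "\<bar>L2_inner (\<psi> k (x k)) ?S\<bar> \<le> b * (\<Sum>l\<in>I. c l)" .
  qed
  finally show ?thesis .
qed

lemma L2_inner_sum_measurable:
  assumes \<phi>: "\<And>k. k \<in> J \<Longrightarrow> centered_L2 P (c k) (\<phi> k)"
    and \<psi>: "\<And>k. k \<in> J \<Longrightarrow> centered_L2 P b (\<psi> k)" and I: "I \<subseteq> J" and K: "K \<subseteq> J"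
  shows "(\<lambda>x. \<Sum>k\<in>K. L2_inner (\<psi> k (x k)) (\<lambda>t. \<Sum>l\<in>I. \<phi> l (x l) t))
    \<in> borel_measurable (Pi\<^sub>M J (\<lambda>_. P))"
proof (rule borel_measurable_sum)
  fix k assume "k \<in> K"
  then have k: "k \<in> J" using K by auto
  show "(\<lambda>x. L2_inner (\<psi> k (x k)) (\<lambda>t. \<Sum>l\<in>I. \<phi> l (x l) t)) \<in> borel_measurable (Pi\<^sub>M J (\<lambda>_. P))"
  proof (rule L2_inner_measurable)
    show "case_prod (\<lambda>x. \<psi> k (x k)) \<in> borel_measurable (Pi\<^sub>M J (\<lambda>_. P) \<Otimes>\<^sub>M lborel)"
      by (rule PiM_component_measurable[OF centered_L2D(1)[OF \<psi>[OF k]] k])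
    show "case_prod (\<lambda>x t. \<Sum>l\<in>I. \<phi> l (x l) t) \<in> borel_measurable (Pi\<^sub>M J (\<lambda>_. P) \<Otimes>\<^sub>M lborel)"
      using I by (intro PiM_sum_measurable) (auto intro: centered_L2D(1)[OF \<phi>])
  qed
qed

lemma integrable_L2_inner_sum_power:
  assumes prob: "prob_space P" and J: "finite J" and \<phi>: "\<And>k. k \<in> J \<Longrightarrow> centered_L2 P (c k) (\<phi> k)"
    and \<psi>: "\<And>k. k \<in> J \<Longrightarrow> centered_L2 P b (\<psi> k)"
    and I: "I \<subseteq> J" and K: "K \<subseteq> J" and b: "0 \<le> b"
  shows "integrable (Pi\<^sub>M J (\<lambda>_. P))
    (\<lambda>x. (\<Sum>k\<in>K. L2_inner (\<psi> k (x k)) (\<lambda>t. \<Sum>l\<in>I. \<phi> l (x l) t)) ^ m)"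
proof (rule integrable_bounded_prob[OF prob_space_PiM_const[OF prob]])
  show "(\<lambda>x. (\<Sum>k\<in>K. L2_inner (\<psi> k (x k)) (\<lambda>t. \<Sum>l\<in>I. \<phi> l (x l) t)) ^ m)
      \<in> borel_measurable (Pi\<^sub>M J (\<lambda>_. P))"
    by (intro borel_measurable_power L2_inner_sum_measurable[where \<phi>=\<phi> and \<psi>=\<psi> and b=b and c=c, OF \<phi> \<psi> I K])
  fix x assume "x \<in> space (Pi\<^sub>M J (\<lambda>_. P))"
  from L2_inner_sum_bounded[where \<phi>=\<phi> and \<psi>=\<psi> and b=b and c=c, OF J \<phi> \<psi> this I K b]
  have "\<bar>\<Sum>k\<in>K. L2_inner (\<psi> k (x k)) (\<lambda>t. \<Sum>l\<in>I. \<phi> l (x l) t)\<bar> ^ m \<le> (\<Sum>k\<in>K. b * (\<Sum>l\<in>I. c l)) ^ m"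
    by (intro power_mono) auto
  then show "\<bar>(\<Sum>k\<in>K. L2_inner (\<psi> k (x k)) (\<lambda>t. \<Sum>l\<in>I. \<phi> l (x l) t)) ^ m\<bar>
      \<le> (\<Sum>k\<in>K. b * (\<Sum>l\<in>I. c l)) ^ m"
    by (simp add: power_abs)
qed

text \<open>The two groups of variables are independent. Conditioning on the group \<open>I\<close> leaves a linear
  functional of the other group, evaluated at a random vector whose norm has the moments of a sub-Gaussian variable.\<close>

lemma expectation_decoupled_power:
  assumes prob: "prob_space P" and J: "finite J" and I: "I \<subseteq> J" and card: "real (card J) \<le> N"
    and \<phi>: "\<And>k. k \<in> J \<Longrightarrow> centered_L2 P (c k) (\<phi> k)"
    and \<psi>: "\<And>k. k \<in> J \<Longrightarrow> centered_L2 P b (\<psi> k)"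
    and wv: "\<And>k. k \<in> J \<Longrightarrow> weak_variance_le P v (\<psi> k)"
    and V: "(\<Sum>k\<in>J. (c k)\<^sup>2) \<le> V" "0 < V"
    and b: "0 < b" and v: "0 \<le> v" and p: "1 \<le> p"
  shows "(LINT x|Pi\<^sub>M J (\<lambda>_. P).
      (\<Sum>k\<in>J - I. L2_inner (\<psi> k (x k)) (\<lambda>t. \<Sum>l\<in>I. \<phi> l (x l) t)) ^ (2 * p))
    \<le> (12 * (Bernstein_scale v b N (real p) * sqrt (real p * V))) ^ (2 * p)"
proof -
  interpret product_sigma_finite "\<lambda>_. P" by (rule product_sigma_finite_const[OF prob])
  let ?K = "J - I"
  let ?QI = "Pi\<^sub>M I (\<lambda>_. P)"
  let ?QK = "Pi\<^sub>M ?K (\<lambda>_. P)"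
  let ?S = "\<lambda>x t. \<Sum>l\<in>I. \<phi> l (x l) t"
  let ?T = "\<lambda>x. \<Sum>k\<in>?K. L2_inner (\<psi> k (x k)) (?S x)"
  let ?\<beta> = "Bernstein_scale v b N (real p)"
  have JIK: "J = I \<union> ?K" using I by auto
  have fin: "finite I" "finite ?K" using I J finite_subset by auto
  have int: "integrable (Pi\<^sub>M J (\<lambda>_. P)) (\<lambda>x. ?T x ^ (2 * p))"
    using b by (intro integrable_L2_inner_sum_power[where c=c and b=b, OF prob J \<phi> \<psi> I]) auto
  have "(LINT x|Pi\<^sub>M J (\<lambda>_. P). ?T x ^ (2 * p))
      = (LINT x|?QI. LINT y|?QK. ?T (merge I ?K (x, y)) ^ (2 * p))"
    using product_integral_fold[of I ?K "\<lambda>x. ?T x ^ (2 * p)"] fin int JIK[symmetric] by simp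
  also have "\<dots> = (LINT x|?QI. LINT y|?QK. (\<Sum>k\<in>?K. L2_inner (\<psi> k (y k)) (?S x)) ^ (2 * p))"
  proof -
    have S: "?S (merge I ?K (x, y)) = ?S x" for x y
      by (intro ext sum.cong) (auto simp: merge_def)
    have "?T (merge I ?K (x, y)) = (\<Sum>k\<in>?K. L2_inner (\<psi> k (y k)) (?S x))" for x y
      unfolding S by (intro sum.cong) (auto simp: merge_def)
    then show ?thesis by (simp only:)
  qed
  also have "\<dots> \<le> (LINT x|?QI. (4 * ?\<beta>) ^ (2 * p) * Lp_norm 2 (?S x) ^ (2 * p))"
  proof (rule integral_mono_AE')
    have Nb: "Lp_norm 2 (?S x) \<le> (\<Sum>l\<in>I. c l)" if "x \<in> space ?QI" for x
      using I by (intro norm_sum_bounded(2)[where P=P and J=I, OF _ that]) (auto intro: \<phi>)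
    have Nm: "(\<lambda>x. Lp_norm 2 (?S x)) \<in> borel_measurable ?QI"
      using I by (intro Lp_norm_2_measurable PiM_sum_measurable) (auto intro: centered_L2D(1)[OF \<phi>])
    have "integrable ?QI (\<lambda>x. Lp_norm 2 (?S x) ^ (2 * p))"
    proof (rule integrable_bounded_prob[OF prob_space_PiM_const[OF prob]])
      show "(\<lambda>x. Lp_norm 2 (?S x) ^ (2 * p)) \<in> borel_measurable ?QI" using Nm by measurable
      show "\<bar>Lp_norm 2 (?S x) ^ (2 * p)\<bar> \<le> (\<Sum>l\<in>I. c l) ^ (2 * p)" if "x \<in> space ?QI" for x
        using power_mono[OF Nb[OF that], of "2 * p"] by simp
    qed
    then show "integrable ?QI (\<lambda>x. (4 * ?\<beta>) ^ (2 * p) * Lp_norm 2 (?S x) ^ (2 * p))" by simp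
    show "AE x in ?QI. (LINT y|?QK. (\<Sum>k\<in>?K. L2_inner (\<psi> k (y k)) (?S x)) ^ (2 * p))
        \<le> (4 * ?\<beta>) ^ (2 * p) * Lp_norm 2 (?S x) ^ (2 * p)"
    proof (rule AE_I2)
      fix x assume x: "x \<in> space ?QI"
      have "sq_int (?S x)"
        using I by (intro norm_sum_bounded(1)[where P=P and J=I and c=c, OF _ x]) (auto intro: \<phi>)
      moreover have "real (card ?K) \<le> N"
        using card card_mono[OF J, of ?K] by (auto intro: order_trans[rotated])
      ultimately have "(LINT y|?QK. (\<Sum>k\<in>?K. L2_inner (\<psi> k (y k)) (?S x)) ^ (2 * p))
          \<le> (4 * (?\<beta> * Lp_norm 2 (?S x))) ^ (2 * p)"
        using fin b v p by (intro expectation_linear_power[OF prob]) (auto intro: \<psi> wv)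
      then show "(LINT y|?QK. (\<Sum>k\<in>?K. L2_inner (\<psi> k (y k)) (?S x)) ^ (2 * p))
          \<le> (4 * ?\<beta>) ^ (2 * p) * Lp_norm 2 (?S x) ^ (2 * p)"
        by (simp only: power_mult_distrib mult.assoc)
    qed
  qed (auto simp: zero_le_power_eq)
  also have "\<dots> = (4 * ?\<beta>) ^ (2 * p) * (LINT x|?QI. Lp_norm 2 (?S x) ^ (2 * p))" by simp
  also have "\<dots> \<le> (4 * ?\<beta>) ^ (2 * p) * (3 * sqrt (real p * V)) ^ (2 * p)"
  proof (rule mult_left_mono)
    have "(\<Sum>l\<in>I. (c l)\<^sup>2) \<le> V"
      using V sum_mono2[OF J I, of "\<lambda>l. (c l)\<^sup>2"] by simp
    then show "(LINT x|?QI. Lp_norm 2 (?S x) ^ (2 * p)) \<le> (3 * sqrt (real p * V)) ^ (2 * p)"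
      using V p fin I by (intro expectation_norm_sum_power[OF prob]) (auto intro: \<phi>)
  qed (simp add: zero_le_power_eq)
  also have "\<dots> = (12 * (?\<beta> * sqrt (real p * V))) ^ (2 * p)"
    unfolding power_mult_distrib[symmetric] by (simp add: mult_ac)
  finally show ?thesis .
qed

definition offdiag_form :: "'i set \<Rightarrow> ('i \<Rightarrow> 'b \<Rightarrow> real \<Rightarrow> real) \<Rightarrow> ('i \<Rightarrow> 'b \<Rightarrow> real \<Rightarrow> real) \<Rightarrow> ('i \<Rightarrow> 'b) \<Rightarrow> real" where
  "offdiag_form J \<psi> \<phi> x = (\<Sum>k\<in>J. \<Sum>l\<in>J - {k}. L2_inner (\<psi> k (x k)) (\<phi> l (x l)))"

text \<open>Convexity of \<open>t\<^sup>2\<^sup>p\<close> transfers the moment bound from each decoupled sum to their average.\<close>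

lemma expectation_offdiag_power:
  assumes prob: "prob_space P" and J: "finite J" and card: "real (card J) \<le> N"
    and \<phi>: "\<And>k. k \<in> J \<Longrightarrow> centered_L2 P (c k) (\<phi> k)"
    and \<psi>: "\<And>k. k \<in> J \<Longrightarrow> centered_L2 P b (\<psi> k)"
    and wv: "\<And>k. k \<in> J \<Longrightarrow> weak_variance_le P v (\<psi> k)"
    and V: "(\<Sum>k\<in>J. (c k)\<^sup>2) \<le> V" "0 < V"
    and b: "0 < b" and v: "0 \<le> v" and p: "1 \<le> p"
  shows "integrable (Pi\<^sub>M J (\<lambda>_. P)) (\<lambda>x. offdiag_form J \<psi> \<phi> x ^ (2 * p))" (is ?INT)
    and "(LINT x|Pi\<^sub>M J (\<lambda>_. P). offdiag_form J \<psi> \<phi> x ^ (2 * p))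
      \<le> (48 * (Bernstein_scale v b N (real p) * sqrt (real p * V))) ^ (2 * p)" (is ?E)
proof -
  let ?Q = "Pi\<^sub>M J (\<lambda>_. P)"
  let ?T = "\<lambda>I x. \<Sum>k\<in>J - I. L2_inner (\<psi> k (x k)) (\<lambda>t. \<Sum>l\<in>I. \<phi> l (x l) t)"
  let ?M = "Bernstein_scale v b N (real p) * sqrt (real p * V)"
  let ?w = "1 / 2 ^ card J :: real"
  have sq: "sq_int (\<psi> k (x k))" "sq_int (\<phi> k (x k))" if "x \<in> space ?Q" "k \<in> J" for x k
    using centered_L2D(2)[OF \<phi>[OF that(2)]] centered_L2D(2)[OF \<psi>[OF that(2)]]
      PiM_component_in_space[OF that] by auto
  have U: "offdiag_form J \<psi> \<phi> x = (\<Sum>I\<in>Pow J. ?w * (4 * ?T I x))" if x: "x \<in> space ?Q" for x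
  proof -
    have "(\<Sum>k\<in>J - I. \<Sum>l\<in>I. L2_inner (\<psi> k (x k)) (\<phi> l (x l))) = ?T I x" if I: "I \<in> Pow J" for I
    proof (rule sum.cong[OF refl])
      fix k assume "k \<in> J - I"
      then show "(\<Sum>l\<in>I. L2_inner (\<psi> k (x k)) (\<phi> l (x l))) = L2_inner (\<psi> k (x k)) (\<lambda>t. \<Sum>l\<in>I. \<phi> l (x l) t)"
        using I sq[OF x] by (subst L2_inner_sum_right) auto
    qed
    then show ?thesis
      unfolding offdiag_form_def sum_decoupling[OF J] by (intro sum.cong) simp_all
  qed
  have Ti: "integrable ?Q (\<lambda>x. ?T I x ^ m)" if "I \<in> Pow J" for I m
    using that b by (intro integrable_L2_inner_sum_power[where c=c and b=b, OF prob J \<phi> \<psi>]) auto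
  have w: "(\<Sum>I\<in>Pow J. ?w) = 1" using J by (simp add: card_Pow)
  have jensen: "offdiag_form J \<psi> \<phi> x ^ (2 * p) \<le> (\<Sum>I\<in>Pow J. ?w * (4 * ?T I x) ^ (2 * p))"
    if x: "x \<in> space ?Q" for x
    unfolding U[OF x]
    using convex_on_sum[OF _ _ convex_power_even[of "2 * p"], of "Pow J" "\<lambda>_. ?w" "\<lambda>I. 4 * ?T I x"]
      w J by auto
  have Ri: "integrable ?Q (\<lambda>x. \<Sum>I\<in>Pow J. ?w * (4 * ?T I x) ^ (2 * p))"
    using Ti by (intro Bochner_Integration.integrable_sum) (simp add: power_mult_distrib)
  have Um: "offdiag_form J \<psi> \<phi> \<in> borel_measurable ?Q"
  proof (subst measurable_cong[OF U])
    show "(\<lambda>x. \<Sum>I\<in>Pow J. ?w * (4 * ?T I x)) \<in> borel_measurable ?Q"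
      using borel_measurable_integrable[OF Ti[where m=1]] by (intro borel_measurable_sum) simp
  qed
  show i: ?INT
  proof (rule Bochner_Integration.integrable_bound[OF Ri])
    show "AE x in ?Q. norm (offdiag_form J \<psi> \<phi> x ^ (2 * p)) \<le> norm (\<Sum>I\<in>Pow J. ?w * (4 * ?T I x) ^ (2 * p))"
    proof (rule AE_I2)
      fix x assume "x \<in> space ?Q"
      from jensen[OF this]
      show "norm (offdiag_form J \<psi> \<phi> x ^ (2 * p)) \<le> norm (\<Sum>I\<in>Pow J. ?w * (4 * ?T I x) ^ (2 * p))"
        by (simp add: power_even_abs)
    qed
  qed (use Um in measurable)
  have "(LINT x|?Q. offdiag_form J \<psi> \<phi> x ^ (2 * p))
      \<le> (LINT x|?Q. (\<Sum>I\<in>Pow J. ?w * (4 * ?T I x) ^ (2 * p)))"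
    by (rule integral_mono[OF i Ri jensen])
  also have "\<dots> = (\<Sum>I\<in>Pow J. ?w * (4 ^ (2 * p) * (LINT x|?Q. ?T I x ^ (2 * p))))"
    using Ti by (subst Bochner_Integration.integral_sum) (simp_all add: power_mult_distrib)
  also have "\<dots> \<le> (\<Sum>I\<in>Pow J. ?w * (4 ^ (2 * p) * (12 * ?M) ^ (2 * p)))"
    using b v p V card
    by (intro sum_mono mult_left_mono expectation_decoupled_power[OF prob J]) (auto intro: \<phi> \<psi> wv)
  also have "\<dots> = 4 ^ (2 * p) * (12 * ?M) ^ (2 * p)"
    unfolding sum_distrib_right[symmetric] w by simp
  also have "\<dots> = (48 * ?M) ^ (2 * p)"
    unfolding power_mult_distrib[symmetric] by (simp add: mult_ac)
  finally show ?E .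
qed

section \<open>Tail bounds\<close>

text \<open>Markov's inequality at three times the moment bound: \<open>3\<^sup>-\<^sup>2\<^sup>p \<le> e\<^sup>-\<^sup>p\<close>.\<close>

lemma prob_tail_of_moment:
  fixes W :: "'c \<Rightarrow> real"
  assumes prob: "prob_space Q" and W: "W \<in> borel_measurable Q" and i: "integrable Q (\<lambda>x. W x ^ (2 * p))"
    and E: "(LINT x|Q. W x ^ (2 * p)) \<le> D ^ (2 * p)" and D: "0 \<le> D" and p: "1 \<le> p"
  shows "measure Q {x \<in> space Q. 3 * D < \<bar>W x\<bar>} \<le> exp (- real p)"
proof -
  interpret prob_space Q by fact
  note W[measurable]
  show ?thesis
  proof (cases "D = 0")
    case True
    have "(LINT x|Q. W x ^ (2 * p)) = 0"
    proof (rule antisym)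
      show "(LINT x|Q. W x ^ (2 * p)) \<le> 0" using E p True by (simp add: zero_power)
      show "0 \<le> (LINT x|Q. W x ^ (2 * p))" by (simp add: zero_le_power_eq)
    qed
    then have "AE x in Q. W x ^ (2 * p) = 0"
      by (subst (asm) integral_nonneg_eq_0_iff_AE[OF i]) (auto simp: zero_le_power_eq)
    then have "AE x in Q. x \<notin> {x \<in> space Q. 3 * D < \<bar>W x\<bar>}"
      by eventually_elim (use True p in auto)
    then have "prob {x \<in> space Q. 3 * D < \<bar>W x\<bar>} = 0"
      by (subst prob_eq_0) auto
    then show ?thesis by simp
  next
    case False
    then have D0: "0 < D" using D by simp
    have "prob {x \<in> space Q. 3 * D < \<bar>W x\<bar>} \<le> prob {x \<in> space Q. (3 * D) ^ (2 * p) \<le> W x ^ (2 * p)}"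
    proof (rule finite_measure_mono)
      show "{x \<in> space Q. 3 * D < \<bar>W x\<bar>} \<subseteq> {x \<in> space Q. (3 * D) ^ (2 * p) \<le> W x ^ (2 * p)}"
      proof safe
        fix x assume "3 * D < \<bar>W x\<bar>"
        then have "(3 * D) ^ (2 * p) \<le> \<bar>W x\<bar> ^ (2 * p)"
          using D by (intro power_mono) auto
        then show "(3 * D) ^ (2 * p) \<le> W x ^ (2 * p)" by (simp add: power_even_abs)
      qed
    qed measurable
    also have "\<dots> \<le> (LINT x|Q. W x ^ (2 * p)) / (3 * D) ^ (2 * p)"
      using D0 by (intro integral_Markov_inequality_measure[OF i, of "{}"]) (auto simp: zero_le_power_eq)
    also have "\<dots> \<le> D ^ (2 * p) / (3 * D) ^ (2 * p)"
      using D0 E by (intro divide_right_mono) auto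
    also have "\<dots> = 1 / 9 ^ p"
      using D0 by (simp add: power_mult_distrib power_mult)
    also have "\<dots> \<le> 1 / exp 1 ^ p"
      using exp_le by (intro divide_left_mono power_mono) auto
    also have "\<dots> = exp (- real p)"
      by (simp add: exp_minus exp_of_nat_mult[symmetric] divide_inverse)
    finally show ?thesis .
  qed
qed

lemma Bernstein_scale_double:
  assumes "0 \<le> v" "0 \<le> b" "0 \<le> N" "0 \<le> p" "p \<le> 2 * q"
  shows "Bernstein_scale v b N p \<le> 2 * Bernstein_scale v b N q"
proof -
  have "v * N * p \<le> 4 * (v * N * q)"
  proof -
    have nn: "0 \<le> v * N * q" using assms by (intro mult_nonneg_nonneg) auto
    have "v * N * p \<le> v * N * (2 * q)" using assms by (intro mult_left_mono mult_nonneg_nonneg)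
    also have "\<dots> = 2 * (v * N * q)" by simp
    also have "\<dots> \<le> 4 * (v * N * q)" using nn by linarith
    finally show ?thesis .
  qed
  then have "sqrt (v * N * p) \<le> 2 * sqrt (v * N * q)"
    using real_sqrt_le_mono[of "v * N * p" "4 * (v * N * q)"] by (simp add: real_sqrt_mult)
  moreover have "b * p \<le> 2 * (b * q)"
    using mult_left_mono[OF assms(5,2)] by simp
  ultimately show ?thesis unfolding Bernstein_scale_def by (simp add: distrib_left)
qed

text \<open>Taking \<open>p = \<lceil>\<lambda>\<rceil> \<le> 2 \<lambda>\<close> costs a factor \<open>2\<close> in each of the two scales, so the constant is
  \<open>3 \<cdot> 48 \<cdot> 4 = 576\<close>.\<close>

lemma offdiag_tail:
  assumes prob: "prob_space P" and J: "finite J"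
    and \<phi>: "\<And>k. k \<in> J \<Longrightarrow> centered_L2 P (c k) (\<phi> k)"
    and \<psi>: "\<And>k. k \<in> J \<Longrightarrow> centered_L2 P b (\<psi> k)"
    and wv: "\<And>k. k \<in> J \<Longrightarrow> weak_variance_le P v (\<psi> k)"
    and V: "(\<Sum>k\<in>J. (c k)\<^sup>2) \<le> V" "0 < V"
    and b: "0 < b" and v: "0 \<le> v" and lam: "1 \<le> lam"
  shows "offdiag_form J \<psi> \<phi> \<in> borel_measurable (Pi\<^sub>M J (\<lambda>_. P))"
    and "measure (Pi\<^sub>M J (\<lambda>_. P)) {x \<in> space (Pi\<^sub>M J (\<lambda>_. P)).
      576 * (Bernstein_scale v b (real (card J)) lam * sqrt (lam * V)) < \<bar>offdiag_form J \<psi> \<phi> x\<bar>} \<le> exp (- lam)"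
proof -
  let ?Q = "Pi\<^sub>M J (\<lambda>_. P)"
  let ?U = "offdiag_form J \<psi> \<phi>"
  let ?\<beta> = "Bernstein_scale v b (real (card J))"
  interpret Q: prob_space ?Q by (rule prob_space_PiM_const[OF prob])
  define p where "p = nat \<lceil>lam\<rceil>"
  have p: "1 \<le> p" "lam \<le> real p" "real p \<le> 2 * lam" using lam by (auto simp: p_def) linarith+
  note E = expectation_offdiag_power[where \<phi>=\<phi> and \<psi>=\<psi> and c=c and J=J, OF prob J order.refl \<phi> \<psi> wv V b v p(1)]
  show Um: "?U \<in> borel_measurable ?Q"
    unfolding offdiag_form_def
    by (intro borel_measurable_sum L2_inner_measurable PiM_component_measurable)
      (auto intro: centered_L2D(1)[OF \<phi>] centered_L2D(1)[OF \<psi>])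
  let ?D = "48 * (?\<beta> (real p) * sqrt (real p * V))"
  have \<beta>: "0 \<le> ?\<beta> (real p)" using b v by (simp add: Bernstein_scale_def)
  have "?\<beta> (real p) * sqrt (real p * V) \<le> (2 * ?\<beta> lam) * (2 * sqrt (lam * V))"
  proof (rule mult_mono)
    show "?\<beta> (real p) \<le> 2 * ?\<beta> lam" using b v p by (intro Bernstein_scale_double) auto
    have "real p * V \<le> 4 * (lam * V)" using p(3) V lam by (simp add: mult_right_mono)
    then show "sqrt (real p * V) \<le> 2 * sqrt (lam * V)"
      using real_sqrt_le_mono[of "real p * V" "4 * (lam * V)"] by (simp add: real_sqrt_mult)
  qed (use b v lam V in \<open>auto simp: Bernstein_scale_def\<close>)
  then have le: "3 * ?D \<le> 576 * (?\<beta> lam * sqrt (lam * V))" by (simp add: mult_ac)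
  have "Q.prob {x \<in> space ?Q. 576 * (?\<beta> lam * sqrt (lam * V)) < \<bar>?U x\<bar>}
      \<le> Q.prob {x \<in> space ?Q. 3 * ?D < \<bar>?U x\<bar>}"
  proof (rule Q.finite_measure_mono)
    show "{x \<in> space ?Q. 576 * (?\<beta> lam * sqrt (lam * V)) < \<bar>?U x\<bar>} \<subseteq> {x \<in> space ?Q. 3 * ?D < \<bar>?U x\<bar>}"
      using le_less_trans[OF le] by blast
  qed (use Um in measurable)
  also have "\<dots> \<le> exp (- real p)"
    using \<beta> V E by (intro prob_tail_of_moment[OF Q.prob_space_axioms Um]) (use p in auto)
  also have "\<dots> \<le> exp (- lam)" using p by simp
  finally show "Q.prob {x \<in> space ?Q. 576 * (?\<beta> lam * sqrt (lam * V)) < \<bar>?U x\<bar>} \<le> exp (- lam)" .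
qed

lemma linear_tail:
  assumes prob: "prob_space P" and J: "finite J"
    and \<psi>: "\<And>k. k \<in> J \<Longrightarrow> centered_L2 P b (\<psi> k)"
    and wv: "\<And>k. k \<in> J \<Longrightarrow> weak_variance_le P v (\<psi> k)"
    and u: "sq_int u" and b: "0 < b" and v: "0 \<le> v" and lam: "1 \<le> lam"
  shows "(\<lambda>x. \<Sum>k\<in>J. L2_inner (\<psi> k (x k)) u) \<in> borel_measurable (Pi\<^sub>M J (\<lambda>_. P))"
    and "measure (Pi\<^sub>M J (\<lambda>_. P)) {x \<in> space (Pi\<^sub>M J (\<lambda>_. P)).
      24 * (Bernstein_scale v b (real (card J)) lam * Lp_norm 2 u) < \<bar>\<Sum>k\<in>J. L2_inner (\<psi> k (x k)) u\<bar>}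
      \<le> exp (- lam)"
proof -
  let ?Q = "Pi\<^sub>M J (\<lambda>_. P)"
  let ?W = "\<lambda>x. \<Sum>k\<in>J. L2_inner (\<psi> k (x k)) u"
  let ?\<beta> = "Bernstein_scale v b (real (card J))"
  interpret Q: prob_space ?Q by (rule prob_space_PiM_const[OF prob])
  define p where "p = nat \<lceil>lam\<rceil>"
  have p: "1 \<le> p" "lam \<le> real p" "real p \<le> 2 * lam" using lam by (auto simp: p_def) linarith+
  show Wm: "?W \<in> borel_measurable ?Q"
    by (intro borel_measurable_sum L2_inner_measurable PiM_component_measurable case_prod_const_measurable u)
      (auto intro: centered_L2D(1)[OF \<psi>])
  have Wi: "integrable ?Q (\<lambda>x. ?W x ^ (2 * p))"
  proof (rule integrable_bounded_prob[OF Q.prob_space_axioms])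
    fix x assume x: "x \<in> space ?Q"
    have "\<bar>?W x\<bar> \<le> (\<Sum>k\<in>J. \<bar>L2_inner (\<psi> k (x k)) u\<bar>)" by (rule sum_abs)
    also have "\<dots> \<le> (\<Sum>k\<in>J. b * Lp_norm 2 u)"
      using L2_inner_component_bounded[OF \<psi> u PiM_component_in_space[OF x]] by (intro sum_mono) auto
    finally have "\<bar>?W x\<bar> ^ (2 * p) \<le> (\<Sum>k\<in>J. b * Lp_norm 2 u) ^ (2 * p)"
      by (intro power_mono) auto
    then show "\<bar>?W x ^ (2 * p)\<bar> \<le> (\<Sum>k\<in>J. b * Lp_norm 2 u) ^ (2 * p)" by (simp add: power_abs)
  qed (use Wm in measurable)
  note E = expectation_linear_power[where \<psi>=\<psi> and J=J, OF prob J order.refl \<psi> wv u b v p(1)]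
  let ?D = "4 * (?\<beta> (real p) * Lp_norm 2 u)"
  have \<beta>: "0 \<le> ?\<beta> (real p)" using b v by (simp add: Bernstein_scale_def)
  have "?\<beta> (real p) \<le> 2 * ?\<beta> lam" using b v p by (intro Bernstein_scale_double) auto
  from mult_right_mono[OF this, of "Lp_norm 2 u"]
  have le: "3 * ?D \<le> 24 * (?\<beta> lam * Lp_norm 2 u)" by (simp add: mult_ac)
  have "Q.prob {x \<in> space ?Q. 24 * (?\<beta> lam * Lp_norm 2 u) < \<bar>?W x\<bar>}
      \<le> Q.prob {x \<in> space ?Q. 3 * ?D < \<bar>?W x\<bar>}"
  proof (rule Q.finite_measure_mono)
    show "{x \<in> space ?Q. 24 * (?\<beta> lam * Lp_norm 2 u) < \<bar>?W x\<bar>} \<subseteq> {x \<in> space ?Q. 3 * ?D < \<bar>?W x\<bar>}"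
      using le_less_trans[OF le] by blast
  qed (use Wm in measurable)
  also have "\<dots> \<le> exp (- real p)"
    using \<beta> E by (intro prob_tail_of_moment[OF Q.prob_space_axioms Wm Wi]) (use p in auto)
  also have "\<dots> \<le> exp (- lam)" using p by simp
  finally show "Q.prob {x \<in> space ?Q. 24 * (?\<beta> lam * Lp_norm 2 u) < \<bar>?W x\<bar>} \<le> exp (- lam)" .
qed

section \<open>Translates of a kernel at a random point with bounded density\<close>

text \<open>The density of the law enters through integrals only, so an almost-everywhere bound \<open>F\<close> serves as well as a
  pointwise one.\<close>

locale dominated_by_lborel = prob_space P for P :: "real measure" +
  fixes F :: real
  assumes sets_P [measurable_cong]: "sets P = sets borel"
    and F_nonneg: "0 \<le> F"
    and nn_integral_le: "q \<in> borel_measurable borel \<Longrightarrow>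
      (\<integral>\<^sup>+ y. q y \<partial>P) \<le> ennreal F * (\<integral>\<^sup>+ y. q y \<partial>lborel)"
begin

lemma space_P [simp]: "space P = UNIV"
  using sets_eq_imp_space_eq[OF sets_P] by simp

sublocale pair: pair_sigma_finite P lborel
  by (simp add: pair_sigma_finite_def sigma_finite_measure_axioms lborel.sigma_finite_measure_axioms)

lemma integrable_P:
  fixes q :: "real \<Rightarrow> real"
  assumes "integrable lborel q"
  shows "integrable P q"
proof (rule integrableI_bounded)
  have [measurable]: "q \<in> borel_measurable borel" using assms by auto
  show "q \<in> borel_measurable P" by measurable
  have "(\<integral>\<^sup>+ y. norm (q y) \<partial>P) \<le> ennreal F * (\<integral>\<^sup>+ y. norm (q y) \<partial>lborel)"
    by (rule nn_integral_le) measurable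
  also have "\<dots> < \<infinity>"
    using assms by (simp add: integrable_iff_bounded ennreal_mult_less_top)
  finally show "(\<integral>\<^sup>+ y. norm (q y) \<partial>P) < \<infinity>" .
qed

lemma integral_P_le:
  fixes q :: "real \<Rightarrow> real"
  assumes q: "integrable lborel q" "\<And>y. 0 \<le> q y"
  shows "(LINT y|P. q y) \<le> F * (LINT y|lborel. q y)"
proof -
  have qm: "q \<in> borel_measurable borel" using q by auto
  have "ennreal (LINT y|P. q y) = (\<integral>\<^sup>+ y. q y \<partial>P)"
    using q integrable_P[OF q(1)] by (subst nn_integral_eq_integral) auto
  also have "\<dots> \<le> ennreal F * (\<integral>\<^sup>+ y. q y \<partial>lborel)"
    by (rule nn_integral_le) (use qm in measurable)
  also have "(\<integral>\<^sup>+ y. q y \<partial>lborel) = ennreal (LINT y|lborel. q y)"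
    using q by (subst nn_integral_eq_integral) auto
  finally show ?thesis
    using F_nonneg q by (simp add: ennreal_mult[symmetric] integral_nonneg_AE)
qed

end

lemma integral_translate:
  fixes q :: "real \<Rightarrow> real"
  assumes "integrable lborel q"
  shows "integrable lborel (\<lambda>t. q (y - t))" "(LINT t|lborel. q (y - t)) = (LINT t|lborel. q t)"
    "integrable lborel (\<lambda>t. q (t - y))" "(LINT t|lborel. q (t - y)) = (LINT t|lborel. q t)"
  using lborel_integrable_real_affine[OF assms, of "- 1" y] lborel_integral_real_affine[of "- 1" q y]
    lborel_integrable_real_affine[OF assms, of 1 "- y"] lborel_integral_real_affine[of 1 q "- y"]
  by simp_all

definition translate :: "(real \<Rightarrow> real) \<Rightarrow> real \<Rightarrow> real \<Rightarrow> real" where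
  "translate g y t = g (y - t)"

lemma
  assumes g: "sq_int g"
  shows sq_int_translate: "sq_int (translate g y)"
    and Lp_norm_translate: "Lp_norm 2 (translate g y) = Lp_norm 2 g"
proof -
  have i: "integrable lborel (\<lambda>t. (g t)\<^sup>2)" and [measurable]: "g \<in> borel_measurable borel"
    using g by (auto simp: sq_int_def)
  show "sq_int (translate g y)"
    using integral_translate(1)[OF i, of y] by (simp add: sq_int_def translate_def[abs_def])
  have "(Lp_norm 2 (translate g y))\<^sup>2 = (Lp_norm 2 g)\<^sup>2"
    using integral_translate(2)[OF i, of y] by (simp add: Lp_norm_2_sq translate_def)
  then show "Lp_norm 2 (translate g y) = Lp_norm 2 g" by simp
qed

lemma L2_inner_translate:
  assumes "sq_int g" "sq_int g'"
  shows "L2_inner (translate g y) (translate g' y) = L2_inner g g'"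
  using integral_translate(2)[OF sq_int_mult_integrable[OF assms], of y]
  by (simp add: L2_inner_def translate_def)

text \<open>Used against a bounded mean function, this keeps inner products bounded uniformly in the bandwidth, where the
  Cauchy-Schwarz inequality would lose a power of it.\<close>

lemma L2_inner_le_L1_bound:
  assumes g: "integrable lborel g" and w: "w \<in> borel_measurable borel" "\<And>t. \<bar>w t\<bar> \<le> B"
  shows "\<bar>L2_inner g w\<bar> \<le> (LINT t|lborel. \<bar>g t\<bar>) * B"
proof -
  have [measurable]: "g \<in> borel_measurable borel" using g by auto
  note w(1)[measurable]
  have B: "0 \<le> B" using w(2)[of 0] by linarith
  have gw: "integrable lborel (\<lambda>t. \<bar>g t\<bar> * B)" using g by auto
  have "\<bar>L2_inner g w\<bar> \<le> (LINT t|lborel. \<bar>g t * w t\<bar>)"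
    unfolding L2_inner_def by (rule integral_abs_bound)
  also have "\<dots> \<le> (LINT t|lborel. \<bar>g t\<bar> * B)"
    using w(2) gw B by (intro integral_mono_AE' AE_I2) (auto simp: abs_mult intro!: mult_left_mono)
  finally show ?thesis by simp
qed

definition mean_translate :: "real measure \<Rightarrow> (real \<Rightarrow> real) \<Rightarrow> real \<Rightarrow> real" where
  "mean_translate P g t = (LINT y|P. translate g y t)"

definition centered_translate :: "real measure \<Rightarrow> (real \<Rightarrow> real) \<Rightarrow> real \<Rightarrow> real \<Rightarrow> real" where
  "centered_translate P g y t = translate g y t - mean_translate P g t"

lemma Lp_norm_1_translate:
  assumes "integrable lborel g"
  shows "integrable lborel (translate g y)"
    and "(LINT t|lborel. \<bar>translate g y t\<bar>) = (LINT t|lborel. \<bar>g t\<bar>)"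
  using integral_translate(1)[OF assms, of y]
    integral_translate(2)[of "\<lambda>t. \<bar>g t\<bar>" y] assms
  by (simp_all add: translate_def[abs_def])

context dominated_by_lborel
begin

context
  fixes g :: "real \<Rightarrow> real"
  assumes g: "sq_int g" and gi: "integrable lborel g"
begin

lemma g_measurable [measurable]: "g \<in> borel_measurable borel"
  using g by (rule sq_int_measurable)

lemma translate_measurable [measurable]:
  "(\<lambda>(y, t). translate g y t) \<in> borel_measurable (P \<Otimes>\<^sub>M lborel)"
  unfolding translate_def by measurable

lemma mean_translate_measurable [measurable]: "mean_translate P g \<in> borel_measurable borel"
  unfolding mean_translate_def[abs_def] translate_def by measurable

lemma integrable_translate_P:
  shows "integrable P (\<lambda>y. translate g y t)" "integrable P (\<lambda>y. (translate g y t)\<^sup>2)"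
  using integral_translate(3)[OF gi, of t] integral_translate(3)[of "\<lambda>t. (g t)\<^sup>2" t] g
  by (auto simp: translate_def sq_int_def intro!: integrable_P)

lemma mean_translate_bounded: "\<bar>mean_translate P g t\<bar> \<le> F * (LINT t|lborel. \<bar>g t\<bar>)"
proof -
  have "\<bar>mean_translate P g t\<bar> \<le> (LINT y|P. \<bar>g (y - t)\<bar>)"
    unfolding mean_translate_def translate_def by (rule integral_abs_bound)
  also have "\<dots> \<le> F * (LINT y|lborel. \<bar>g (y - t)\<bar>)"
    using integral_translate(3)[OF gi, of t] by (intro integral_P_le) auto
  also have "(LINT y|lborel. \<bar>g (y - t)\<bar>) = (LINT t|lborel. \<bar>g t\<bar>)"
    using integral_translate(4)[of "\<lambda>t. \<bar>g t\<bar>" t] gi by simp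
  finally show ?thesis .
qed

text \<open>Jensen's inequality, in the form of nonnegativity of the variance. Integrated over \<open>t\<close>, it shows that averaging the
  translates does not increase the norm.\<close>

lemma mean_translate_sq_le: "(mean_translate P g t)\<^sup>2 \<le> (LINT y|P. (translate g y t)\<^sup>2)"
proof -
  have "0 \<le> variance (\<lambda>y. translate g y t)" by simp
  then show ?thesis
    using variance_eq[OF integrable_translate_P] by (simp add: mean_translate_def)
qed

lemma
  shows sq_int_mean_translate: "sq_int (mean_translate P g)"
    and Lp_norm_mean_translate_le: "Lp_norm 2 (mean_translate P g) \<le> Lp_norm 2 g"
proof -
  have "(\<integral>\<^sup>+ t. (mean_translate P g t)\<^sup>2 \<partial>lborel) \<le> (\<integral>\<^sup>+ t. \<integral>\<^sup>+ y. (translate g y t)\<^sup>2 \<partial>P \<partial>lborel)"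
  proof (rule nn_integral_mono)
    fix t
    have "ennreal ((mean_translate P g t)\<^sup>2) \<le> ennreal (LINT y|P. (translate g y t)\<^sup>2)"
      using mean_translate_sq_le by (rule ennreal_leI)
    also have "\<dots> = (\<integral>\<^sup>+ y. (translate g y t)\<^sup>2 \<partial>P)"
      using integrable_translate_P(2) by (subst nn_integral_eq_integral) auto
    finally show "ennreal ((mean_translate P g t)\<^sup>2) \<le> (\<integral>\<^sup>+ y. (translate g y t)\<^sup>2 \<partial>P)" .
  qed
  also have "\<dots> = (\<integral>\<^sup>+ y. \<integral>\<^sup>+ t. (translate g y t)\<^sup>2 \<partial>lborel \<partial>P)"
    by (rule pair.Fubini') measurable
  also have "\<dots> = (\<integral>\<^sup>+ y. ennreal ((Lp_norm 2 g)\<^sup>2) \<partial>P)"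
  proof (rule nn_integral_cong)
    fix y
    have "(\<integral>\<^sup>+ t. (translate g y t)\<^sup>2 \<partial>lborel) = ennreal (LINT t|lborel. (translate g y t)\<^sup>2)"
      using sq_int_translate[OF g, of y] by (subst nn_integral_eq_integral) (auto simp: sq_int_def)
    then show "(\<integral>\<^sup>+ t. (translate g y t)\<^sup>2 \<partial>lborel) = ennreal ((Lp_norm 2 g)\<^sup>2)"
      using Lp_norm_translate[OF g, of y] by (simp add: Lp_norm_2_sq[symmetric])
  qed
  also have "\<dots> = ennreal ((Lp_norm 2 g)\<^sup>2)" by (simp add: emeasure_space_1[simplified])
  finally have le: "(\<integral>\<^sup>+ t. (mean_translate P g t)\<^sup>2 \<partial>lborel) \<le> ennreal ((Lp_norm 2 g)\<^sup>2)" .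
  have i: "integrable lborel (\<lambda>t. (mean_translate P g t)\<^sup>2)"
    using le by (intro integrableI_bounded) (auto intro: le_less_trans)
  then show "sq_int (mean_translate P g)" by (simp add: sq_int_def)
  have "ennreal (LINT t|lborel. (mean_translate P g t)\<^sup>2) \<le> ennreal ((Lp_norm 2 g)\<^sup>2)"
    using le i by (subst (asm) nn_integral_eq_integral) auto
  then have "(Lp_norm 2 (mean_translate P g))\<^sup>2 \<le> (Lp_norm 2 g)\<^sup>2"
    by (simp add: Lp_norm_2_sq)
  then show "Lp_norm 2 (mean_translate P g) \<le> Lp_norm 2 g" by (rule power2_le_imp_le) simp
qed

lemma expectation_L2_inner_translate:
  assumes u: "sq_int u"
  shows "integrable P (\<lambda>y. L2_inner (translate g y) u)"
    and "(LINT y|P. L2_inner (translate g y) u) = L2_inner (mean_translate P g) u"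
proof -
  have [measurable]: "u \<in> borel_measurable borel" using u by (rule sq_int_measurable)
  have "integrable (P \<Otimes>\<^sub>M lborel) (\<lambda>(y, t). translate g y t * u t)"
  proof (rule integrableI_bounded)
    have "(\<integral>\<^sup>+ p. norm (case p of (y, t) \<Rightarrow> translate g y t * u t) \<partial>(P \<Otimes>\<^sub>M lborel))
        = (\<integral>\<^sup>+ y. \<integral>\<^sup>+ t. norm (translate g y t * u t) \<partial>lborel \<partial>P)"
      by (subst lborel.nn_integral_fst[symmetric]) (auto simp: case_prod_beta')
    also have "\<dots> \<le> (\<integral>\<^sup>+ y. ennreal ((Lp_norm 2 g) * Lp_norm 2 u) \<partial>P)"
    proof (rule nn_integral_mono)
      fix y
      have ga: "sq_int (\<lambda>t. \<bar>translate g y t\<bar>)" and ua: "sq_int (\<lambda>t. \<bar>u t\<bar>)"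
        using sq_int_translate[OF g, of y] u by (auto simp: sq_int_def)
      have "(\<integral>\<^sup>+ t. norm (translate g y t * u t) \<partial>lborel) = ennreal (L2_inner (\<lambda>t. \<bar>translate g y t\<bar>) (\<lambda>t. \<bar>u t\<bar>))"
        using sq_int_mult_integrable[OF ga ua]
        by (simp add: L2_inner_def abs_mult nn_integral_eq_integral)
      also have "\<dots> \<le> ennreal (Lp_norm 2 (\<lambda>t. \<bar>translate g y t\<bar>) * Lp_norm 2 (\<lambda>t. \<bar>u t\<bar>))"
        using L2_Cauchy_Schwarz[OF ga ua] by (intro ennreal_leI) linarith
      also have "Lp_norm 2 (\<lambda>t. \<bar>translate g y t\<bar>) = Lp_norm 2 g"
        using Lp_norm_translate[OF g, of y] by (simp add: Lp_norm_def)
      also have "Lp_norm 2 (\<lambda>t. \<bar>u t\<bar>) = Lp_norm 2 u" by (simp add: Lp_norm_def)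
      finally show "(\<integral>\<^sup>+ t. norm (translate g y t * u t) \<partial>lborel) \<le> ennreal (Lp_norm 2 g * Lp_norm 2 u)" .
    qed
    also have "\<dots> < \<infinity>" by (simp add: emeasure_space_1[simplified])
    finally show "(\<integral>\<^sup>+ p. norm (case p of (y, t) \<Rightarrow> translate g y t * u t) \<partial>(P \<Otimes>\<^sub>M lborel)) < \<infinity>" .
  qed measurable
  note F = this
  show "integrable P (\<lambda>y. L2_inner (translate g y) u)"
    unfolding L2_inner_def using pair.integrable_fst[OF F] by simp
  have "(LINT y|P. L2_inner (translate g y) u) = (LINT t|lborel. LINT y|P. translate g y t * u t)"
    unfolding L2_inner_def using pair.Fubini_integral[OF F] by simp
  then show "(LINT y|P. L2_inner (translate g y) u) = L2_inner (mean_translate P g) u"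
    by (simp add: L2_inner_def mean_translate_def)
qed

text \<open>Young's inequality for convolutions, \<open>|g * u|\<^sub>2 \<le> |g|\<^sub>1 |u|\<^sub>2\<close>: by Cauchy-Schwarz with weight \<open>|g|\<close>,
  \<open>\<langle>g(y - \<cdot>), u\<rangle>\<^sup>2 \<le> |g|\<^sub>1 \<integral> |g(y - t)| u(t)\<^sup>2 dt\<close>, and Tonelli's theorem integrates the right-hand side over \<open>y\<close>.
  The bound involves \<open>g\<close> only through its \<open>L\<^sup>1\<close> norm, which is invariant under rescaling.\<close>

lemma expectation_L2_inner_translate_sq:
  assumes u: "sq_int u"
  shows "(LINT y|P. (L2_inner (translate g y) u)\<^sup>2) \<le> F * (LINT t|lborel. \<bar>g t\<bar>)\<^sup>2 * (Lp_norm 2 u)\<^sup>2"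
proof -
  let ?a = "LINT t|lborel. \<bar>g t\<bar>"
  have [measurable]: "u \<in> borel_measurable borel" using u by (rule sq_int_measurable)
  have pt: "ennreal ((L2_inner (translate g y) u)\<^sup>2)
      \<le> ennreal ?a * (\<integral>\<^sup>+ t. \<bar>translate g y t\<bar> * (u t)\<^sup>2 \<partial>lborel)" for y
  proof -
    have i: "integrable lborel (\<lambda>t. \<bar>translate g y t * u t\<bar>)"
      using sq_int_mult_integrable[OF sq_int_translate[OF g] u] by simp
    have "ennreal \<bar>L2_inner (translate g y) u\<bar> \<le> ennreal (LINT t|lborel. \<bar>translate g y t * u t\<bar>)"
      unfolding L2_inner_def by (intro ennreal_leI integral_abs_bound)
    also have "\<dots> = (\<integral>\<^sup>+ t. \<bar>translate g y t * u t\<bar> \<partial>lborel)"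
      using i by (subst nn_integral_eq_integral) auto
    also have "\<dots> = (\<integral>\<^sup>+ t. ennreal (sqrt \<bar>translate g y t\<bar>) * ennreal (sqrt \<bar>translate g y t\<bar> * \<bar>u t\<bar>) \<partial>lborel)"
      by (intro nn_integral_cong) (simp add: ennreal_mult[symmetric] abs_mult mult.assoc[symmetric])
    finally have "(ennreal \<bar>L2_inner (translate g y) u\<bar>)\<^sup>2 \<le>
      (\<integral>\<^sup>+ t. ennreal (sqrt \<bar>translate g y t\<bar>) * ennreal (sqrt \<bar>translate g y t\<bar> * \<bar>u t\<bar>) \<partial>lborel)\<^sup>2"
      by (rule power_mono) simp
    also have "\<dots> \<le> (\<integral>\<^sup>+ t. (ennreal (sqrt \<bar>translate g y t\<bar>))\<^sup>2 \<partial>lborel) *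
        (\<integral>\<^sup>+ t. (ennreal (sqrt \<bar>translate g y t\<bar> * \<bar>u t\<bar>))\<^sup>2 \<partial>lborel)"
      by (rule Cauchy_Schwarz_nn_integral) (simp_all add: translate_def)
    also have "(\<integral>\<^sup>+ t. (ennreal (sqrt \<bar>translate g y t\<bar>))\<^sup>2 \<partial>lborel) = (\<integral>\<^sup>+ t. \<bar>translate g y t\<bar> \<partial>lborel)"
      by (intro nn_integral_cong) (simp add: ennreal_power)
    also have "\<dots> = ennreal ?a"
      using Lp_norm_1_translate[OF gi, of y] by (subst nn_integral_eq_integral) auto
    also have "(\<integral>\<^sup>+ t. (ennreal (sqrt \<bar>translate g y t\<bar> * \<bar>u t\<bar>))\<^sup>2 \<partial>lborel)
        = (\<integral>\<^sup>+ t. \<bar>translate g y t\<bar> * (u t)\<^sup>2 \<partial>lborel)"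
      by (intro nn_integral_cong) (simp add: ennreal_power power_mult_distrib)
    finally show ?thesis by (simp add: ennreal_power)
  qed
  have a0: "0 \<le> ?a" by simp
  have [measurable]: "(\<lambda>y. L2_inner (translate g y) u) \<in> borel_measurable borel"
    unfolding L2_inner_def translate_def by measurable
  have "(\<integral>\<^sup>+ y. (L2_inner (translate g y) u)\<^sup>2 \<partial>P)
      \<le> ennreal F * (\<integral>\<^sup>+ y. (L2_inner (translate g y) u)\<^sup>2 \<partial>lborel)"
    by (rule nn_integral_le) measurable
  also have "\<dots> \<le> ennreal F * (\<integral>\<^sup>+ y. ennreal ?a * (\<integral>\<^sup>+ t. \<bar>translate g y t\<bar> * (u t)\<^sup>2 \<partial>lborel) \<partial>lborel)"
    by (intro mult_left_mono nn_integral_mono pt) auto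
  also have "(\<integral>\<^sup>+ y. ennreal ?a * (\<integral>\<^sup>+ t. \<bar>translate g y t\<bar> * (u t)\<^sup>2 \<partial>lborel) \<partial>lborel)
      = ennreal ?a * (\<integral>\<^sup>+ y. \<integral>\<^sup>+ t. \<bar>translate g y t\<bar> * (u t)\<^sup>2 \<partial>lborel \<partial>lborel)"
    unfolding translate_def by (rule nn_integral_cmult) measurable
  also have "(\<integral>\<^sup>+ y. \<integral>\<^sup>+ t. \<bar>translate g y t\<bar> * (u t)\<^sup>2 \<partial>lborel \<partial>lborel)
      = (\<integral>\<^sup>+ t. \<integral>\<^sup>+ y. \<bar>translate g y t\<bar> * (u t)\<^sup>2 \<partial>lborel \<partial>lborel)"
    unfolding translate_def by (rule lborel_pair.Fubini') measurable
  also have "\<dots> = (\<integral>\<^sup>+ t. ennreal ?a * ennreal ((u t)\<^sup>2) \<partial>lborel)"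
  proof (rule nn_integral_cong)
    fix t
    have "(\<integral>\<^sup>+ y. \<bar>translate g y t\<bar> * (u t)\<^sup>2 \<partial>lborel) = (\<integral>\<^sup>+ y. ennreal \<bar>g (y - t)\<bar> * ennreal ((u t)\<^sup>2) \<partial>lborel)"
      by (simp add: translate_def ennreal_mult)
    also have "\<dots> = (\<integral>\<^sup>+ y. ennreal \<bar>g (y - t)\<bar> \<partial>lborel) * ennreal ((u t)\<^sup>2)"
      by (rule nn_integral_multc) measurable
    also have "(\<integral>\<^sup>+ y. ennreal \<bar>g (y - t)\<bar> \<partial>lborel) = ennreal ?a"
      using integral_translate(3,4)[of "\<lambda>t. \<bar>g t\<bar>" t] gi by (subst nn_integral_eq_integral) auto
    finally show "(\<integral>\<^sup>+ y. \<bar>translate g y t\<bar> * (u t)\<^sup>2 \<partial>lborel) = ennreal ?a * ennreal ((u t)\<^sup>2)" .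
  qed
  also have "\<dots> = ennreal ?a * (\<integral>\<^sup>+ t. ennreal ((u t)\<^sup>2) \<partial>lborel)"
    by (rule nn_integral_cmult) measurable
  also have "(\<integral>\<^sup>+ t. ennreal ((u t)\<^sup>2) \<partial>lborel) = ennreal ((Lp_norm 2 u)\<^sup>2)"
    using u by (subst nn_integral_eq_integral) (auto simp: sq_int_def Lp_norm_2_sq)
  finally have "(\<integral>\<^sup>+ y. (L2_inner (translate g y) u)\<^sup>2 \<partial>P) \<le> ennreal (F * ?a\<^sup>2 * (Lp_norm 2 u)\<^sup>2)"
    using F_nonneg a0 by (simp add: ennreal_mult[symmetric] power2_eq_square mult.assoc)
  moreover have "(LINT y|P. (L2_inner (translate g y) u)\<^sup>2)
      = enn2real (\<integral>\<^sup>+ y. (L2_inner (translate g y) u)\<^sup>2 \<partial>P)"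
    by (rule integral_eq_nn_integral) auto
  ultimately show ?thesis
    using F_nonneg by (simp add: enn2real_leI)
qed

lemma centered_translate_field:
  shows "centered_L2 P (2 * Lp_norm 2 g) (centered_translate P g)"
    and "weak_variance_le P (F * (LINT t|lborel. \<bar>g t\<bar>)\<^sup>2) (centered_translate P g)"
proof -
  note ms = sq_int_mean_translate and ts = sq_int_translate[OF g]
  have inner: "L2_inner (centered_translate P g y) u
      = L2_inner (translate g y) u - L2_inner (mean_translate P g) u" if "sq_int u" for u y
    unfolding centered_translate_def[abs_def] using that ms ts[of y]
    by (simp add: L2_inner_diff_left)
  show "centered_L2 P (2 * Lp_norm 2 g) (centered_translate P g)"
    unfolding centered_L2_def
  proof (intro conjI ballI allI impI)
    show "case_prod (centered_translate P g) \<in> borel_measurable (P \<Otimes>\<^sub>M lborel)"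
      unfolding centered_translate_def[abs_def] by measurable
    fix y
    show "sq_int (centered_translate P g y)"
      unfolding centered_translate_def[abs_def] using ms ts by auto
    have "Lp_norm 2 (\<lambda>t. translate g y t + (- 1) * mean_translate P g t)
        \<le> Lp_norm 2 (translate g y) + Lp_norm 2 (\<lambda>t. (- 1) * mean_translate P g t)"
      by (rule Lp_norm_2_triangle[OF ts sq_int_cmult[OF ms]])
    also have "Lp_norm 2 (\<lambda>t. (- 1) * mean_translate P g t) = Lp_norm 2 (mean_translate P g)"
      by (simp add: Lp_norm_def)
    also have "Lp_norm 2 (translate g y) + Lp_norm 2 (mean_translate P g) \<le> 2 * Lp_norm 2 g"
      using Lp_norm_mean_translate_le Lp_norm_translate[OF g, of y] by simp
    finally show "Lp_norm 2 (centered_translate P g y) \<le> 2 * Lp_norm 2 g"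
      by (simp add: centered_translate_def[abs_def])
  next
    fix u assume u: "sq_int u"
    show "(LINT y|P. L2_inner (centered_translate P g y) u) = 0"
      unfolding inner[OF u] using expectation_L2_inner_translate[OF u] by (simp add: prob_space[simplified])
  qed
  show "weak_variance_le P (F * (LINT t|lborel. \<bar>g t\<bar>)\<^sup>2) (centered_translate P g)"
    unfolding weak_variance_le_def
  proof (intro allI impI)
    fix u assume u: "sq_int u"
    let ?r = "\<lambda>y. L2_inner (translate g y) u"
    have rm: "?r \<in> borel_measurable P"
      using expectation_L2_inner_translate(1)[OF u] by auto
    have "integrable P (\<lambda>y. (?r y)\<^sup>2)"
    proof (rule integrable_bounded_prob[OF prob_space_axioms])
      show "(\<lambda>y. (?r y)\<^sup>2) \<in> borel_measurable P" using rm by measurable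
      show "\<bar>(?r y)\<^sup>2\<bar> \<le> (Lp_norm 2 g * Lp_norm 2 u)\<^sup>2" for y
        using power_mono[OF L2_Cauchy_Schwarz[OF ts[of y] u], of 2]
        by (simp add: Lp_norm_translate[OF g])
    qed
    then have "variance ?r = (LINT y|P. (?r y)\<^sup>2) - (LINT y|P. ?r y)\<^sup>2"
      using expectation_L2_inner_translate(1)[OF u] by (rule variance_eq[rotated])
    then have "variance ?r \<le> (LINT y|P. (?r y)\<^sup>2)" by simp
    also have "\<dots> \<le> F * (LINT t|lborel. \<bar>g t\<bar>)\<^sup>2 * (Lp_norm 2 u)\<^sup>2"
      by (rule expectation_L2_inner_translate_sq[OF u])
    finally show "(LINT y|P. (L2_inner (centered_translate P g y) u)\<^sup>2)
        \<le> F * (LINT t|lborel. \<bar>g t\<bar>)\<^sup>2 * (Lp_norm 2 u)\<^sup>2"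
      unfolding inner[OF u] expectation_L2_inner_translate(2)[OF u] .
  qed
qed

end

text \<open>The inner product of two kernels translated by the same \<open>y\<close> is independent of \<open>y\<close>; centering changes it by
  three terms, each containing a mean function, which is bounded uniformly in the bandwidth.\<close>

lemma L2_inner_centered_translate:
  assumes g: "sq_int g" "integrable lborel g" and g': "sq_int g'" "integrable lborel g'"
  shows "\<bar>L2_inner (centered_translate P g y) (centered_translate P g' y) - L2_inner g g'\<bar>
    \<le> 3 * (F * (LINT t|lborel. \<bar>g t\<bar>) * (LINT t|lborel. \<bar>g' t\<bar>))"
proof -
  let ?B = "F * (LINT t|lborel. \<bar>g t\<bar>) * (LINT t|lborel. \<bar>g' t\<bar>)"
  note sq = sq_int_mean_translate[OF g] sq_int_mean_translate[OF g'] sq_int_translate[OF g(1), of y]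
    sq_int_translate[OF g'(1), of y]
  have tm: "\<bar>L2_inner (translate g1 z) (mean_translate P g2)\<bar>
      \<le> (LINT t|lborel. \<bar>g1 t\<bar>) * (F * (LINT t|lborel. \<bar>g2 t\<bar>))"
    if "sq_int g1" "integrable lborel g1" "sq_int g2" "integrable lborel g2" for g1 g2 z
    using L2_inner_le_L1_bound[OF Lp_norm_1_translate(1)[OF that(2)] mean_translate_measurable[OF that(3,4)]
        mean_translate_bounded[OF that(3,4)]] Lp_norm_1_translate(2)[OF that(2)] by simp
  have b1: "\<bar>L2_inner (translate g z) (mean_translate P g')\<bar> \<le> ?B" for z
    using tm[OF g g', of z] by (simp add: mult_ac)
  have b2: "\<bar>L2_inner (mean_translate P g) (translate g' y)\<bar> \<le> ?B"
    using tm[OF g' g, of y] by (simp add: mult_ac L2_inner_commute)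
  have "\<bar>L2_inner (mean_translate P g) (mean_translate P g')\<bar>
      = \<bar>LINT z|P. L2_inner (translate g z) (mean_translate P g')\<bar>"
    using expectation_L2_inner_translate(2)[OF g sq(2)] by simp
  also have "\<dots> \<le> (LINT z|P. \<bar>L2_inner (translate g z) (mean_translate P g')\<bar>)"
    by (rule integral_abs_bound)
  also have "\<dots> \<le> ?B"
    using expectation_L2_inner_translate(1)[OF g sq(2)] b1
    by (intro integral_bounded_prob[OF prob_space_axioms]) auto
  finally have b3: "\<bar>L2_inner (mean_translate P g) (mean_translate P g')\<bar> \<le> ?B" .
  have "L2_inner (centered_translate P g y) (centered_translate P g' y)
      = L2_inner g g' - L2_inner (translate g y) (mean_translate P g')
        - L2_inner (mean_translate P g) (translate g' y)
        + L2_inner (mean_translate P g) (mean_translate P g')"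
    unfolding centered_translate_def[abs_def]
    using sq L2_inner_translate[OF g(1) g'(1), of y]
    by (simp add: L2_inner_diff_left L2_inner_diff_right sq_int_diff)
  then show ?thesis using b1[of y] b2 b3 by linarith
qed

end

section \<open>Deviations of a sample of kernels\<close>

lemma
  assumes K: "integrable lborel K" and H: "0 < H"
  shows integrable_rescale: "integrable lborel (rescale K H)"
    and integral_abs_rescale: "(LINT t|lborel. \<bar>rescale K H t\<bar>) = (LINT t|lborel. \<bar>K t\<bar>)"
proof -
  show "integrable lborel (rescale K H)"
    using lborel_integrable_real_affine[OF K, of "1 / H" 0] H
    by (simp add: rescale_def[abs_def])
  have "(LINT t|lborel. \<bar>K t\<bar>) = \<bar>1 / H\<bar> * (LINT t|lborel. \<bar>K (0 + (1 / H) * t)\<bar>)"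
    using lborel_integral_real_affine[of "1 / H" "\<lambda>t. \<bar>K t\<bar>" 0] H by simp
  then show "(LINT t|lborel. \<bar>rescale K H t\<bar>) = (LINT t|lborel. \<bar>K t\<bar>)"
    using H by (simp add: rescale_def abs_mult)
qed

lemma
  assumes K: "sq_int K" and H: "0 < H"
  shows sq_int_rescale: "sq_int (rescale K H)"
    and Lp_norm_rescale: "(Lp_norm 2 (rescale K H))\<^sup>2 = (Lp_norm 2 K)\<^sup>2 / H"
proof -
  have i: "integrable lborel (\<lambda>t. (K t)\<^sup>2)" and [measurable]: "K \<in> borel_measurable borel"
    using K by (auto simp: sq_int_def)
  show "sq_int (rescale K H)"
    using lborel_integrable_real_affine[OF i, of "1 / H" 0] H
    by (simp add: sq_int_def rescale_def[abs_def] power_divide)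
  have "(LINT t|lborel. (K t)\<^sup>2) = (1 / H) * (LINT t|lborel. (K (t / H))\<^sup>2)"
    using lborel_integral_real_affine[of "1 / H" "\<lambda>t. (K t)\<^sup>2" 0] H by simp
  then show "(Lp_norm 2 (rescale K H))\<^sup>2 = (Lp_norm 2 K)\<^sup>2 / H"
    using H unfolding Lp_norm_2_sq rescale_def
    by (simp add: power_divide power2_eq_square[of H])
qed

lemma centered_L2_mono: "centered_L2 P c \<phi> \<Longrightarrow> c \<le> c' \<Longrightarrow> centered_L2 P c' \<phi>"
  unfolding centered_L2_def by (meson order_trans)

text \<open>Every stochastic term ends up as a product of square roots of the rate and of an error; this splits it.\<close>

lemma weighted_AM_GM:
  fixes x y \<theta> :: real
  assumes "0 < \<theta>"
  shows "x * y \<le> \<theta> * x\<^sup>2 + y\<^sup>2 / (4 * \<theta>)"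
proof -
  have "0 \<le> (2 * \<theta> * x - y)\<^sup>2 / (4 * \<theta>)" using assms by simp
  also have "\<dots> = \<theta> * x\<^sup>2 + y\<^sup>2 / (4 * \<theta>) - x * y"
    using assms by (simp add: power2_eq_square field_simps)
  finally show ?thesis by simp
qed

text \<open>The sample is represented by a point \<open>x\<close> of the product space of \<open>n\<close> copies of the law \<open>P\<close>, whose coordinates are
  the observations; \<open>G\<close> is the set of candidate parameters and \<open>m\<close> the reference parameter.\<close>

locale kernel_sample = dominated_by_lborel P F for P F +
  fixes K f :: "real \<Rightarrow> real" and h :: "nat \<Rightarrow> real \<Rightarrow> real" and n :: nat and G :: "real set"
    and m lam :: real
  assumes n: "1 \<le> n" and finite_G: "finite G" and m: "m \<in> G"
    and K_sq: "sq_int K" and K_int: "integrable lborel K" and K_pos: "0 < Lp_norm 2 K"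
    and f_sq: "sq_int f"
    and hm_pos: "0 < h n m" and h_ge: "\<And>\<gamma> k. \<gamma> \<in> G \<Longrightarrow> k \<in> {1..n} \<Longrightarrow> h n m \<le> h k \<gamma>"
    and lam: "1 \<le> lam"
begin

abbreviation ker :: "real \<Rightarrow> nat \<Rightarrow> real \<Rightarrow> real" where
  "ker \<gamma> k \<equiv> rescale K (h k \<gamma>)"

abbreviation cent :: "real \<Rightarrow> nat \<Rightarrow> real \<Rightarrow> real \<Rightarrow> real" where
  "cent \<gamma> k \<equiv> centered_translate P (ker \<gamma> k)"

definition fbar :: "real \<Rightarrow> real \<Rightarrow> real" where
  "fbar \<gamma> t = (1 / real n) * (\<Sum>k=1..n. mean_translate P (ker \<gamma> k) t)"

definition variance_proxy :: real where
  "variance_proxy = F * (LINT t|lborel. \<bar>K t\<bar>)\<^sup>2"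

text \<open>Twice the sum of the contributions of variance and of boundedness to
  \<open>(Bernstein_scale v b n \<lambda>)\<^sup>2 \<lambda> / n\<^sup>2\<close>, with \<open>v\<close> the variance proxy and \<open>b\<close> the envelope of the centered kernels.\<close>

definition rate :: real where
  "rate = 2 * (variance_proxy * (lam\<^sup>2 / real n) + 4 * (Lp_norm 2 K)\<^sup>2 * (lam ^ 3 / ((real n)\<^sup>2 * h n m)))"

text \<open>The leading term of the mean squared norm of the noise.\<close>

definition stochastic_level :: "real \<Rightarrow> real" where
  "stochastic_level \<gamma> = (1 / (real n)\<^sup>2) * (\<Sum>k=1..n. (Lp_norm 2 (ker \<gamma> k))\<^sup>2)"

definition bias :: "real \<Rightarrow> real" where
  "bias \<gamma> = (Lp_norm 2 (\<lambda>t. fbar \<gamma> t - f t))\<^sup>2"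

definition loss :: "(nat \<Rightarrow> real) \<Rightarrow> real \<Rightarrow> real" where
  "loss x \<gamma> = (Lp_norm 2 (\<lambda>t. fhat K h n x \<gamma> t - f t))\<^sup>2"

text \<open>The kernels at the second parameter play the role of the vectors whose sum is conditioned on, hence
  their stochastic level governs the deviation.\<close>

definition offdiag_ok :: "(nat \<Rightarrow> real) \<Rightarrow> real \<Rightarrow> real \<Rightarrow> bool" where
  "offdiag_ok x \<gamma>' \<gamma> \<longleftrightarrow> \<bar>offdiag_form {1..n} (cent \<gamma>') (cent \<gamma>) x\<bar>
      \<le> 1152 * ((real n)\<^sup>2 * (sqrt rate * sqrt (stochastic_level \<gamma>)))"

definition linear_ok :: "(nat \<Rightarrow> real) \<Rightarrow> real \<Rightarrow> real \<Rightarrow> bool" where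
  "linear_ok x \<gamma>' \<gamma> \<longleftrightarrow> \<bar>\<Sum>k=1..n. L2_inner (cent \<gamma>' k (x k)) (\<lambda>t. fbar \<gamma> t - f t)\<bar>
      \<le> 24 * (real n * (sqrt rate * sqrt (bias \<gamma>)))"

definition deviations_ok :: "(nat \<Rightarrow> real) \<Rightarrow> real \<Rightarrow> bool" where
  "deviations_ok x \<gamma> \<longleftrightarrow> offdiag_ok x m \<gamma> \<and> offdiag_ok x \<gamma> \<gamma> \<and>
     linear_ok x \<gamma> m \<and> linear_ok x m \<gamma> \<and> linear_ok x \<gamma> \<gamma>"

lemma ker_facts:
  assumes "\<gamma> \<in> G" "k \<in> {1..n}"
  shows "0 < h k \<gamma>" "sq_int (ker \<gamma> k)" "integrable lborel (ker \<gamma> k)"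
    "(LINT t|lborel. \<bar>ker \<gamma> k t\<bar>) = (LINT t|lborel. \<bar>K t\<bar>)"
    "(Lp_norm 2 (ker \<gamma> k))\<^sup>2 = (Lp_norm 2 K)\<^sup>2 / h k \<gamma>"
proof -
  show h: "0 < h k \<gamma>" using h_ge[OF assms] hm_pos by linarith
  show "sq_int (ker \<gamma> k)" "integrable lborel (ker \<gamma> k)"
    "(LINT t|lborel. \<bar>ker \<gamma> k t\<bar>) = (LINT t|lborel. \<bar>K t\<bar>)"
    "(Lp_norm 2 (ker \<gamma> k))\<^sup>2 = (Lp_norm 2 K)\<^sup>2 / h k \<gamma>"
    using sq_int_rescale[OF K_sq h] integrable_rescale[OF K_int h] integral_abs_rescale[OF K_int h]
      Lp_norm_rescale[OF K_sq h] by blast+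
qed

definition envelope :: real where "envelope = 2 * (Lp_norm 2 K / sqrt (h n m))"

text \<open>The first bound is adapted to the bandwidth of each kernel and adds up to the stochastic level. The second
  one is uniform: no admissible bandwidth is smaller than \<open>h n m\<close>.\<close>

lemma cent_facts:
  assumes "\<gamma> \<in> G" "k \<in> {1..n}"
  shows "centered_L2 P (2 * Lp_norm 2 (ker \<gamma> k)) (cent \<gamma> k)"
    and "centered_L2 P envelope (cent \<gamma> k)"
    and "weak_variance_le P variance_proxy (cent \<gamma> k)"
    and "sq_int (cent \<gamma> k y)"
proof -
  note k = ker_facts[OF assms]
  show c: "centered_L2 P (2 * Lp_norm 2 (ker \<gamma> k)) (cent \<gamma> k)"
    by (rule centered_translate_field(1)[OF k(2,3)])
  have "(Lp_norm 2 (ker \<gamma> k))\<^sup>2 \<le> (Lp_norm 2 K / sqrt (h n m))\<^sup>2"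
    unfolding k(5) using h_ge[OF assms] hm_pos k(1)
    by (simp add: power_divide divide_left_mono)
  then have "Lp_norm 2 (ker \<gamma> k) \<le> Lp_norm 2 K / sqrt (h n m)"
    using hm_pos by (rule_tac power2_le_imp_le) auto
  then show "centered_L2 P envelope (cent \<gamma> k)"
    by (intro centered_L2_mono[OF c]) (simp add: envelope_def)
  show "weak_variance_le P variance_proxy (cent \<gamma> k)"
    using centered_translate_field(2)[OF k(2,3)] by (simp add: variance_proxy_def k(4))
  show "sq_int (cent \<gamma> k y)" using centered_L2D(2)[OF c] by simp
qed

lemma variance_proxy_nonneg: "0 \<le> variance_proxy"
  using F_nonneg by (simp add: variance_proxy_def)

lemma rate_nonneg: "0 \<le> rate"
  using variance_proxy_nonneg hm_pos lam by (simp add: rate_def)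

lemma envelope_pos: "0 < envelope"
  using K_pos hm_pos by (simp add: envelope_def)

lemma stochastic_level_pos: "\<gamma> \<in> G \<Longrightarrow> 0 < stochastic_level \<gamma>"
proof -
  assume \<gamma>: "\<gamma> \<in> G"
  have "0 < (\<Sum>k=1..n. (Lp_norm 2 (ker \<gamma> k))\<^sup>2)"
  proof (rule sum_pos)
    fix k assume k: "k \<in> {1..n}"
    then show "0 < (Lp_norm 2 (ker \<gamma> k))\<^sup>2" using ker_facts(1,5)[OF \<gamma> k] K_pos by simp
  qed (use n in auto)
  then show ?thesis using n by (simp add: stochastic_level_def)
qed

text \<open>The extra factor \<open>\<surd>\<lambda>\<close> comes from the deviation of the norm of the conditioning vector. It produces the
  exponents \<open>\<lambda>\<^sup>2\<close> and \<open>\<lambda>\<^sup>3\<close> in the rate.\<close>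

lemma Bernstein_scale_le_rate:
  "Bernstein_scale variance_proxy envelope (real n) lam * sqrt lam \<le> real n * sqrt rate"
proof (rule power2_le_imp_le)
  let ?v = variance_proxy and ?b = envelope
  have v: "0 \<le> ?v" by (rule variance_proxy_nonneg)
  have b2: "?b\<^sup>2 = 4 * ((Lp_norm 2 K)\<^sup>2 / h n m)"
    using hm_pos by (simp add: envelope_def power_mult_distrib power_divide)
  have sq: "(sqrt (?v * real n * lam))\<^sup>2 = ?v * real n * lam"
    using v lam by simp
  have "(Bernstein_scale ?v ?b (real n) lam)\<^sup>2 \<le> 2 * (?v * real n * lam) + 2 * (?b * lam)\<^sup>2"
    using sum_squares_bound[of "sqrt (?v * real n * lam)" "?b * lam"]
    unfolding Bernstein_scale_def power2_sum sq by linarith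
  then have "(Bernstein_scale ?v ?b (real n) lam * sqrt lam)\<^sup>2
      \<le> (2 * (?v * real n * lam) + 2 * (?b * lam)\<^sup>2) * lam"
    using lam by (simp add: power_mult_distrib mult_right_mono)
  also have "\<dots> = (real n)\<^sup>2 * rate"
    using n hm_pos unfolding rate_def power_mult_distrib b2
    by (simp add: power2_eq_square power3_eq_cube field_simps)
  finally show "(Bernstein_scale ?v ?b (real n) lam * sqrt lam)\<^sup>2 \<le> (real n * sqrt rate)\<^sup>2"
    using rate_nonneg by (simp add: power_mult_distrib)
qed (use rate_nonneg in simp)

lemma Bernstein_scale_le_rate_unscaled:
  "Bernstein_scale variance_proxy envelope (real n) lam \<le> real n * sqrt rate"
proof -
  have "0 \<le> Bernstein_scale variance_proxy envelope (real n) lam"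
    using variance_proxy_nonneg envelope_pos lam by (simp add: Bernstein_scale_def)
  then have "Bernstein_scale variance_proxy envelope (real n) lam * 1
      \<le> Bernstein_scale variance_proxy envelope (real n) lam * sqrt lam"
    using lam by (intro mult_left_mono) auto
  then show ?thesis using Bernstein_scale_le_rate by linarith
qed

lemma sq_int_fbar: "\<gamma> \<in> G \<Longrightarrow> sq_int (fbar \<gamma>)"
  unfolding fbar_def[abs_def]
  by (intro sq_int_cmult sq_int_sum sq_int_mean_translate ker_facts) auto

lemma sqrt_bias: "sqrt (bias \<gamma>) = Lp_norm 2 (\<lambda>t. fbar \<gamma> t - f t)"
  by (simp add: bias_def)

abbreviation (input) sample_law :: "(nat \<Rightarrow> real) measure" where
  "sample_law \<equiv> Pi\<^sub>M {1..n} (\<lambda>_. P)"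

lemma offdiag_ok_tail:
  assumes "\<gamma>' \<in> G" "\<gamma> \<in> G"
  shows "{x \<in> space sample_law. \<not> offdiag_ok x \<gamma>' \<gamma>} \<in> sets sample_law"
    and "measure sample_law {x \<in> space sample_law. \<not> offdiag_ok x \<gamma>' \<gamma>} \<le> exp (- lam)"
proof -
  interpret Q: prob_space sample_law by (rule prob_space_PiM_const[OF prob_space_axioms])
  let ?V = "4 * ((real n)\<^sup>2 * stochastic_level \<gamma>)"
  let ?\<beta> = "Bernstein_scale variance_proxy envelope (real (card {1..n})) lam"
  let ?U = "offdiag_form {1..n} (cent \<gamma>') (cent \<gamma>)"
  \<comment> \<open>the square of the factor \<open>2\<close> lost by centering\<close>
  have V: "(\<Sum>k\<in>{1..n}. (2 * Lp_norm 2 (ker \<gamma> k))\<^sup>2) \<le> ?V"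
    using n by (simp add: stochastic_level_def power_mult_distrib sum_distrib_left)
  have V0: "0 < ?V" using stochastic_level_pos[OF assms(2)] n by simp
  note T = offdiag_tail[where c="\<lambda>k. 2 * Lp_norm 2 (ker \<gamma> k)" and J="{1..n}" and \<phi>="cent \<gamma>" and
      \<psi>="cent \<gamma>'" and P=P, OF prob_space_axioms finite_atLeastAtMost cent_facts(1)[OF assms(2)]
      cent_facts(2)[OF assms(1)] cent_facts(3)[OF assms(1)] V V0 envelope_pos variance_proxy_nonneg lam]
  note T(1)[measurable]
  show s: "{x \<in> space sample_law. \<not> offdiag_ok x \<gamma>' \<gamma>} \<in> sets sample_law"
    unfolding offdiag_ok_def by measurable
  have "?\<beta> * sqrt (lam * ?V) = 2 * real n * sqrt (stochastic_level \<gamma>) * (?\<beta> * sqrt lam)"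
    by (simp add: real_sqrt_mult)
  also have "\<dots> \<le> 2 * real n * sqrt (stochastic_level \<gamma>) * (real n * sqrt rate)"
    using Bernstein_scale_le_rate stochastic_level_pos[OF assms(2)] by (intro mult_left_mono) auto
  finally have le: "576 * (?\<beta> * sqrt (lam * ?V)) \<le> 1152 * ((real n)\<^sup>2 * (sqrt rate * sqrt (stochastic_level \<gamma>)))"
    by (simp add: power2_eq_square mult_ac)
  have "Q.prob {x \<in> space sample_law. \<not> offdiag_ok x \<gamma>' \<gamma>}
      \<le> Q.prob {x \<in> space sample_law. 576 * (?\<beta> * sqrt (lam * ?V)) < \<bar>?U x\<bar>}"
  proof (rule Q.finite_measure_mono)
    show "{x \<in> space sample_law. \<not> offdiag_ok x \<gamma>' \<gamma>}
        \<subseteq> {x \<in> space sample_law. 576 * (?\<beta> * sqrt (lam * ?V)) < \<bar>?U x\<bar>}"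
      unfolding offdiag_ok_def not_le using le_less_trans[OF le] by blast
  qed measurable
  also have "\<dots> \<le> exp (- lam)" by (rule T(2))
  finally show "Q.prob {x \<in> space sample_law. \<not> offdiag_ok x \<gamma>' \<gamma>} \<le> exp (- lam)" .
qed

lemma linear_ok_tail:
  assumes "\<gamma>' \<in> G" "\<gamma> \<in> G"
  shows "{x \<in> space sample_law. \<not> linear_ok x \<gamma>' \<gamma>} \<in> sets sample_law"
    and "measure sample_law {x \<in> space sample_law. \<not> linear_ok x \<gamma>' \<gamma>} \<le> exp (- lam)"
proof -
  interpret Q: prob_space sample_law by (rule prob_space_PiM_const[OF prob_space_axioms])
  let ?u = "\<lambda>t. fbar \<gamma> t - f t"
  let ?\<beta> = "Bernstein_scale variance_proxy envelope (real (card {1..n})) lam"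
  let ?W = "\<lambda>x. \<Sum>k=1..n. L2_inner (cent \<gamma>' k (x k)) ?u"
  have u: "sq_int ?u" using sq_int_fbar[OF assms(2)] f_sq by auto
  note T = linear_tail[where J="{1..n}" and \<psi>="cent \<gamma>'" and P=P, OF prob_space_axioms finite_atLeastAtMost
      cent_facts(2)[OF assms(1)] cent_facts(3)[OF assms(1)] u envelope_pos variance_proxy_nonneg lam]
  note T(1)[measurable]
  show s: "{x \<in> space sample_law. \<not> linear_ok x \<gamma>' \<gamma>} \<in> sets sample_law"
    unfolding linear_ok_def by measurable
  have le: "24 * (?\<beta> * Lp_norm 2 ?u) \<le> 24 * (real n * (sqrt rate * sqrt (bias \<gamma>)))"
    using mult_right_mono[OF Bernstein_scale_le_rate_unscaled, of "Lp_norm 2 ?u"]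
    by (simp add: sqrt_bias mult_ac)
  have "Q.prob {x \<in> space sample_law. \<not> linear_ok x \<gamma>' \<gamma>}
      \<le> Q.prob {x \<in> space sample_law. 24 * (?\<beta> * Lp_norm 2 ?u) < \<bar>?W x\<bar>}"
  proof (rule Q.finite_measure_mono)
    show "{x \<in> space sample_law. \<not> linear_ok x \<gamma>' \<gamma>}
        \<subseteq> {x \<in> space sample_law. 24 * (?\<beta> * Lp_norm 2 ?u) < \<bar>?W x\<bar>}"
      unfolding linear_ok_def not_le using le_less_trans[OF le] by blast
  qed measurable
  also have "\<dots> \<le> exp (- lam)" by (rule T(2))
  finally show "Q.prob {x \<in> space sample_law. \<not> linear_ok x \<gamma>' \<gamma>} \<le> exp (- lam)" .
qed

text \<open>A union bound over five deviation events for each candidate.\<close>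

lemma deviations_ok_prob:
  obtains E where "E \<in> sets sample_law" "measure sample_law E \<le> 5 * real (card G) * exp (- lam)"
    "\<And>x \<gamma>. x \<in> space sample_law \<Longrightarrow> x \<notin> E \<Longrightarrow> \<gamma> \<in> G \<Longrightarrow> deviations_ok x \<gamma>"
proof -
  interpret Q: prob_space sample_law by (rule prob_space_PiM_const[OF prob_space_axioms])
  define A where "A = (\<lambda>\<gamma>. {x \<in> space sample_law. \<not> offdiag_ok x m \<gamma>})"
  define B where "B = (\<lambda>\<gamma>. {x \<in> space sample_law. \<not> offdiag_ok x \<gamma> \<gamma>})"
  define C where "C = (\<lambda>\<gamma>. {x \<in> space sample_law. \<not> linear_ok x \<gamma> m})"
  define D where "D = (\<lambda>\<gamma>. {x \<in> space sample_law. \<not> linear_ok x m \<gamma>})"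
  define E where "E = (\<lambda>\<gamma>. {x \<in> space sample_law. \<not> linear_ok x \<gamma> \<gamma>})"
  have s: "A \<gamma> \<in> Q.events" "B \<gamma> \<in> Q.events" "C \<gamma> \<in> Q.events" "D \<gamma> \<in> Q.events" "E \<gamma> \<in> Q.events"
    and t: "Q.prob (A \<gamma>) \<le> exp (- lam)" "Q.prob (B \<gamma>) \<le> exp (- lam)" "Q.prob (C \<gamma>) \<le> exp (- lam)"
      "Q.prob (D \<gamma>) \<le> exp (- lam)" "Q.prob (E \<gamma>) \<le> exp (- lam)"
    if "\<gamma> \<in> G" for \<gamma>
    unfolding A_def B_def C_def D_def E_def
    by (intro offdiag_ok_tail linear_ok_tail that m)+
  let ?S = "\<lambda>\<gamma>. A \<gamma> \<union> (B \<gamma> \<union> (C \<gamma> \<union> (D \<gamma> \<union> E \<gamma>)))"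
  have S: "Q.prob (?S \<gamma>) \<le> 5 * exp (- lam)" if "\<gamma> \<in> G" for \<gamma>
  proof -
    have "Q.prob (?S \<gamma>) \<le> Q.prob (A \<gamma>) + (Q.prob (B \<gamma>) + (Q.prob (C \<gamma>) + (Q.prob (D \<gamma>) + Q.prob (E \<gamma>))))"
      using s[OF that]
      by (intro order_trans[OF measure_Un_le] add_left_mono sets.Un) auto
    then show ?thesis using t[OF that] by linarith
  qed
  show thesis
  proof (rule that[of "\<Union>\<gamma>\<in>G. ?S \<gamma>"])
    show "(\<Union>\<gamma>\<in>G. ?S \<gamma>) \<in> Q.events" using s finite_G by (intro sets.finite_UN sets.Un) auto
    have "Q.prob (\<Union>\<gamma>\<in>G. ?S \<gamma>) \<le> (\<Sum>\<gamma>\<in>G. Q.prob (?S \<gamma>))"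
      using s finite_G by (intro Q.finite_measure_subadditive_finite) (auto intro!: sets.Un)
    also have "\<dots> \<le> (\<Sum>\<gamma>\<in>G. 5 * exp (- lam))" by (intro sum_mono S)
    also have "\<dots> = 5 * real (card G) * exp (- lam)" by simp
    finally show "Q.prob (\<Union>\<gamma>\<in>G. ?S \<gamma>) \<le> 5 * real (card G) * exp (- lam)" .
    fix x \<gamma> assume "x \<in> space sample_law" "x \<notin> (\<Union>\<gamma>\<in>G. ?S \<gamma>)" "\<gamma> \<in> G"
    then show "deviations_ok x \<gamma>"
      by (auto simp: deviations_ok_def A_def B_def C_def D_def E_def)
  qed
qed

end

section \<open>The oracle inequality on the deviation event\<close>

context kernel_sample
begin

lemma fhat_eq_translate:
  "fhat K h n x \<gamma> t = (1 / real n) * (\<Sum>k=1..n. translate (ker \<gamma> k) (x k) t)"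
  by (simp add: fhat_def translate_def rescale_def)

lemma fhat_minus_fbar:
  "fhat K h n x \<gamma> t - fbar \<gamma> t = (1 / real n) * (\<Sum>k=1..n. cent \<gamma> k (x k) t)"
  unfolding fhat_eq_translate fbar_def centered_translate_def
  by (simp add: sum_subtractf right_diff_distrib)

lemma sq_int_fhat: "\<gamma> \<in> G \<Longrightarrow> sq_int (fhat K h n x \<gamma>)"
  unfolding fhat_eq_translate[abs_def] by (intro sq_int_cmult sq_int_sum sq_int_translate ker_facts)

definition noise :: "(nat \<Rightarrow> real) \<Rightarrow> real \<Rightarrow> real \<Rightarrow> real" where
  "noise x \<gamma> t = (1 / real n) * (\<Sum>k=1..n. cent \<gamma> k (x k) t)"

text \<open>The deterministic error of the estimator; \<open>bias\<close> is its squared norm.\<close>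

definition drift :: "real \<Rightarrow> real \<Rightarrow> real" where
  "drift \<gamma> t = fbar \<gamma> t - f t"

lemma fhat_minus_f: "(\<lambda>t. fhat K h n x \<gamma> t - f t) = (\<lambda>t. noise x \<gamma> t + drift \<gamma> t)"
  using fhat_minus_fbar[of x \<gamma>] by (auto simp: noise_def drift_def fun_eq_iff algebra_simps)

lemma sq_int_noise: "\<gamma> \<in> G \<Longrightarrow> sq_int (noise x \<gamma>)"
  unfolding noise_def[abs_def] by (intro sq_int_cmult sq_int_sum cent_facts(4))

lemma sq_int_drift: "\<gamma> \<in> G \<Longrightarrow> sq_int (drift \<gamma>)"
  unfolding drift_def[abs_def] using sq_int_fbar f_sq by auto

lemma L2_inner_noise:
  assumes "\<gamma>' \<in> G" "\<gamma> \<in> G"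
  shows "L2_inner (noise x \<gamma>') (noise x \<gamma>) = (1 / (real n)\<^sup>2) *
    ((\<Sum>k=1..n. L2_inner (cent \<gamma>' k (x k)) (cent \<gamma> k (x k))) + offdiag_form {1..n} (cent \<gamma>') (cent \<gamma>) x)"
proof -
  let ?S = "\<lambda>\<gamma> t. \<Sum>k=1..n. cent \<gamma> k (x k) t"
  have "L2_inner (noise x \<gamma>') (noise x \<gamma>) = (1 / real n) * ((1 / real n) * L2_inner (?S \<gamma>') (?S \<gamma>))"
    unfolding noise_def[abs_def] L2_inner_cmult_left L2_inner_cmult_right ..
  also have "L2_inner (?S \<gamma>') (?S \<gamma>) = (\<Sum>k=1..n. L2_inner (cent \<gamma>' k (x k)) (?S \<gamma>))"
    by (intro L2_inner_sum_left sq_int_sum cent_facts(4) assms)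
  also have "\<dots> = (\<Sum>k=1..n. \<Sum>l=1..n. L2_inner (cent \<gamma>' k (x k)) (cent \<gamma> l (x l)))"
    by (intro sum.cong refl L2_inner_sum_right cent_facts(4) assms)
  also have "(\<Sum>k=1..n. \<Sum>l=1..n. L2_inner (cent \<gamma>' k (x k)) (cent \<gamma> l (x l)))
      = (\<Sum>k=1..n. L2_inner (cent \<gamma>' k (x k)) (cent \<gamma> k (x k))
          + (\<Sum>l\<in>{1..n} - {k}. L2_inner (cent \<gamma>' k (x k)) (cent \<gamma> l (x l))))"
    by (intro sum.cong refl sum.remove) auto
  also have "\<dots> = (\<Sum>k=1..n. L2_inner (cent \<gamma>' k (x k)) (cent \<gamma> k (x k)))
      + offdiag_form {1..n} (cent \<gamma>') (cent \<gamma>) x"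
    by (simp add: sum.distrib offdiag_form_def)
  finally show ?thesis by (simp add: power2_eq_square)
qed

text \<open>Here the form of the penalty is used: the diagonal part is deterministic up to \<open>O(1/n)\<close>, which the rate
  absorbs because \<open>1 \<le> \<lambda>\<^sup>2\<close>.\<close>

lemma diagonal_error:
  assumes "\<gamma>' \<in> G" "\<gamma> \<in> G"
  shows "\<bar>(1 / (real n)\<^sup>2) * (\<Sum>k=1..n. L2_inner (cent \<gamma>' k (x k)) (cent \<gamma> k (x k)))
    - (1 / (real n)\<^sup>2) * (\<Sum>k=1..n. L2_inner (ker \<gamma>' k) (ker \<gamma> k))\<bar> \<le> 2 * rate"
proof -
  have "\<bar>(\<Sum>k=1..n. L2_inner (cent \<gamma>' k (x k)) (cent \<gamma> k (x k))) - (\<Sum>k=1..n. L2_inner (ker \<gamma>' k) (ker \<gamma> k))\<bar>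
      \<le> (\<Sum>k=1..n. \<bar>L2_inner (cent \<gamma>' k (x k)) (cent \<gamma> k (x k)) - L2_inner (ker \<gamma>' k) (ker \<gamma> k)\<bar>)"
    unfolding sum_subtractf[symmetric] by (rule sum_abs)
  also have "\<dots> \<le> (\<Sum>k=1..n. 3 * variance_proxy)"
  proof (rule sum_mono)
    fix k assume k: "k \<in> {1..n}"
    show "\<bar>L2_inner (cent \<gamma>' k (x k)) (cent \<gamma> k (x k)) - L2_inner (ker \<gamma>' k) (ker \<gamma> k)\<bar> \<le> 3 * variance_proxy"
      using L2_inner_centered_translate[OF ker_facts(2,3)[OF assms(1) k] ker_facts(2,3)[OF assms(2) k], of "x k"]
      unfolding ker_facts(4)[OF assms(1) k] ker_facts(4)[OF assms(2) k]
      by (simp add: variance_proxy_def power2_eq_square mult_ac)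
  qed
  finally have "\<bar>(\<Sum>k=1..n. L2_inner (cent \<gamma>' k (x k)) (cent \<gamma> k (x k))) - (\<Sum>k=1..n. L2_inner (ker \<gamma>' k) (ker \<gamma> k))\<bar>
      \<le> real n * (3 * variance_proxy)" by simp
  then have "(1 / (real n)\<^sup>2) * \<bar>(\<Sum>k=1..n. L2_inner (cent \<gamma>' k (x k)) (cent \<gamma> k (x k))) - (\<Sum>k=1..n. L2_inner (ker \<gamma>' k) (ker \<gamma> k))\<bar>
      \<le> (1 / (real n)\<^sup>2) * (real n * (3 * variance_proxy))"
    by (rule mult_left_mono) simp
  also have "\<dots> = 3 * (variance_proxy * (1 / real n))"
    using n by (simp add: power2_eq_square)
  also have "\<dots> \<le> 2 * rate"
  proof -
    have "1 / real n \<le> lam\<^sup>2 / real n"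
      using lam n by (intro divide_right_mono) (auto simp: one_le_power)
    then have "variance_proxy * (1 / real n) \<le> variance_proxy * (lam\<^sup>2 / real n)"
      using variance_proxy_nonneg by (rule mult_left_mono)
    moreover have "0 \<le> 4 * (Lp_norm 2 K)\<^sup>2 * (lam ^ 3 / ((real n)\<^sup>2 * h n m))"
      using hm_pos lam by simp
    moreover have "0 \<le> variance_proxy * (lam\<^sup>2 / real n)" using variance_proxy_nonneg by simp
    ultimately show ?thesis unfolding rate_def distrib_left by linarith
  qed
  finally show ?thesis
    by (simp only: right_diff_distrib[symmetric] abs_mult) simp
qed

lemma L2_inner_noise_drift:
  assumes "\<gamma>' \<in> G" "\<gamma> \<in> G" "linear_ok x \<gamma>' \<gamma>"
  shows "\<bar>L2_inner (noise x \<gamma>') (drift \<gamma>)\<bar> \<le> 24 * (sqrt rate * sqrt (bias \<gamma>))"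
proof -
  have "L2_inner (noise x \<gamma>') (drift \<gamma>) = (1 / real n) * (\<Sum>k=1..n. L2_inner (cent \<gamma>' k (x k)) (drift \<gamma>))"
    unfolding noise_def[abs_def] L2_inner_cmult_left
    by (subst L2_inner_sum_left) (auto intro: cent_facts(4) sq_int_drift assms)
  then have "\<bar>L2_inner (noise x \<gamma>') (drift \<gamma>)\<bar>
      = (1 / real n) * \<bar>\<Sum>k=1..n. L2_inner (cent \<gamma>' k (x k)) (drift \<gamma>)\<bar>"
    by (simp add: abs_mult)
  also have "\<dots> \<le> (1 / real n) * (24 * (real n * (sqrt rate * sqrt (bias \<gamma>))))"
    using assms(3) unfolding linear_ok_def drift_def[abs_def] by (rule mult_left_mono) simp
  also have "\<dots> = 24 * (sqrt rate * sqrt (bias \<gamma>))" using n by simp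
  finally show ?thesis .
qed

lemma offdiag_bound:
  assumes "offdiag_ok x \<gamma>' \<gamma>"
  shows "\<bar>(1 / (real n)\<^sup>2) * offdiag_form {1..n} (cent \<gamma>') (cent \<gamma>) x\<bar>
    \<le> 1152 * (sqrt rate * sqrt (stochastic_level \<gamma>))"
proof -
  have "\<bar>(1 / (real n)\<^sup>2) * offdiag_form {1..n} (cent \<gamma>') (cent \<gamma>) x\<bar>
      = (1 / (real n)\<^sup>2) * \<bar>offdiag_form {1..n} (cent \<gamma>') (cent \<gamma>) x\<bar>"
    by (simp add: abs_mult)
  also have "\<dots> \<le> (1 / (real n)\<^sup>2) * (1152 * ((real n)\<^sup>2 * (sqrt rate * sqrt (stochastic_level \<gamma>))))"
    using assms unfolding offdiag_ok_def by (rule mult_left_mono) simp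
  also have "\<dots> = 1152 * (sqrt rate * sqrt (stochastic_level \<gamma>))" using n by simp
  finally show ?thesis .
qed

lemma bias_nonneg: "0 \<le> bias \<gamma>"
  by (simp add: bias_def)

lemma sqrt_product_le:
  assumes "0 < \<theta>" "0 \<le> y" "0 \<le> z" "0 \<le> c"
  shows "c * (sqrt z * sqrt y) \<le> \<theta> * y + c\<^sup>2 / 4 * (z / \<theta>)"
  using weighted_AM_GM[OF assms(1), of "sqrt y" "c * sqrt z"] assms
  by (simp add: power_mult_distrib mult_ac)

text \<open>The observed loss dominates both errors. In \<open>loss = |noise|\<^sup>2 + 2 \<langle>noise, drift\<rangle> + bias\<close> the first term is
  the stochastic level up to a diagonal error and an off-diagonal form, and half of each error absorbs the
  fluctuations. The constant is \<open>4 + 1152\<^sup>2 + 48\<^sup>2\<close>.\<close>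

lemma bias_plus_stochastic_level_le:
  assumes \<gamma>: "\<gamma> \<in> G" and ok: "deviations_ok x \<gamma>"
  shows "bias \<gamma> + stochastic_level \<gamma> \<le> 2 * loss x \<gamma> + 1329412 * rate"
proof -
  let ?D = "stochastic_level \<gamma>"
  let ?L = "L2_inner (noise x \<gamma>) (drift \<gamma>)"
  let ?U = "(1 / (real n)\<^sup>2) * offdiag_form {1..n} (cent \<gamma>) (cent \<gamma>) x"
  let ?\<Delta> = "(1 / (real n)\<^sup>2) * (\<Sum>k=1..n. L2_inner (cent \<gamma> k (x k)) (cent \<gamma> k (x k)))"
  have q: "loss x \<gamma> = L2_inner (noise x \<gamma>) (noise x \<gamma>) + 2 * ?L + bias \<gamma>"
    unfolding loss_def fhat_minus_f Lp_norm_2_add_sq[OF sq_int_noise[OF \<gamma>] sq_int_drift[OF \<gamma>]]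
    by (simp add: bias_def drift_def[abs_def] Lp_norm_2_sq_inner)
  have s: "L2_inner (noise x \<gamma>) (noise x \<gamma>) = ?\<Delta> + ?U"
    unfolding L2_inner_noise[OF \<gamma> \<gamma>] by (rule distrib_left)
  have d: "\<bar>?\<Delta> - ?D\<bar> \<le> 2 * rate"
    using diagonal_error[OF \<gamma> \<gamma>, of x] by (simp add: stochastic_level_def Lp_norm_2_sq_inner)
  have u: "\<bar>?U\<bar> \<le> 1152 * (sqrt rate * sqrt ?D)"
    using ok by (intro offdiag_bound) (simp add: deviations_ok_def)
  have l: "\<bar>?L\<bar> \<le> 24 * (sqrt rate * sqrt (bias \<gamma>))"
    using ok by (intro L2_inner_noise_drift \<gamma>) (simp add: deviations_ok_def)
  have "1152 * (sqrt rate * sqrt ?D) \<le> 1 / 2 * ?D + 1152\<^sup>2 / 4 * (rate / (1 / 2))"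
    using stochastic_level_pos[OF \<gamma>] rate_nonneg by (intro sqrt_product_le) auto
  moreover have "48 * (sqrt rate * sqrt (bias \<gamma>)) \<le> 1 / 2 * bias \<gamma> + 48\<^sup>2 / 4 * (rate / (1 / 2))"
    using bias_nonneg rate_nonneg by (intro sqrt_product_le) auto
  ultimately show ?thesis
    using q s d u l unfolding abs_le_iff by simp
qed

text \<open>The amount by which the criterion fails to be the loss, up to a sign, a factor \<open>2\<close> and a term independent
  of \<open>\<gamma>\<close>.\<close>

definition criterion_error :: "(nat \<Rightarrow> real) \<Rightarrow> real \<Rightarrow> real" where
  "criterion_error x \<gamma> = L2_inner (\<lambda>t. fhat K h n x \<gamma> t - f t) (\<lambda>t. fhat K h n x m t - f t)
     - (1 / (real n)\<^sup>2) * (\<Sum>k=1..n. L2_inner (ker m k) (ker \<gamma> k))"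

text \<open>The four terms of \<open>\<langle>noise \<gamma> + drift \<gamma>, noise m + drift m\<rangle>\<close> are split with weight \<open>\<theta>\<close> on the errors at \<open>\<gamma>\<close>.
  Placing \<open>\<gamma>\<close> second in the off-diagonal form matters: it brings in the stochastic level at \<open>\<gamma>\<close>, which the loss at
  \<open>\<gamma>\<close> dominates, and not the one at \<open>m\<close>.\<close>

lemma criterion_error_le:
  assumes \<gamma>: "\<gamma> \<in> G" and ok: "deviations_ok x \<gamma>" and \<theta>: "0 < \<theta>" "\<theta> \<le> 1"
  shows "\<bar>criterion_error x \<gamma>\<bar>
    \<le> 2 * \<theta> * loss x \<gamma> + 2 * bias m / \<theta> + 1661622 * rate / \<theta>"
proof -
  let ?D = "stochastic_level \<gamma>"
  let ?L1 = "L2_inner (noise x \<gamma>) (drift m)"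
  let ?L2 = "L2_inner (noise x m) (drift \<gamma>)"
  let ?b = "L2_inner (drift \<gamma>) (drift m)"
  let ?U = "(1 / (real n)\<^sup>2) * offdiag_form {1..n} (cent m) (cent \<gamma>) x"
  let ?\<Delta> = "(1 / (real n)\<^sup>2) * (\<Sum>k=1..n. L2_inner (cent m k (x k)) (cent \<gamma> k (x k)))"
  let ?p = "(1 / (real n)\<^sup>2) * (\<Sum>k=1..n. L2_inner (ker m k) (ker \<gamma> k))"
  note sq = sq_int_noise[OF \<gamma>, of x] sq_int_noise[OF m, of x] sq_int_drift[OF \<gamma>] sq_int_drift[OF m]
  have "L2_inner (\<lambda>t. noise x \<gamma> t + drift \<gamma> t) (\<lambda>t. noise x m t + drift m t)
      = L2_inner (noise x m) (noise x \<gamma>) + ?L1 + ?L2 + ?b"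
    using sq by (simp add: L2_inner_add_left L2_inner_add_right sq_int_add
        L2_inner_commute[of "noise x \<gamma>" "noise x m"] L2_inner_commute[of "drift \<gamma>" "noise x m"])
  moreover have "L2_inner (noise x m) (noise x \<gamma>) = ?\<Delta> + ?U"
    unfolding L2_inner_noise[OF m \<gamma>] by (rule distrib_left)
  ultimately have e: "criterion_error x \<gamma> = (?\<Delta> - ?p) + ?U + ?L1 + ?L2 + ?b"
    unfolding criterion_error_def fhat_minus_f by linarith
  have d: "\<bar>?\<Delta> - ?p\<bar> \<le> 2 * rate" by (rule diagonal_error[OF m \<gamma>])
  have u: "\<bar>?U\<bar> \<le> 1152 * (sqrt rate * sqrt ?D)"
    using ok by (intro offdiag_bound) (simp add: deviations_ok_def)
  have l1: "\<bar>?L1\<bar> \<le> 24 * (sqrt rate * sqrt (bias m))"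
    using ok by (intro L2_inner_noise_drift \<gamma> m) (simp add: deviations_ok_def)
  have l2: "\<bar>?L2\<bar> \<le> 24 * (sqrt rate * sqrt (bias \<gamma>))"
    using ok by (intro L2_inner_noise_drift \<gamma> m) (simp add: deviations_ok_def)
  have b: "\<bar>?b\<bar> \<le> 1 * (sqrt (bias m) * sqrt (bias \<gamma>))"
    using L2_Cauchy_Schwarz[OF sq(3,4)] by (simp add: bias_def drift_def[abs_def] mult.commute)
  have i1: "1152 * (sqrt rate * sqrt ?D) \<le> \<theta> * ?D + 1152\<^sup>2 / 4 * (rate / \<theta>)"
    using stochastic_level_pos[OF \<gamma>] rate_nonneg \<theta> by (intro sqrt_product_le) auto
  have i2: "24 * (sqrt rate * sqrt (bias m)) \<le> 1 * bias m + 24\<^sup>2 / 4 * (rate / 1)"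
    using bias_nonneg rate_nonneg by (intro sqrt_product_le) auto
  have i3: "24 * (sqrt rate * sqrt (bias \<gamma>)) \<le> \<theta> / 2 * bias \<gamma> + 24\<^sup>2 / 4 * (rate / (\<theta> / 2))"
    using bias_nonneg rate_nonneg \<theta> by (intro sqrt_product_le) auto
  have i4: "1 * (sqrt (bias m) * sqrt (bias \<gamma>)) \<le> \<theta> / 2 * bias \<gamma> + 1\<^sup>2 / 4 * (bias m / (\<theta> / 2))"
    using bias_nonneg \<theta> by (intro sqrt_product_le) auto
  have r: "rate \<le> rate / \<theta>" and bm: "bias m \<le> bias m / \<theta>"
    using \<theta> rate_nonneg bias_nonneg[of m] by (simp_all add: le_divide_eq mult_left_le)
  have j3: "rate / (\<theta> / 2) = 2 * (rate / \<theta>)" and j4: "bias m / (\<theta> / 2) = 2 * (bias m / \<theta>)"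
    by simp_all
  have "\<bar>criterion_error x \<gamma>\<bar> \<le> \<theta> * (bias \<gamma> + ?D) + 2 * (bias m / \<theta>) + 332210 * (rate / \<theta>)"
  proof -
    have c: "1152\<^sup>2 / 4 = (331776 :: real)" "24\<^sup>2 / 4 = (144 :: real)" "1\<^sup>2 / 4 = (1 / 4 :: real)" by simp_all
    have "\<bar>criterion_error x \<gamma>\<bar> \<le> \<bar>?\<Delta> - ?p\<bar> + \<bar>?U\<bar> + \<bar>?L1\<bar> + \<bar>?L2\<bar> + \<bar>?b\<bar>"
      unfolding e by linarith
    then show ?thesis
      unfolding distrib_left
      using d u l1 l2 b i1[unfolded c] i2[unfolded c] i3[unfolded c j3] i4[unfolded c j4] r bm bias_nonneg[of m]
      by linarith
  qed
  also have "\<theta> * (bias \<gamma> + ?D) \<le> \<theta> * (2 * loss x \<gamma> + 1329412 * rate)"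
    using bias_plus_stochastic_level_le[OF \<gamma> ok] \<theta> by (intro mult_left_mono) auto
  also have "\<dots> \<le> 2 * \<theta> * loss x \<gamma> + 1329412 * (rate / \<theta>)"
  proof -
    have "\<theta> * rate \<le> 1 * rate" using \<theta> rate_nonneg by (intro mult_right_mono) auto
    then show ?thesis using r by (simp add: distrib_left)
  qed
  finally show ?thesis by simp
qed

lemma Crit_eq:
  assumes "\<gamma> \<in> G" "m = Max (\<Gamma> n)"
  shows "Crit K h \<Gamma> n x \<gamma> = loss x \<gamma> + loss x m - 2 * criterion_error x \<gamma>"
proof -
  let ?A = "\<lambda>\<gamma> t. fhat K h n x \<gamma> t - f t"
  have "(\<lambda>t. fhat K h n x \<gamma> t - fhat K h n x m t) = (\<lambda>t. ?A \<gamma> t - ?A m t)" by simp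
  moreover have "sq_int (?A \<gamma>)" "sq_int (?A m)"
    using sq_int_fhat assms m f_sq by auto
  ultimately have "(Lp_norm 2 (\<lambda>t. fhat K h n x \<gamma> t - fhat K h n x m t))\<^sup>2
      = (Lp_norm 2 (?A \<gamma>))\<^sup>2 - 2 * L2_inner (?A \<gamma>) (?A m) + (Lp_norm 2 (?A m))\<^sup>2"
    by (simp only: Lp_norm_2_diff_sq)
  then show ?thesis
    unfolding Crit_def pen_def criterion_error_def loss_def assms(2)[symmetric]
    by simp
qed

lemma oracle_inequality_on_deviations:
  assumes \<gamma>: "\<gamma> \<in> G" and g: "g \<in> G" and ok: "deviations_ok x \<gamma>" "deviations_ok x g"
    and m_Max: "m = Max (\<Gamma> n)" and min: "Crit K h \<Gamma> n x g \<le> Crit K h \<Gamma> n x \<gamma>"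
    and \<epsilon>: "0 < \<epsilon>" "\<epsilon> < 1"
  shows "loss x g \<le> (1 + \<epsilon>) * loss x \<gamma> + 200 / \<epsilon> * bias m + 150000000 / \<epsilon> * rate"
proof -
  \<comment> \<open>small enough for \<open>(1 + 4 \<theta>) / (1 - 4 \<theta>) \<le> 1 + \<epsilon>\<close>\<close>
  define \<theta> where "\<theta> = \<epsilon> / 16"
  have \<theta>: "0 < \<theta>" "\<theta> \<le> 1" using \<epsilon> by (auto simp: \<theta>_def)
  let ?R = "8 * (bias m / \<theta>) + 6646488 * (rate / \<theta>)"
  have b: "\<bar>criterion_error x g\<bar> \<le> 2 * \<theta> * loss x g + 2 * (bias m / \<theta>) + 1661622 * (rate / \<theta>)"
    "\<bar>criterion_error x \<gamma>\<bar> \<le> 2 * \<theta> * loss x \<gamma> + 2 * (bias m / \<theta>) + 1661622 * (rate / \<theta>)"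
    using criterion_error_le[OF g ok(2) \<theta>] criterion_error_le[OF \<gamma> ok(1) \<theta>] by simp_all
  have le: "loss x g \<le> loss x \<gamma> + 2 * criterion_error x g - 2 * criterion_error x \<gamma>"
    using min unfolding Crit_eq[where \<Gamma>=\<Gamma>, OF g m_Max] Crit_eq[where \<Gamma>=\<Gamma>, OF \<gamma> m_Max] by simp
  have "loss x g \<le> loss x \<gamma> + 4 * (\<theta> * loss x g) + 4 * (\<theta> * loss x \<gamma>) + ?R"
    using le b unfolding abs_le_iff by simp
  then have "(1 - \<epsilon> / 4) * loss x g \<le> (1 + \<epsilon> / 4) * loss x \<gamma> + ?R"
    by (simp add: \<theta>_def algebra_simps)
  moreover have "(1 + \<epsilon> / 4) * loss x \<gamma> \<le> (1 - \<epsilon> / 4) * ((1 + \<epsilon>) * loss x \<gamma>)"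
  proof -
    have "1 + \<epsilon> / 4 \<le> (1 - \<epsilon> / 4) * (1 + \<epsilon>)"
    proof -
      have "(1 - \<epsilon> / 4) * (1 + \<epsilon>) - (1 + \<epsilon> / 4) = \<epsilon> * (2 - \<epsilon>) / 4"
        by (simp add: field_simps)
      moreover have "0 \<le> \<epsilon> * (2 - \<epsilon>) / 4" using \<epsilon> by simp
      ultimately show ?thesis by linarith
    qed
    then have "(1 + \<epsilon> / 4) * loss x \<gamma> \<le> ((1 - \<epsilon> / 4) * (1 + \<epsilon>)) * loss x \<gamma>"
      by (rule mult_right_mono) (simp add: loss_def)
    then show ?thesis by (simp add: mult.assoc)
  qed
  moreover have "?R \<le> (1 - \<epsilon> / 4) * (200 / \<epsilon> * bias m + 150000000 / \<epsilon> * rate)"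
  proof -
    have "?R = 128 * (bias m / \<epsilon>) + 106343808 * (rate / \<epsilon>)" by (simp add: \<theta>_def)
    also have "\<dots> \<le> 150 * (bias m / \<epsilon>) + 112500000 * (rate / \<epsilon>)"
      using \<epsilon> bias_nonneg[of m] rate_nonneg by (intro add_mono mult_right_mono) auto
    also have "\<dots> = 3 / 4 * (200 / \<epsilon> * bias m + 150000000 / \<epsilon> * rate)" by simp
    also have "\<dots> \<le> (1 - \<epsilon> / 4) * (200 / \<epsilon> * bias m + 150000000 / \<epsilon> * rate)"
      using \<epsilon> bias_nonneg[of m] rate_nonneg by (intro mult_right_mono) auto
    finally show ?thesis .
  qed
  ultimately have "(1 - \<epsilon> / 4) * loss x g
      \<le> (1 - \<epsilon> / 4) * ((1 + \<epsilon>) * loss x \<gamma> + 200 / \<epsilon> * bias m + 150000000 / \<epsilon> * rate)"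
    by (simp add: distrib_left)
  then show ?thesis
    using \<epsilon> by (simp only: mult_le_cancel_left_pos)
qed

end

section \<open>Proof of the theorem\<close>

lemma Linf_norm_AE_bound:
  assumes "Linf_norm g < \<infinity>"
  obtains C where "0 \<le> C" "AE y in lborel. \<bar>g y\<bar> \<le> C"
proof -
  have ae: "AE y in lborel. ereal \<bar>g y\<bar> \<le> Linf_norm g"
    unfolding Linf_norm_def by (rule esssup_AE)
  show thesis
  proof (cases "Linf_norm g")
    case (real r)
    show thesis
    proof (rule that[of "max r 0"])
      show "AE y in lborel. \<bar>g y\<bar> \<le> max r 0"
        using ae by eventually_elim (simp add: real)
    qed simp
  next
    case PInf
    then show thesis using assms by simp
  next
    case MInf
    show thesis
    proof (rule that[of 0])
      show "AE y in lborel. \<bar>g y\<bar> \<le> 0"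
        using ae by eventually_elim (simp add: MInf)
    qed simp
  qed
qed

lemma sq_int_of_integrable_bounded:
  assumes g: "integrable lborel g" and C: "AE y in lborel. \<bar>g y\<bar> \<le> C" "0 \<le> C"
  shows "sq_int g"
  unfolding sq_int_def
proof
  show gm: "g \<in> borel_measurable borel" using g by auto
  show "integrable lborel (\<lambda>t. (g t)\<^sup>2)"
  proof (rule Bochner_Integration.integrable_bound[where f="\<lambda>t. C * \<bar>g t\<bar>"])
    show "AE t in lborel. norm ((g t)\<^sup>2) \<le> norm (C * \<bar>g t\<bar>)"
      using C(1)
    proof eventually_elim
      case (elim t)
      from mult_right_mono[OF elim, of "\<bar>g t\<bar>"] show ?case
        using C(2) by (simp add: power2_eq_square abs_mult)
    qed
  qed (use g gm in auto)
qed

lemma dominated_by_lborel_density: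
  assumes P: "prob_space (density lborel (\<lambda>x. ennreal (f x)))"
    and f: "f \<in> borel_measurable borel" "\<And>x. 0 \<le> f x" and F: "AE y in lborel. \<bar>f y\<bar> \<le> F" "0 \<le> F"
  shows "dominated_by_lborel (density lborel (\<lambda>x. ennreal (f x))) F"
proof -
  interpret prob_space "density lborel (\<lambda>x. ennreal (f x))" by fact
  show ?thesis
  proof
    fix q :: "real \<Rightarrow> ennreal" assume [measurable]: "q \<in> borel_measurable borel"
    note f(1)[measurable]
    have "(\<integral>\<^sup>+ y. q y \<partial>density lborel (\<lambda>x. ennreal (f x))) = (\<integral>\<^sup>+ y. ennreal (f y) * q y \<partial>lborel)"
      by (rule nn_integral_density) measurable
    also have "\<dots> \<le> (\<integral>\<^sup>+ y. ennreal F * q y \<partial>lborel)"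
    proof (rule nn_integral_mono_AE)
      show "AE y in lborel. ennreal (f y) * q y \<le> ennreal F * q y"
        using F(1) by eventually_elim (auto intro!: mult_right_mono ennreal_leI)
    qed
    also have "\<dots> = ennreal F * (\<integral>\<^sup>+ y. q y \<partial>lborel)"
      by (rule nn_integral_cmult) measurable
    finally show "(\<integral>\<^sup>+ y. q y \<partial>density lborel (\<lambda>x. ennreal (f x))) \<le> ennreal F * (\<integral>\<^sup>+ y. q y \<partial>lborel)" .
  qed (use F in auto)
qed

lemma integrable_probability_density:
  assumes P: "prob_space (density lborel (\<lambda>x. ennreal (f x)))"
    and f: "f \<in> borel_measurable borel" "\<And>x. 0 \<le> f x"
  shows "integrable lborel f"
proof (rule integrableI_bounded)
  note f(1)[measurable]
  have "(\<integral>\<^sup>+ y. norm (f y) \<partial>lborel) = emeasure (density lborel (\<lambda>x. ennreal (f x))) (space (density lborel (\<lambda>x. ennreal (f x))))"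
    using f(2) by (subst emeasure_density) (auto simp: indicator_def intro!: nn_integral_cong)
  also have "\<dots> = 1" by (rule prob_space.emeasure_space_1[OF P])
  finally show "(\<integral>\<^sup>+ y. norm (f y) \<partial>lborel) < \<infinity>" by simp
qed (use f in simp)

lemma Lp_norm_2_pos_of_integral:
  assumes "sq_int K" "(LINT y|lborel. K y) \<noteq> 0"
  shows "0 < Lp_norm 2 K"
proof (rule ccontr)
  assume "\<not> 0 < Lp_norm 2 K"
  then have "Lp_norm 2 K = 0" using Lp_norm_nonneg[of 2 K] by linarith
  then have "(LINT y|lborel. (K y)\<^sup>2) = 0" using Lp_norm_2_sq[of K] by simp
  then have "AE y in lborel. (K y)\<^sup>2 = 0"
    using assms(1) by (subst (asm) integral_nonneg_eq_0_iff_AE) (auto simp: sq_int_def)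
  then have "AE y in lborel. K y = 0" by eventually_elim simp
  then have "(LINT y|lborel. K y) = (LINT y|lborel. 0)"
    using sq_int_measurable[OF assms(1)]
      Bochner_Integration.integral_cong_AE[of K lborel "\<lambda>_. 0"] by simp
  then show False using assms(2) by simp
qed

lemma admissible_bandwidth_ge:
  assumes "admissible h \<Gamma> n" "\<gamma> \<in> \<Gamma> n" "k \<in> {1..n}"
  shows "h n (Max (\<Gamma> n)) \<le> h k \<gamma>"
proof -
  have fin: "finite (\<Gamma> n)" and sub: "\<Gamma> n \<subseteq> {0..1}" and anti: "antimono_on {0..1} (h n)"
    and ord: "\<And>\<gamma> i j. \<gamma> \<in> {0..1} \<Longrightarrow> i \<in> {1..n} \<Longrightarrow> j \<in> {1..n} \<Longrightarrow> i < j \<Longrightarrow> h j \<gamma> < h i \<gamma>"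
    using assms(1) by (auto simp: admissible_def)
  have "Max (\<Gamma> n) \<in> \<Gamma> n" using assms(2) fin by (intro Max_in) auto
  then have \<gamma>: "\<gamma> \<in> {0..1}" and m: "Max (\<Gamma> n) \<in> {0..1}"
    using assms(2) sub by blast+
  have "h n (Max (\<Gamma> n)) \<le> h n \<gamma>"
    using monotone_onD[OF anti \<gamma> m] Max_ge[OF fin assms(2)] by simp
  also have "\<dots> \<le> h k \<gamma>"
    using ord[OF \<gamma> assms(3), of n] assms(3) by (cases "k = n") auto
  finally show ?thesis .
qed

lemma fhat_joint_measurable:
  assumes "\<And>k. k \<in> {1..n} \<Longrightarrow> X k \<in> borel_measurable M" and [measurable]: "K \<in> borel_measurable borel"
  shows "(\<lambda>(\<omega>, t). fhat K h n (\<lambda>k. X k \<omega>) \<gamma> t) \<in> borel_measurable (M \<Otimes>\<^sub>M lborel)"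
  unfolding fhat_def case_prod_beta'
proof (intro borel_measurable_times borel_measurable_const borel_measurable_sum)
  fix k assume "k \<in> {1..n}"
  then have [measurable]: "X k \<in> borel_measurable M" by (rule assms(1))
  show "(\<lambda>z. K ((X k (fst z) - snd z) / h k \<gamma>)) \<in> borel_measurable (M \<Otimes>\<^sub>M lborel)"
    by measurable
qed

theorem proposition4p2:
  fixes f K :: "real \<Rightarrow> real"
    and h :: "nat \<Rightarrow> real \<Rightarrow> real"
    and \<Gamma> :: "nat \<Rightarrow> real set"
  assumes f_meas: "f \<in> borel_measurable borel"
    and f_nonneg: "\<And>x. 0 \<le> f x"
    and f_bdd: "Linf_norm f < \<infinity>"
    and K_sym: "\<And>y. K (- y) = K y"
    and K_0: "0 < K 0"
    and K_integrable: "integrable lborel K"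
    and K_integral: "(LINT y|lborel. K y) = 1"
    and h_pos: "\<And>k \<gamma>. 1 \<le> k \<Longrightarrow> \<gamma> \<in> {0..1} \<Longrightarrow> 0 < h k \<gamma>"
  shows "\<exists>c1 > 0. \<exists>c2 > 0. \<exists>c3 > 0.
    \<forall>(n::nat) (lam::real) (\<epsilon>::real) (M :: 'a measure) (X :: nat \<Rightarrow> 'a \<Rightarrow> real) (\<gamma>t :: 'a \<Rightarrow> real).
      1 \<le> n \<and> admissible h \<Gamma> n \<and>
      Linf_norm K * ereal (Lp_norm 1 K) / ereal (real n * h n (Max (\<Gamma> n))) \<le> 1 \<and>
      1 \<le> lam \<and> 0 < \<epsilon> \<and> \<epsilon> < 1 \<and>
      prob_space M \<and>
      prob_space.indep_vars M (\<lambda>_. borel) X {1..n} \<and>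
      (\<forall>k\<in>{1..n}. distributed M lborel (X k) (\<lambda>x. ennreal (f x))) \<and>
      \<gamma>t \<in> borel_measurable M \<and>
      (\<forall>\<omega>\<in>space M. is_arg_min (Crit K h \<Gamma> n (\<lambda>k. X k \<omega>)) (\<lambda>\<gamma>. \<gamma> \<in> \<Gamma> n) (\<gamma>t \<omega>))
      \<longrightarrow>
      measure M {\<omega> \<in> space M.
          (Lp_norm 2 (\<lambda>x. fhat K h n (\<lambda>k. X k \<omega>) (\<gamma>t \<omega>) x - f x))\<^sup>2
          \<le> (1 + \<epsilon>) * (MIN \<gamma>\<in>\<Gamma> n. (Lp_norm 2 (\<lambda>x. fhat K h n (\<lambda>k. X k \<omega>) \<gamma> x - f x))\<^sup>2)
            + (c2 / \<epsilon>) * (Lp_norm 2 (\<lambda>x. fmean K h n M X (Max (\<Gamma> n)) x - f x))\<^sup>2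
            + (c3 / \<epsilon>) * (lam\<^sup>2 / real n + lam ^ 3 / ((real n)\<^sup>2 * h n (Max (\<Gamma> n))))}
        > 1 - c1 * real (card (\<Gamma> n)) * exp (- lam)"
proof -
  obtain F where F: "0 \<le> F" "AE y in lborel. \<bar>f y\<bar> \<le> F"
    using Linf_norm_AE_bound[OF f_bdd] .
  define C where "C = 2 * (F * (LINT t|lborel. \<bar>K t\<bar>)\<^sup>2 + 4 * (Lp_norm 2 K)\<^sup>2) + 1"
  define c3 where "c3 = 150000000 * C"
  have C: "0 < C" using F by (simp add: C_def add_nonneg_pos)
  have L1: "1 \<le> (LINT t|lborel. \<bar>K t\<bar>)"
    using integral_mono[of lborel K "\<lambda>t. \<bar>K t\<bar>"] K_integrable K_integral by simp
  let ?P = "density lborel (\<lambda>x. ennreal (f x))"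
  have "1 - 6 * real (card (\<Gamma> n)) * exp (- lam) < measure M {\<omega> \<in> space M.
          (Lp_norm 2 (\<lambda>x. fhat K h n (\<lambda>k. X k \<omega>) (\<gamma>t \<omega>) x - f x))\<^sup>2
          \<le> (1 + \<epsilon>) * (MIN \<gamma>\<in>\<Gamma> n. (Lp_norm 2 (\<lambda>x. fhat K h n (\<lambda>k. X k \<omega>) \<gamma> x - f x))\<^sup>2)
            + (200 / \<epsilon>) * (Lp_norm 2 (\<lambda>x. fmean K h n M X (Max (\<Gamma> n)) x - f x))\<^sup>2
            + (c3 / \<epsilon>) * (lam\<^sup>2 / real n + lam ^ 3 / ((real n)\<^sup>2 * h n (Max (\<Gamma> n))))}"
    (is "_ < measure M ?good")
    if n: "1 \<le> n" and adm: "admissible h \<Gamma> n"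
      and ratio: "Linf_norm K * ereal (Lp_norm 1 K) / ereal (real n * h n (Max (\<Gamma> n))) \<le> 1"
      and lam: "1 \<le> lam" and \<epsilon>: "0 < \<epsilon>" "\<epsilon> < 1"
      and M: "prob_space M" and ind: "prob_space.indep_vars M (\<lambda>_. borel) X {1..n}"
      and X: "\<forall>k\<in>{1..n}. distributed M lborel (X k) (\<lambda>x. ennreal (f x))"
      and \<gamma>t_meas: "\<gamma>t \<in> borel_measurable M"
      and arg_min: "\<forall>\<omega>\<in>space M. is_arg_min (Crit K h \<Gamma> n (\<lambda>k. X k \<omega>)) (\<lambda>\<gamma>. \<gamma> \<in> \<Gamma> n) (\<gamma>t \<omega>)"
    for n lam \<epsilon> and M :: "'a measure" and X :: "nat \<Rightarrow> 'a \<Rightarrow> real" and \<gamma>t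
  proof -
    interpret M: prob_space M by fact
    let ?m = "Max (\<Gamma> n)"
    have G: "finite (\<Gamma> n)" "\<Gamma> n \<noteq> {}" "\<Gamma> n \<subseteq> {0..1}" "1 \<le> card (\<Gamma> n)"
      using adm by (auto simp: admissible_def)
    have m: "?m \<in> \<Gamma> n" using G by simp
    have hm: "0 < h n ?m" using h_pos[OF n subsetD[OF G(3) m]] .
    have "Linf_norm K < \<infinity>"
    proof (rule ccontr)
      assume "\<not> Linf_norm K < \<infinity>"
      then have "Linf_norm K = \<infinity>" by simp
      then show False using ratio L1 hm n by (simp add: Lp_norm_1)
    qed
    then obtain CK where CK: "0 \<le> CK" "AE y in lborel. \<bar>K y\<bar> \<le> CK"
      using Linf_norm_AE_bound by blast
    have K_sq: "sq_int K" by (rule sq_int_of_integrable_bounded[OF K_integrable CK(2,1)])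
    have K_meas: "K \<in> borel_measurable borel" using K_sq by (rule sq_int_measurable)
    have Xm: "X k \<in> borel_measurable M" and XP: "distr M borel (X k) = ?P" if "k \<in> {1..n}" for k
    proof -
      have d: "distributed M lborel (X k) (\<lambda>x. ennreal (f x))" using X that by blast
      show "X k \<in> borel_measurable M" using distributed_measurable[OF d] by simp
      have "distr M borel (X k) = distr M lborel (X k)" by (rule distr_cong) auto
      then show "distr M borel (X k) = ?P" using distributed_distr_eq_density[OF d] by simp
    qed
    have P: "prob_space ?P"
      using M.prob_space_distr[OF Xm[of 1]] XP[of 1] n by simp
    have f_sq: "sq_int f"
      by (rule sq_int_of_integrable_bounded[OF integrable_probability_density[OF P f_meas f_nonneg] F(2,1)])
    interpret S: kernel_sample ?P F K f h n "\<Gamma> n" ?m lam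
    proof (intro kernel_sample.intro kernel_sample_axioms.intro)
      show "dominated_by_lborel ?P F"
        by (rule dominated_by_lborel_density[OF P f_meas f_nonneg F(2,1)])
      show "0 < Lp_norm 2 K" using K_sq K_integral by (intro Lp_norm_2_pos_of_integral) auto
    qed (use n G m K_sq K_integrable f_sq hm lam admissible_bandwidth_ge[OF adm] in auto)

    let ?Q = "Pi\<^sub>M {1..n} (\<lambda>_. ?P)"
    let ?X = "\<lambda>\<omega>. \<lambda>k\<in>{1..n}. X k \<omega>"
    have Q: "distr M (Pi\<^sub>M {1..n} (\<lambda>_. borel)) ?X = ?Q"
    proof -
      have "distr M (Pi\<^sub>M {1..n} (\<lambda>_. borel)) ?X = Pi\<^sub>M {1..n} (\<lambda>k. distr M borel (X k))"
        using M.indep_vars_iff_distr_eq_PiM'[of "{1..n}" X "\<lambda>_. borel"] Xm ind n by auto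
      also have "\<dots> = ?Q" by (rule PiM_cong) (simp_all add: XP)
      finally show ?thesis .
    qed
    have Xv: "?X \<in> M \<rightarrow>\<^sub>M Pi\<^sub>M {1..n} (\<lambda>_. borel)"
      using Xm by (intro measurable_restrict) auto
    have sets_Q: "sets ?Q = sets (Pi\<^sub>M {1..n} (\<lambda>_. borel))"
      by (intro sets_PiM_cong) auto
    have fhat_X: "fhat K h n (?X \<omega>) = fhat K h n (\<lambda>k. X k \<omega>)" for \<omega>
      by (intro ext) (simp add: fhat_def)
    have Crit_X: "Crit K h \<Gamma> n (?X \<omega>) = Crit K h \<Gamma> n (\<lambda>k. X k \<omega>)" for \<omega>
      by (intro ext) (simp only: Crit_def fhat_X)
    have loss_X: "S.loss (?X \<omega>) \<gamma> = (Lp_norm 2 (\<lambda>x. fhat K h n (\<lambda>k. X k \<omega>) \<gamma> x - f x))\<^sup>2" for \<omega> \<gamma>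
      by (simp only: S.loss_def fhat_X)
    have fmean: "fmean K h n M X \<gamma> = S.fbar \<gamma>" if \<gamma>: "\<gamma> \<in> \<Gamma> n" for \<gamma>
    proof
      fix t
      have one: "integrable M (\<lambda>\<omega>. (1 / h k \<gamma>) * K ((X k \<omega> - t) / h k \<gamma>))"
        "(LINT \<omega>|M. (1 / h k \<gamma>) * K ((X k \<omega> - t) / h k \<gamma>)) = mean_translate ?P (rescale K (h k \<gamma>)) t"
        if k: "k \<in> {1..n}" for k
      proof -
        let ?g = "\<lambda>y. (1 / h k \<gamma>) * K ((y - t) / h k \<gamma>)"
        have gm: "?g \<in> borel_measurable borel" using K_meas by measurable
        have "integrable ?P ?g"
          using S.integrable_translate_P(1)[OF S.ker_facts(2,3)[OF \<gamma> k], of t]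
          by (simp add: translate_def rescale_def)
        then show "integrable M (\<lambda>\<omega>. ?g (X k \<omega>))"
          unfolding XP[OF k, symmetric] by (subst (asm) integrable_distr_eq[OF Xm[OF k] gm])
        show "(LINT \<omega>|M. ?g (X k \<omega>)) = mean_translate ?P (rescale K (h k \<gamma>)) t"
          using integral_distr[OF Xm[OF k] gm, symmetric] XP[OF k]
          by (simp add: mean_translate_def translate_def rescale_def)
      qed
      show "fmean K h n M X \<gamma> t = S.fbar \<gamma> t"
        unfolding fmean_def fhat_def S.fbar_def using one
        by (simp add: Bochner_Integration.integral_sum)
    qed
    have rate: "S.rate \<le> C * (lam\<^sup>2 / real n + lam ^ 3 / ((real n)\<^sup>2 * h n ?m))"
    proof -
      let ?a = "lam\<^sup>2 / real n" and ?b = "lam ^ 3 / ((real n)\<^sup>2 * h n ?m)"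
      have nn: "0 \<le> ?a" "0 \<le> ?b" using lam hm by auto
      have "2 * S.variance_proxy \<le> C" "8 * (Lp_norm 2 K)\<^sup>2 \<le> C"
        using F S.variance_proxy_nonneg by (auto simp: C_def S.variance_proxy_def)
      then have "2 * S.variance_proxy * ?a + 8 * (Lp_norm 2 K)\<^sup>2 * ?b \<le> C * ?a + C * ?b"
        using nn by (intro add_mono mult_right_mono)
      then show ?thesis by (simp add: S.rate_def distrib_left mult.assoc)
    qed

    \<comment> \<open>the deviation event lives on the product space and is pulled back along the sample\<close>
    obtain E where E: "E \<in> sets ?Q" "measure ?Q E \<le> 5 * real (card (\<Gamma> n)) * exp (- lam)"
      "\<And>x \<gamma>. x \<in> space ?Q \<Longrightarrow> x \<notin> E \<Longrightarrow> \<gamma> \<in> \<Gamma> n \<Longrightarrow> S.deviations_ok x \<gamma>"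
      using S.deviations_ok_prob by blast
    define B where "B = ?X -` E \<inter> space M"
    have E': "E \<in> sets (Pi\<^sub>M {1..n} (\<lambda>_. borel))" using E(1) sets_Q by simp
    have B: "B \<in> M.events" unfolding B_def by (rule measurable_sets[OF Xv E'])
    have PB: "M.prob B \<le> 5 * real (card (\<Gamma> n)) * exp (- lam)"
      using E(2) measure_distr[OF Xv E'] unfolding Q B_def by simp

    define L where "L = (\<lambda>\<gamma> \<omega>. (Lp_norm 2 (\<lambda>x. fhat K h n (\<lambda>k. X k \<omega>) \<gamma> x - f x))\<^sup>2)"
    define r where "r = (200 / \<epsilon>) * (Lp_norm 2 (\<lambda>x. fmean K h n M X ?m x - f x))\<^sup>2
        + (c3 / \<epsilon>) * (lam\<^sup>2 / real n + lam ^ 3 / ((real n)\<^sup>2 * h n ?m))"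
    have \<gamma>t: "\<gamma>t \<omega> \<in> \<Gamma> n" if "\<omega> \<in> space M" for \<omega>
      using arg_min that by (auto simp: is_arg_min_def)
    have min_iff: "a \<le> (1 + \<epsilon>) * (MIN \<gamma>\<in>\<Gamma> n. L \<gamma> \<omega>) + r \<longleftrightarrow> (\<forall>\<gamma>\<in>\<Gamma> n. a \<le> (1 + \<epsilon>) * L \<gamma> \<omega> + r)" for a \<omega>
    proof
      assume a: "a \<le> (1 + \<epsilon>) * (MIN \<gamma>\<in>\<Gamma> n. L \<gamma> \<omega>) + r"
      show "\<forall>\<gamma>\<in>\<Gamma> n. a \<le> (1 + \<epsilon>) * L \<gamma> \<omega> + r"
      proof
        fix \<gamma> assume "\<gamma> \<in> \<Gamma> n"
        then have "(MIN \<gamma>\<in>\<Gamma> n. L \<gamma> \<omega>) \<le> L \<gamma> \<omega>" using G by (intro Min_le) auto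
        then have "(1 + \<epsilon>) * (MIN \<gamma>\<in>\<Gamma> n. L \<gamma> \<omega>) \<le> (1 + \<epsilon>) * L \<gamma> \<omega>"
          using \<epsilon> by (intro mult_left_mono) auto
        then show "a \<le> (1 + \<epsilon>) * L \<gamma> \<omega> + r" using a by linarith
      qed
    next
      assume a: "\<forall>\<gamma>\<in>\<Gamma> n. a \<le> (1 + \<epsilon>) * L \<gamma> \<omega> + r"
      have "(MIN \<gamma>\<in>\<Gamma> n. L \<gamma> \<omega>) \<in> (\<lambda>\<gamma>. L \<gamma> \<omega>) ` \<Gamma> n" using G by (intro Min_in) auto
      then show "a \<le> (1 + \<epsilon>) * (MIN \<gamma>\<in>\<Gamma> n. L \<gamma> \<omega>) + r" using a by auto
    qed
    have good: "?good = {\<omega> \<in> space M. \<forall>\<gamma>\<in>\<Gamma> n. L (\<gamma>t \<omega>) \<omega> \<le> (1 + \<epsilon>) * L \<gamma> \<omega> + r}"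
      unfolding min_iff[symmetric] by (simp add: L_def r_def add.assoc)
    have Lm [measurable]: "L \<gamma> \<in> borel_measurable M" for \<gamma>
    proof -
      note f_meas[measurable] fhat_joint_measurable[where X=X and n=n and M=M, OF Xm K_meas, measurable]
      have "(\<lambda>(\<omega>, x). fhat K h n (\<lambda>k. X k \<omega>) \<gamma> x - f x) \<in> borel_measurable (M \<Otimes>\<^sub>M lborel)"
        by measurable
      from Lp_norm_2_measurable[OF this] show ?thesis unfolding L_def by measurable
    qed
    have good_meas: "?good \<in> M.events"
    proof -
      \<comment> \<open>\<open>\<gamma>t\<close> has finitely many values, so that the loss at the selected parameter is measurable\<close>
      define S where "S = (\<lambda>\<omega>. \<Sum>\<gamma>\<in>\<Gamma> n. if \<gamma>t \<omega> = \<gamma> then L \<gamma> \<omega> else 0)"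
      have [measurable]: "S \<in> borel_measurable M"
        unfolding S_def
      proof (rule borel_measurable_sum)
        note \<gamma>t_meas[measurable]
        show "(\<lambda>\<omega>. if \<gamma>t \<omega> = \<gamma> then L \<gamma> \<omega> else 0) \<in> borel_measurable M" for \<gamma>
          by measurable
      qed
      have "L (\<gamma>t \<omega>) \<omega> = S \<omega>" if "\<omega> \<in> space M" for \<omega>
        unfolding S_def using G(1) \<gamma>t[OF that] by simp
      then have eq: "?good = {\<omega> \<in> space M. \<forall>\<gamma>\<in>\<Gamma> n. S \<omega> \<le> (1 + \<epsilon>) * L \<gamma> \<omega> + r}"
        unfolding good by auto
      show ?thesis
        unfolding eq
      proof (rule sets.sets_Collect_finite_All[OF _ G(1)])
        show "{\<omega> \<in> space M. S \<omega> \<le> (1 + \<epsilon>) * L \<gamma> \<omega> + r} \<in> M.events" for \<gamma>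
          by measurable
      qed
    qed
    have sub: "space M - B \<subseteq> ?good"
    proof
      fix \<omega> assume \<omega>: "\<omega> \<in> space M - B"
      then have \<omega>M: "\<omega> \<in> space M" and nE: "?X \<omega> \<notin> E" by (auto simp: B_def)
      have sp: "?X \<omega> \<in> space ?Q" by (simp add: space_PiM)
      note ok = E(3)[OF sp nE]
      have "L (\<gamma>t \<omega>) \<omega> \<le> (1 + \<epsilon>) * L \<gamma> \<omega> + r" if \<gamma>: "\<gamma> \<in> \<Gamma> n" for \<gamma>
      proof -
        have "Crit K h \<Gamma> n (?X \<omega>) (\<gamma>t \<omega>) \<le> Crit K h \<Gamma> n (?X \<omega>) \<gamma>"
          using arg_min \<omega>M \<gamma> unfolding Crit_X by (auto simp: is_arg_min_def not_less)
        from S.oracle_inequality_on_deviations[OF \<gamma> \<gamma>t[OF \<omega>M] ok[OF \<gamma>] ok[OF \<gamma>t[OF \<omega>M]] refl this \<epsilon>]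
        have "L (\<gamma>t \<omega>) \<omega> \<le> (1 + \<epsilon>) * L \<gamma> \<omega> + 200 / \<epsilon> * S.bias ?m + 150000000 / \<epsilon> * S.rate"
          by (simp only: loss_X L_def)
        also have "150000000 / \<epsilon> * S.rate
            \<le> 150000000 / \<epsilon> * (C * (lam\<^sup>2 / real n + lam ^ 3 / ((real n)\<^sup>2 * h n ?m)))"
          using rate \<epsilon> by (intro mult_left_mono) auto
        also have "\<dots> = (c3 / \<epsilon>) * (lam\<^sup>2 / real n + lam ^ 3 / ((real n)\<^sup>2 * h n ?m))"
          by (simp add: c3_def)
        finally show ?thesis
          by (simp add: r_def S.bias_def fmean[OF m] add.assoc)
      qed
      then show "\<omega> \<in> ?good" unfolding good using \<omega>M by blast
    qed
    have "1 - 6 * real (card (\<Gamma> n)) * exp (- lam) < 1 - 5 * real (card (\<Gamma> n)) * exp (- lam)"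
      using G(4) by simp
    also have "\<dots> \<le> 1 - M.prob B" using PB by linarith
    also have "\<dots> = M.prob (space M - B)" using M.prob_compl[OF B] by simp
    also have "\<dots> \<le> M.prob ?good" by (rule M.finite_measure_mono[OF sub good_meas])
    finally show ?thesis .
  qed
  moreover have "0 < (6 :: real)" "0 < (200 :: real)" "0 < c3" using C by (auto simp: c3_def)
  ultimately show ?thesis by blast
qed

end
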